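(* Let $\Gamma$ be an arithmetic pointclass. Suppose there exists a class $C$ of $\Sigma_n$ generating indiscernibles for a theory $T$ such that for any $\vec c\in[C]^\omega$, any $\widetilde\Gamma$ game has a $\Sigma_n$-definable winning strategy in $\mathcal A_T[\vec c]$, the smallest transitive model of $T$ with $\vec c$ as an element. Then $\operatorname{Det}(\omega^2\text{-}\Pi^1_1+\Gamma)$.
   Context: Generating indiscernibles. $[C]^\omega$ is the set of strictly increasing $\omega$-sequences from $C$; $c_i$ is the $i$-th element of $\vec c$. A closed-unbounded class of ordinals $C$ is a class of $\Sigma_n$ generating indiscernibles for $T$ if for any $\vec c,\vec d\in[C]^\omega$, letting $\mathcal A_T[\vec c]$ be the least transitive model of $T$ containing $\vec c$ as an element, $\mathcal A_T[\vec c]\equiv_{\Sigma_n}\mathcal A_T[\vec d]$. Here $T$ is a set theory extending $\mathsf{KP}$ and the models $\mathcal A_T[\vec c]$ are structures for the language of set theory with an additional symbol interpreted as $\vec c$; definability is in this language. Pointclasses and determinacy. All pointclasses are lightface, in $\omega^\omega$. For $A\subseteq\omega^\omega$, players I and II alternate playing natural numbers, I first, and I wins iff the play is in $A$; $\operatorname{Det}(\Lambda)$ says every such game with $A\in\Lambda$ has a winning strategy for one player. An ordinal $\eta+k$ ($\eta$ zero or limit, $k<\omega$) is even/odd as $k$ is. $A\in\omega^2\text{-}\Pi^1_1+\Gamma$ iff there is $\langle B_\beta\mid\beta\le\omega^2+1\rangle$ with $B_\beta\in\Pi^1_1$ for $\beta<\omega^2$ (uniformly in $\beta$, under a computable coding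 of $\omega^2$), $B_{\omega^2}\in\Gamma$, $B_{\omega^2+1}=\varnothing$ and $x\in A\leftrightarrow$ the least $\beta$ with $x\notin B_\beta$ is odd. The class $\widetilde\Gamma$ (relative to $\vec c$). Let $A\in\omega^2\text{-}\Pi^1_1+\Gamma$ with witness $\langle B_\beta\rangle$. For $\beta<\omega^2$ and $x\in\omega^\omega$ let $\prec^\beta_x$ be a linear ordering of $\omega$ with maximal element $0$, obtained recursively (uniformly in $\beta$) from $x$, with its restriction $\prec^\beta_{x\upharpoonright k}$ to $k$ depending only on $x\upharpoonright k$, and such that $\prec^\beta_x$ is a well-ordering iff $x\in B_\beta$. Let $\langle\beta,k\rangle\mapsto\xi^\beta_k$ be a recursive bijection of $\omega^2\times\omega$ with $\omega$ such that $\xi^\beta_k$ is even iff $\beta$ is even, $\xi^\beta_k$ is increasing in $k$, and $\xi^{\omega i+a}_0<\xi^{\omega i+b}_0$ for natural numbers $i$ and $a<b$. In the auxiliary game, on the tree $T^*=(\omega\times\sup\vec c)^{<\omega}$, the players alternately play pairs $\langle a_m,\eta_m\rangle\in\omega\times\sup\vec c$ (I plays for even $m$). For a play put $x=\langle a_m\rangle_m$ and $F^\beta(k)=\eta_{\xi^\beta_k}$. A play is badly lost if some $F^{\omega i+b}$ is not an order-preserving embedding of $\langle\omega,\prec^{\omega i+b}_x\rangle$ into $\langle c_i,<\rangle$; badly lost positions are defined the same way. At the shortest badly lost position of a badly lost play, if the least $b$ such that some $F^{\omega i+b}$ fails is even, the play is badly lost for I and II wins; otherwise it is badly lost for II and I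 wins. If a play is not badly lost, I wins iff $x\in B_{\omega^2}$. Let $A^*\subseteq[T^*]$ be the set of plays won by I. A $\widetilde\Gamma$ game is a game $G(A^*;T^* )$ with payoff set $A^*$ for I arising in this way from some $A\in\omega^2\text{-}\Pi^1_1+\Gamma$. *)

theory Defs
  imports Main "HOL-Library.Nat_Bijection" "HOL-Library.Product_Lexorder"
begin

section \<open>The universe of sets\<close>

text \<open>
  The set-theoretic universe is a type whose elements are the sets and whose HOL subsets are the
  classes; \<open>elts x\<close> is the class of elements of \<open>x\<close>. The axioms are those of second-order ZF
  (choice comes from HOL). Separation and replacement being second-order, the reals and the
  \<open>\<omega>\<close>-sequences of the universe are those of HOL. Pairing and infinity follow from the
  axiom \<open>countable\<close>, which is replacement applied to the set \<open>\<omega>\<close>.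
\<close>

class zf_universe =
  fixes elts :: "'a \<Rightarrow> 'a set"
  assumes extensionality: "elts x = elts y \<Longrightarrow> x = y"
    and separation: "X \<subseteq> elts x \<Longrightarrow> X \<in> range elts"
    and union: "(\<Union>y\<in>elts x. elts y) \<in> range elts"
    and power: "{y. elts y \<subseteq> elts x} \<in> range elts"
    and replacement: "f ` elts x \<in> range elts"
    and countable: "range (g :: nat \<Rightarrow> 'a) \<in> range elts"
    and foundation: "wf {(x, y). x \<in> elts y}"

text \<open>The set with a given extension; meaningful for classes in the range of \<open>elts\<close>.\<close>

definition vset :: "'v::zf_universe set \<Rightarrow> 'v" where
  "vset X = (THE x. elts x = X)"

definition vpair :: "'v::zf_universe \<Rightarrow> 'v \<Rightarrow> 'v" where
  "vpair x y = vset {vset {x}, vset {x, y}}"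

primrec vnat :: "nat \<Rightarrow> 'v::zf_universe" where
  "vnat 0 = vset {}"
| "vnat (Suc n) = vset (insert (vnat n) (elts (vnat n)))"

definition vtransitive :: "'v::zf_universe \<Rightarrow> bool" where
  "vtransitive x \<longleftrightarrow> (\<forall>y\<in>elts x. elts y \<subseteq> elts x)"

text \<open>Ordinals are von Neumann ordinals, so their ordering is membership.\<close>

definition vord :: "'v::zf_universe \<Rightarrow> bool" where
  "vord x \<longleftrightarrow> vtransitive x \<and> (\<forall>y\<in>elts x. vtransitive y)"

definition club_class :: "'v::zf_universe set \<Rightarrow> bool" where
  "club_class C \<longleftrightarrow>
     (\<forall>\<gamma>\<in>C. vord \<gamma>) \<and>
     (\<forall>\<alpha>. vord \<alpha> \<longrightarrow> (\<exists>\<gamma>\<in>C. \<alpha> \<in> elts \<gamma>)) \<and>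
     (\<forall>\<mu>. vord \<mu> \<and> elts \<mu> \<noteq> {} \<and> (\<forall>\<alpha>\<in>elts \<mu>. \<exists>\<gamma>\<in>C. \<alpha> \<in> elts \<gamma> \<and> \<gamma> \<in> elts \<mu>) \<longrightarrow> \<mu> \<in> C)"

text \<open>\<open>[C]\<^sup>\<omega>\<close>\<close>

definition increasing_seqs :: "'v::zf_universe set \<Rightarrow> (nat \<Rightarrow> 'v) set" where
  "increasing_seqs C = {c. (\<forall>i. c i \<in> C) \<and> (\<forall>i j. i < j \<longrightarrow> c i \<in> elts (c j))}"

text \<open>The sequence as an element of the universe, i.e. as a function with domain \<open>\<omega>\<close>.\<close>

definition vseq :: "(nat \<Rightarrow> 'v::zf_universe) \<Rightarrow> 'v" where
  "vseq c = vset (range (\<lambda>i. vpair (vnat i) (c i)))"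


section \<open>Formulas and the Levy hierarchy\<close>

text \<open>The language has membership, equality and one additional constant symbol \<open>Const\<close>.\<close>

datatype tm = Var nat | Const

datatype fm = Mem tm tm | Eq tm tm | Neg fm | Conj fm fm | Ex nat fm

primrec tm_val :: "'a \<Rightarrow> (nat \<Rightarrow> 'a) \<Rightarrow> tm \<Rightarrow> 'a" where
  "tm_val e v (Var k) = v k"
| "tm_val e v Const = e"

text \<open>Satisfaction in the structure with domain \<open>M\<close>, membership relation \<open>E\<close> and constant \<open>e\<close>.\<close>

primrec sat :: "'a set \<Rightarrow> ('a \<Rightarrow> 'a \<Rightarrow> bool) \<Rightarrow> 'a \<Rightarrow> (nat \<Rightarrow> 'a) \<Rightarrow> fm \<Rightarrow> bool" where
  "sat M E e v (Mem s t) \<longleftrightarrow> E (tm_val e v s) (tm_val e v t)"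
| "sat M E e v (Eq s t) \<longleftrightarrow> tm_val e v s = tm_val e v t"
| "sat M E e v (Neg \<phi>) \<longleftrightarrow> \<not> sat M E e v \<phi>"
| "sat M E e v (Conj \<phi> \<psi>) \<longleftrightarrow> sat M E e v \<phi> \<and> sat M E e v \<psi>"
| "sat M E e v (Ex k \<phi>) \<longleftrightarrow> (\<exists>a\<in>M. sat M E e (v(k := a)) \<phi>)"

primrec tm_fv :: "tm \<Rightarrow> nat set" where
  "tm_fv (Var k) = {k}"
| "tm_fv Const = {}"

primrec fv :: "fm \<Rightarrow> nat set" where
  "fv (Mem s t) = tm_fv s \<union> tm_fv t"
| "fv (Eq s t) = tm_fv s \<union> tm_fv t"
| "fv (Neg \<phi>) = fv \<phi>"
| "fv (Conj \<phi> \<psi>) = fv \<phi> \<union> fv \<psi>"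
| "fv (Ex k \<phi>) = fv \<phi> - {k}"

text \<open>Formulas of the pure language of set theory, without the additional symbol.\<close>

primrec pure :: "fm \<Rightarrow> bool" where
  "pure (Mem s t) \<longleftrightarrow> s \<noteq> Const \<and> t \<noteq> Const"
| "pure (Eq s t) \<longleftrightarrow> s \<noteq> Const \<and> t \<noteq> Const"
| "pure (Neg \<phi>) \<longleftrightarrow> pure \<phi>"
| "pure (Conj \<phi> \<psi>) \<longleftrightarrow> pure \<phi> \<and> pure \<psi>"
| "pure (Ex k \<phi>) \<longleftrightarrow> pure \<phi>"

text \<open>
  Disjunction and bounded universal quantification are obtained through \<open>Neg\<close>. The bound may be
  the additional constant, but not the quantified variable itself.
\<close>

inductive Delta0 :: "fm \<Rightarrow> bool" where
  Mem: "Delta0 (Mem s t)"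
| Eq: "Delta0 (Eq s t)"
| Neg: "Delta0 \<phi> \<Longrightarrow> Delta0 (Neg \<phi>)"
| Conj: "Delta0 \<phi> \<Longrightarrow> Delta0 \<psi> \<Longrightarrow> Delta0 (Conj \<phi> \<psi>)"
| BEx: "Delta0 \<phi> \<Longrightarrow> t \<noteq> Var k \<Longrightarrow> Delta0 (Ex k (Conj (Mem (Var k) t) \<phi>))"

text \<open>
  \<open>\<Pi>\<^sub>n\<close> formulas are taken to be the negations of \<open>\<Sigma>\<^sub>n\<close> formulas; a \<open>\<Sigma>\<^sub>n\<^sub>+\<^sub>1\<close> formula
  is a block of existential quantifiers followed by a \<open>\<Pi>\<^sub>n\<close> formula.
\<close>

primrec Sigma_fm :: "nat \<Rightarrow> fm set" where
  "Sigma_fm 0 = {\<phi>. Delta0 \<phi>}"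
| "Sigma_fm (Suc n) = {foldr Ex ks (Neg \<phi>) | ks \<phi>. \<phi> \<in> Sigma_fm n}"


section \<open>Theories extending KP and their least transitive models\<close>

definition models :: "'a set \<Rightarrow> ('a \<Rightarrow> 'a \<Rightarrow> bool) \<Rightarrow> fm set \<Rightarrow> bool" where
  "models M E T \<longleftrightarrow>
     M \<noteq> {} \<and> (\<forall>\<phi>\<in>T. \<forall>e\<in>M. \<forall>v. (\<forall>k. v k \<in> M) \<longrightarrow> sat M E e v \<phi>)"

text \<open>
  The structure \<open>(M, E)\<close> is a model of KP: extensionality, pairing, union, \<open>\<Delta>\<^sub>0\<close> separation,
  \<open>\<Delta>\<^sub>0\<close> collection and the full foundation schema (no axiom of infinity). As \<open>e\<close> ranges over
  all of \<open>M\<close>, the constant in the schemata is merely one more parameter.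
\<close>

definition KP_model :: "'a set \<Rightarrow> ('a \<Rightarrow> 'a \<Rightarrow> bool) \<Rightarrow> bool" where
  "KP_model M E \<longleftrightarrow>
     M \<noteq> {} \<and>
     (\<forall>x\<in>M. \<forall>y\<in>M. (\<forall>z\<in>M. E z x \<longleftrightarrow> E z y) \<longrightarrow> x = y) \<and>
     (\<forall>x\<in>M. \<forall>y\<in>M. \<exists>z\<in>M. E x z \<and> E y z) \<and>
     (\<forall>x\<in>M. \<exists>u\<in>M. \<forall>y\<in>M. \<forall>z\<in>M. E y x \<and> E z y \<longrightarrow> E z u) \<and>
     (\<forall>\<phi> e v. Delta0 \<phi> \<and> e \<in> M \<and> (\<forall>k. v k \<in> M) \<longrightarrow>
        (\<forall>x\<in>M. \<exists>y\<in>M. \<forall>z\<in>M. E z y \<longleftrightarrow> E z x \<and> sat M E e (v(0 := z)) \<phi>)) \<and>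
     (\<forall>\<phi> e v. Delta0 \<phi> \<and> e \<in> M \<and> (\<forall>k. v k \<in> M) \<longrightarrow>
        (\<forall>x\<in>M. (\<forall>y\<in>M. E y x \<longrightarrow> (\<exists>z\<in>M. sat M E e (v(0 := y, 1 := z)) \<phi>)) \<longrightarrow>
           (\<exists>w\<in>M. \<forall>y\<in>M. E y x \<longrightarrow> (\<exists>z\<in>M. E z w \<and> sat M E e (v(0 := y, 1 := z)) \<phi>)))) \<and>
     (\<forall>\<phi> e v. e \<in> M \<and> (\<forall>k. v k \<in> M) \<longrightarrow>
        (\<exists>x\<in>M. sat M E e (v(0 := x)) \<phi>) \<longrightarrow>
        (\<exists>x\<in>M. sat M E e (v(0 := x)) \<phi> \<and> (\<forall>y\<in>M. E y x \<longrightarrow> \<not> sat M E e (v(0 := y)) \<phi>)))"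

text \<open>
  \<open>T\<close> proves KP, expressed through the completeness theorem as semantic consequence over all
  structures (not just transitive ones) whose domain is a class of the given type; the language being
  countable, any infinite type gives the same notion.
\<close>

definition theory_extending_KP :: "'a itself \<Rightarrow> fm set \<Rightarrow> bool" where
  "theory_extending_KP (ty :: 'a itself) T \<longleftrightarrow>
     (\<forall>\<phi>\<in>T. pure \<phi> \<and> fv \<phi> = {}) \<and>
     (\<forall>(M :: 'a set) E. models M E T \<longrightarrow> KP_model M E)"

abbreviation mem :: "'v::zf_universe \<Rightarrow> 'v \<Rightarrow> bool" where
  "mem x y \<equiv> x \<in> elts y"

definition transitive_model :: "fm set \<Rightarrow> (nat \<Rightarrow> 'v::zf_universe) \<Rightarrow> 'v \<Rightarrow> bool" where
  "transitive_model T c A \<longleftrightarrow> vtransitive A \<and> vseq c \<in> elts A \<and> models (elts A) mem T"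

definition is_least_model :: "fm set \<Rightarrow> (nat \<Rightarrow> 'v::zf_universe) \<Rightarrow> 'v \<Rightarrow> bool" where
  "is_least_model T c A \<longleftrightarrow>
     transitive_model T c A \<and> (\<forall>B. transitive_model T c B \<longrightarrow> elts A \<subseteq> elts B)"

text \<open>\<open>\<A>\<^sub>T[c]\<close>\<close>

definition least_model :: "fm set \<Rightarrow> (nat \<Rightarrow> 'v::zf_universe) \<Rightarrow> 'v" where
  "least_model T c = (THE A. is_least_model T c A)"

text \<open>Satisfaction in \<open>\<A>\<^sub>T[c]\<close>, with the additional symbol interpreted as \<open>c\<close>.\<close>

definition A_sat :: "fm set \<Rightarrow> (nat \<Rightarrow> 'v::zf_universe) \<Rightarrow> (nat \<Rightarrow> 'v) \<Rightarrow> fm \<Rightarrow> bool" where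
  "A_sat T c v \<phi> \<longleftrightarrow> sat (elts (least_model T c)) mem (vseq c) v \<phi>"

text \<open>
  For a sentence the assignment is irrelevant; \<open>vseq c\<close> is just some element of the model.
  The existence of the least models is part of the definition.
\<close>

definition generating_indiscernibles :: "nat \<Rightarrow> fm set \<Rightarrow> 'v::zf_universe set \<Rightarrow> bool" where
  "generating_indiscernibles n T C \<longleftrightarrow>
     club_class C \<and>
     (\<forall>c\<in>increasing_seqs C. \<exists>A. is_least_model T c A) \<and>
     (\<forall>c\<in>increasing_seqs C. \<forall>d\<in>increasing_seqs C. \<forall>\<phi>\<in>Sigma_fm n. fv \<phi> = {} \<longrightarrow>
        (A_sat T c (\<lambda>_. vseq c) \<phi> \<longleftrightarrow> A_sat T d (\<lambda>_. vseq d) \<phi>))"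


section \<open>Lightface pointclasses in Baire space\<close>

text \<open>
  Total recursive functions of \<open>k\<close> arguments, given as functions on lists of length \<open>k\<close>
  (values on other lists are immaterial). Minimization is applied to regular functions only,
  which by the normal form theorem yields all total recursive functions.
\<close>

inductive recursive :: "nat \<Rightarrow> (nat list \<Rightarrow> nat) \<Rightarrow> bool" where
  zero: "recursive k (\<lambda>_. 0)"
| succ: "recursive 1 (\<lambda>xs. Suc (xs ! 0))"
| proj: "i < k \<Longrightarrow> recursive k (\<lambda>xs. xs ! i)"
| comp: "recursive (length gs) f \<Longrightarrow> (\<forall>g\<in>set gs. recursive k g) \<Longrightarrow>
           recursive k (\<lambda>xs. f (map (\<lambda>g. g xs) gs))"
| prim_rec: "recursive k f \<Longrightarrow> recursive (Suc (Suc k)) g \<Longrightarrow>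
           recursive (Suc k) (\<lambda>xs. rec_nat (f (tl xs)) (\<lambda>n r. g (n # r # tl xs)) (hd xs))"
| minimize: "recursive (Suc k) f \<Longrightarrow> (\<forall>xs. length xs = k \<longrightarrow> (\<exists>n. f (n # xs) = 0)) \<Longrightarrow>
           recursive k (\<lambda>xs. LEAST n. f (n # xs) = 0)"
| agree: "recursive k f \<Longrightarrow> (\<forall>xs. length xs = k \<longrightarrow> f xs = g xs) \<Longrightarrow> recursive k g"

definition recursive_rel :: "nat \<Rightarrow> (nat list \<Rightarrow> bool) \<Rightarrow> bool" where
  "recursive_rel k R \<longleftrightarrow> recursive k (\<lambda>xs. if R xs then 1 else 0)"

type_synonym baire = "nat \<Rightarrow> nat"

text \<open>The code of the initial segment of \<open>x\<close> of length \<open>k\<close>.\<close>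

definition seg :: "baire \<Rightarrow> nat \<Rightarrow> nat" where
  "seg x k = list_encode (map x [0..<k])"

text \<open>
  \<open>Sigma0 j k\<close> is the class of \<open>\<Sigma>\<^sup>0\<close> relations of level \<open>j + 1\<close> on \<open>\<omega>\<^sup>\<omega> \<times> \<omega>\<^sup>k\<close>;
  the second argument of a relation is a list of length \<open>k\<close>.
\<close>

primrec Sigma0 :: "nat \<Rightarrow> nat \<Rightarrow> (baire \<Rightarrow> nat list \<Rightarrow> bool) set" where
  "Sigma0 0 k = {(\<lambda>x ns. \<exists>m. R (seg x m # ns)) | R. recursive_rel (Suc k) R}"
| "Sigma0 (Suc j) k = {(\<lambda>x ns. \<exists>m. \<not> P x (m # ns)) | P. P \<in> Sigma0 j (Suc k)}"

definition arithmetical :: "baire set \<Rightarrow> bool" where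
  "arithmetical X \<longleftrightarrow> (\<exists>j. \<exists>P\<in>Sigma0 j 0. X = {x. P x []})"

definition arithmetic_pointclass :: "baire set set \<Rightarrow> bool" where
  "arithmetic_pointclass \<Gamma> \<longleftrightarrow> (\<forall>X\<in>\<Gamma>. arithmetical X)"

text \<open>
  The ordinal \<open>\<omega>\<^sup>2 \<cdot> e + \<omega> \<cdot> i + a\<close> is represented by the triple \<open>(e, i, a)\<close>; the lexicographic
  ordering of \<open>nat \<times> nat \<times> nat\<close> from \<^theory>\<open>HOL-Library.Product_Lexorder\<close> is the ordering of
  these ordinals. Thus \<open>\<omega>\<^sup>2\<close> is \<open>(1, 0, 0)\<close>, \<open>\<omega>\<^sup>2 + 1\<close> is \<open>(1, 0, 1)\<close>, and \<open>(i, a)\<close> is the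
  computable code of an ordinal below \<open>\<omega>\<^sup>2\<close>.
\<close>

type_synonym index = "nat \<times> nat \<times> nat"

definition odd_index :: "index \<Rightarrow> bool" where
  "odd_index \<beta> \<longleftrightarrow> odd (snd (snd \<beta>))"

text \<open>\<open>B\<^sub>\<beta>\<close> is \<open>\<Pi>\<^sup>1\<^sub>1\<close> uniformly in \<open>\<beta> < \<omega>\<^sup>2\<close>.\<close>

definition uniformly_Pi11 :: "(index \<Rightarrow> baire set) \<Rightarrow> bool" where
  "uniformly_Pi11 B \<longleftrightarrow>
     (\<exists>R. recursive_rel 4 R \<and>
       (\<forall>i a. B (0, i, a) = {x. \<forall>y :: baire. \<exists>m. R [i, a, seg x m, seg y m]}))"

definition diff_witness :: "baire set set \<Rightarrow> baire set \<Rightarrow> (index \<Rightarrow> baire set) \<Rightarrow> bool" where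
  "diff_witness \<Gamma> A B \<longleftrightarrow>
     uniformly_Pi11 B \<and> B (1, 0, 0) \<in> \<Gamma> \<and> B (1, 0, 1) = {} \<and>
     A = {x. odd_index (LEAST \<beta>. \<beta> \<le> (1, 0, 1) \<and> x \<notin> B \<beta>)}"

text \<open>The pointclass \<open>\<omega>\<^sup>2-\<Pi>\<^sup>1\<^sub>1 + \<Gamma>\<close>\<close>

definition omega2_Pi11_plus :: "baire set set \<Rightarrow> baire set set" where
  "omega2_Pi11_plus \<Gamma> = {A. \<exists>B. diff_witness \<Gamma> A B}"


section \<open>Games\<close>

datatype player = I | II

fun turn :: "player \<Rightarrow> nat \<Rightarrow> bool" where
  "turn I m \<longleftrightarrow> even m"
| "turn II m \<longleftrightarrow> odd m"

text \<open>
  The game on the tree of finite sequences from \<open>X\<close> with payoff set \<open>W\<close> for player I.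
  Positions are lists, plays are infinite sequences; a strategy is relevant only at positions
  where its owner is to move.
\<close>

definition winning_strategy :: "'m set \<Rightarrow> (nat \<Rightarrow> 'm) set \<Rightarrow> player \<Rightarrow> ('m list \<Rightarrow> 'm) \<Rightarrow> bool" where
  "winning_strategy X W pl \<sigma> \<longleftrightarrow>
     (\<forall>p\<in>lists X. turn pl (length p) \<longrightarrow> \<sigma> p \<in> X) \<and>
     (\<forall>f. (\<forall>m. f m \<in> X) \<and> (\<forall>m. turn pl m \<longrightarrow> f m = \<sigma> (map f [0..<m])) \<longrightarrow>
        (f \<in> W \<longleftrightarrow> pl = I))"

definition Det :: "baire set set \<Rightarrow> bool" where
  "Det \<Lambda> \<longleftrightarrow> (\<forall>A\<in>\<Lambda>. \<exists>pl \<sigma>. winning_strategy UNIV A pl \<sigma>)"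


section \<open>The auxiliary games\<close>

text \<open>
  \<open>prec i a x\<close> is the ordering \<open>\<prec>\<^sup>\<beta>\<^sub>x\<close> for \<open>\<beta> = \<omega> \<cdot> i + a\<close>. The recursive relation \<open>R\<close> computes
  its restriction to \<open>k\<close> from \<open>\<beta>\<close> and the initial segment of \<open>x\<close> of length \<open>k\<close>.
\<close>

definition order_assignment ::
  "(index \<Rightarrow> baire set) \<Rightarrow> (nat \<Rightarrow> nat \<Rightarrow> baire \<Rightarrow> nat rel) \<Rightarrow> bool" where
  "order_assignment B prec \<longleftrightarrow>
     (\<forall>i a x. strict_linear_order_on UNIV (prec i a x) \<and>
        (\<forall>m. m \<noteq> 0 \<longrightarrow> (m, 0) \<in> prec i a x) \<and>
        (wf (prec i a x) \<longleftrightarrow> x \<in> B (0, i, a))) \<and>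
     (\<exists>R. recursive_rel 5 R \<and>
        (\<forall>i a x k. \<forall>m<k. \<forall>n<k. (m, n) \<in> prec i a x \<longleftrightarrow> R [i, a, seg x k, m, n]))"

text \<open>\<open>xi i a k\<close> is \<open>\<xi>\<^sup>\<beta>\<^sub>k\<close> for \<open>\<beta> = \<omega> \<cdot> i + a\<close>, which is even iff \<open>a\<close> is.\<close>

definition enumeration :: "(nat \<Rightarrow> nat \<Rightarrow> nat \<Rightarrow> nat) \<Rightarrow> bool" where
  "enumeration xi \<longleftrightarrow>
     recursive 3 (\<lambda>xs. xi (xs ! 0) (xs ! 1) (xs ! 2)) \<and>
     bij (\<lambda>(i, a, k). xi i a k) \<and>
     (\<forall>i a k. even (xi i a k) \<longleftrightarrow> even a) \<and>
     (\<forall>i a. strict_mono (xi i a)) \<and>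
     (\<forall>i a b. a < b \<longrightarrow> xi i a 0 < xi i b 0)"

text \<open>Moves: elements of \<open>\<omega> \<times> sup c\<close>.\<close>

definition aux_moves :: "(nat \<Rightarrow> 'v::zf_universe) \<Rightarrow> (nat \<times> 'v) set" where
  "aux_moves c = UNIV \<times> (\<Union>i. elts (c i))"

definition embeds :: "nat set \<Rightarrow> nat rel \<Rightarrow> (nat \<Rightarrow> 'v::zf_universe) \<Rightarrow> 'v \<Rightarrow> bool" where
  "embeds D r F \<gamma> \<longleftrightarrow>
     (\<forall>k\<in>D. F k \<in> elts \<gamma>) \<and> (\<forall>k\<in>D. \<forall>l\<in>D. (k, l) \<in> r \<longrightarrow> F k \<in> elts (F l))"

locale aux_game =
  fixes c :: "nat \<Rightarrow> 'v::zf_universe"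
    and B :: "index \<Rightarrow> baire set"
    and prec :: "nat \<Rightarrow> nat \<Rightarrow> baire \<Rightarrow> nat rel"
    and xi :: "nat \<Rightarrow> nat \<Rightarrow> nat \<Rightarrow> nat"
begin

definition real_part :: "(nat \<Rightarrow> nat \<times> 'v) \<Rightarrow> baire" where
  "real_part f = (\<lambda>m. fst (f m))"

definition F :: "(nat \<Rightarrow> nat \<times> 'v) \<Rightarrow> nat \<Rightarrow> nat \<Rightarrow> nat \<Rightarrow> 'v" where
  "F f i a k = snd (f (xi i a k))"

definition badly_lost :: "(nat \<Rightarrow> nat \<times> 'v) \<Rightarrow> bool" where
  "badly_lost f \<longleftrightarrow> (\<exists>i b. \<not> embeds UNIV (prec i b (real_part f)) (F f i b) (c i))"

text \<open>
  \<open>fails_at f N i b\<close>: the part of \<open>F\<^sup>\<omega>\<^sup>i\<^sup>+\<^sup>b\<close> determined by the position of length \<open>N\<close> in the play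
  \<open>f\<close> is not an embedding. If \<open>xi i b k < N\<close> then \<open>k < N\<close>, so this depends only on that position.
\<close>

definition fails_at :: "(nat \<Rightarrow> nat \<times> 'v) \<Rightarrow> nat \<Rightarrow> nat \<Rightarrow> nat \<Rightarrow> bool" where
  "fails_at f N i b \<longleftrightarrow>
     \<not> embeds {k. xi i b k < N} (prec i b (real_part f)) (F f i b) (c i)"

definition shortest_bad :: "(nat \<Rightarrow> nat \<times> 'v) \<Rightarrow> nat" where
  "shortest_bad f = (LEAST N. \<exists>i b. fails_at f N i b)"

text \<open>\<open>A\<^sup>*\<close>, the set of plays won by player I\<close>

definition payoff :: "(nat \<Rightarrow> nat \<times> 'v) set" where
  "payoff = {f. (\<forall>m. f m \<in> aux_moves c) \<and>
     (if badly_lost f then odd (LEAST b. \<exists>i. fails_at f (shortest_bad f) i b)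
      else real_part f \<in> B (1, 0, 0))}"

end

text \<open>The payoff sets of the \<open>\<Gamma>\<close>-tilde games relative to \<open>c\<close>\<close>

definition Gamma_tilde ::
  "baire set set \<Rightarrow> (nat \<Rightarrow> 'v::zf_universe) \<Rightarrow> (nat \<Rightarrow> nat \<times> 'v) set set" where
  "Gamma_tilde \<Gamma> c = {aux_game.payoff c B prec xi | A B prec xi.
     diff_witness \<Gamma> A B \<and> order_assignment B prec \<and> enumeration xi}"

text \<open>Moves and positions of an auxiliary game as elements of the universe.\<close>

definition vmove :: "nat \<times> 'v::zf_universe \<Rightarrow> 'v" where
  "vmove m = vpair (vnat (fst m)) (snd m)"

definition vpos :: "(nat \<times> 'v::zf_universe) list \<Rightarrow> 'v" where
  "vpos p = vset {vpair (vnat k) (vmove (p ! k)) | k. k < length p}"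

text \<open>
  The graph of \<open>\<sigma>\<close>, on the positions where \<open>pl\<close> is to move, is \<open>\<Sigma>\<^sub>n\<close>-definable over \<open>\<A>\<^sub>T[c]\<close>
  without parameters other than the additional symbol.
\<close>

definition Sigma_definable_strategy ::
  "nat \<Rightarrow> fm set \<Rightarrow> (nat \<Rightarrow> 'v::zf_universe) \<Rightarrow> player \<Rightarrow>
    ((nat \<times> 'v) list \<Rightarrow> nat \<times> 'v) \<Rightarrow> bool" where
  "Sigma_definable_strategy n T c pl \<sigma> \<longleftrightarrow>
     (\<exists>\<phi>\<in>Sigma_fm n. fv \<phi> \<subseteq> {0, 1} \<and>
       (\<forall>u\<in>elts (least_model T c). \<forall>w\<in>elts (least_model T c).
          A_sat T c (\<lambda>k. if k = 0 then u else w) \<phi> \<longleftrightarrow>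
          (\<exists>p\<in>lists (aux_moves c). turn pl (length p) \<and> u = vpos p \<and> w = vmove (\<sigma> p))))"

end

theory Submission
  imports Defs "HOL-Library.Countable_Set"
begin

text \<open>
  Fix a single \<open>c \<in> [C]\<^sup>\<omega>\<close> with large gaps below each \<open>c\<^sub>i\<close> and a definable winning strategy \<open>\<sigma>\<close> for the
  auxiliary game relative to \<open>c\<close>. In the integer game the opponent's ordinals are supplied by us:
  elements of \<open>C\<close> between \<open>c\<^sub>i\<^sub>-\<^sub>1\<close> and \<open>c\<^sub>i\<close>, ordered lexicographically by \<open>b\<close> and \<open>\<prec>\<close>. Inserting finitely
  many elements of \<open>C\<close> into \<open>c\<close> does not change the least model, so the answers of \<open>\<sigma>\<close> depend on these
  ordinals only through their order type; in particular the integer answers depend on the integers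
  alone, and this is the strategy for the integer game.

  Suppose a play \<open>x\<close> against it is lost, and let \<open>\<omega>i + b\<close> be least with \<open>x \<notin> B\<^sub>\<omega>\<^sub>i\<^sub>+\<^sub>b\<close>; then \<open>b\<close> has the parity of
  the owner of \<open>\<sigma>\<close>. The opponent's orderings below \<open>\<omega>i + b\<close> are well-orderings and can be embedded once and
  for all, while at each finite stage the later ones are embedded afresh, above the ordinal that \<open>\<sigma>\<close>
  assigns to the maximal element of \<open>\<prec>\<^sup>\<omega>\<^sup>i\<^sup>+\<^sup>b\<close>. As there are more indiscernibles than smaller ordinals, two
  choices give the same value, hence by indiscernibility all do. So the values of \<open>\<sigma>\<close> at the different
  stages cohere into an embedding of \<open>\<prec>\<^sup>\<omega>\<^sup>i\<^sup>+\<^sup>b\<close> into the ordinals, and \<open>x \<in> B\<^sub>\<omega>\<^sub>i\<^sub>+\<^sub>b\<close> after all.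
  If there is no such index, the opponent can embed all his orderings at once, and the payoff of the
  auxiliary game decides the play \<open>x\<close> itself.
\<close>

subsection \<open>Sets and ordinals\<close>

text \<open>Indiscernibility is assumed only for sentences about whole sequences, and only at the
  given level n, possibly 0. Parameters from \<open>C\<close> must therefore be hidden inside the
  sequence without raising the level: the old and the enlarged sequence have to be computed from
  each other by functions whose substitution preserves bounded formulas and whose values stay in the
  model. This is why rudimentary functions are developed. The answers of the strategy need not lie
  in \<open>C\<close>, so they cannot be treated as parameters. They are quantified existentially
  over the supremum of the sequence, which is itself the value of a rudimentary function; hence even
  for n = 0 the quantifier is a bounded one. The gaps below \<open>c i\<close> serve two purposes:
  their cardinality is used for the pigeonhole argument, and their uncountable cofinality leaves
  room above any countable set of ordinals, so that orderings of \<omega> can be embedded. The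
  opponent's ordinals increase also from one b to the next, which the game does not demand: the
  orderings before a given one then form an initial segment that can be frozen.\<close>

lemma elts_vset: "X \<in> range elts \<Longrightarrow> elts (vset X) = (X :: 'v::zf_universe set)"
proof -
  assume "X \<in> range elts"
  then obtain x where x: "X = elts x" by auto
  have "(THE y. elts y = elts x) = x"
    by (rule the_equality) (simp_all add: extensionality)
  then show ?thesis by (simp add: vset_def x)
qed

lemma small_subset: "X \<subseteq> elts (x :: 'v::zf_universe) \<Longrightarrow> X \<in> range elts"
  by (rule separation)

lemma small_countable: "countable X \<Longrightarrow> (X :: 'v::zf_universe set) \<in> range elts"
proof (cases "X = {}")
  case True
  then show ?thesis by (simp add: separation[of "{}"])
next
  case False
  moreover assume "countable X"
  ultimately have "range (from_nat_into X) = X" by (simp add: range_from_nat_into)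
  then show ?thesis using zf_universe_class.countable[of "from_nat_into X"] by metis
qed

lemma small_image: "X \<in> range elts \<Longrightarrow> f ` X \<in> range elts"
  for f :: "'v \<Rightarrow> 'v::zf_universe"
  using replacement[of f] by (elim imageE) simp

lemma small_UN:
  fixes f :: "'v \<Rightarrow> 'v::zf_universe"
  assumes "X \<in> range elts" shows "(\<Union>x\<in>X. elts (f x)) \<in> range elts"
proof -
  from small_image[OF assms, of f] obtain y where "f ` X = elts y" by auto
  then have "(\<Union>x\<in>X. elts (f x)) = (\<Union>z\<in>elts y. elts z)" by (simp flip: \<open>f ` X = elts y\<close>)
  then show ?thesis using union[of y] by simp
qed

lemma small_Un:
  assumes "X \<in> range elts" "Y \<in> range elts" shows "X \<union> Y \<in> range elts"
proof -
  from assms obtain x y where "X = elts x" "Y = elts y" by auto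
  then have "X \<union> Y = (\<Union>z\<in>{x,y}. elts (id z))" by auto
  moreover have "\<dots> \<in> range elts" by (rule small_UN) (rule small_countable, simp)
  ultimately show ?thesis by simp
qed

lemma small_insert: "X \<in> range elts \<Longrightarrow> insert x X \<in> range elts"
  using small_Un[OF small_countable[of "{x}"]] by simp

lemma elts_empty [simp]: "elts (vset {} :: 'v::zf_universe) = {}"
  by (rule elts_vset) (simp add: small_countable)

lemma elts_sing [simp]: "elts (vset {x} :: 'v::zf_universe) = {x}"
  by (rule elts_vset) (simp add: small_countable)

lemma elts_upair [simp]: "elts (vset {x, y} :: 'v::zf_universe) = {x, y}"
  by (rule elts_vset) (simp add: small_countable)

lemma elts_insert [simp]: "elts (vset (insert x (elts y)) :: 'v::zf_universe) = insert x (elts y)"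
  by (rule elts_vset) (simp add: small_insert)

lemma elts_UN [simp]:
  fixes f :: "'v \<Rightarrow> 'v::zf_universe"
  shows "elts (vset (\<Union>x\<in>elts y. elts (f x))) = (\<Union>x\<in>elts y. elts (f x))"
  by (rule elts_vset, rule small_UN, simp)

lemma vpair_inject [simp]: "vpair x y = vpair x' y' \<longleftrightarrow> x = x' \<and> y = (y' :: 'v::zf_universe)"
proof
  assume "vpair x y = vpair x' y'"
  then have "{vset {x}, vset {x, y}} = {vset {x'}, vset {x', y'}}"
    unfolding vpair_def by (metis elts_upair)
  moreover have "elts ` {vset {x}, vset {x, y}} = {{x}, {x,y}}" "elts ` {vset {x'}, vset {x', y'}} = {{x'}, {x',y'}}"
    by auto
  ultimately have "{{x}, {x,y}} = {{x'}, {x',y'}}" by metis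
  then show "x = x' \<and> y = y'" by (auto simp: doubleton_eq_iff)
qed auto

lemma mem_induct:
  assumes "\<And>x :: 'v::zf_universe. (\<And>y. y \<in> elts x \<Longrightarrow> P y) \<Longrightarrow> P x" shows "P x"
  by (rule wf_induct_rule[OF foundation, of P x]) (rule assms, simp)

lemma mem_irrefl [simp]: "x \<notin> elts (x :: 'v::zf_universe)"
  using wf_not_refl[OF foundation, of x] by simp

lemma mem_asym: "x \<in> elts y \<Longrightarrow> y \<notin> elts (x :: 'v::zf_universe)"
  using wf_asym[OF foundation, of x y] by simp

lemma ex_mem_minimal:
  assumes "P (x :: 'v::zf_universe)" shows "\<exists>y. P y \<and> (\<forall>z\<in>elts y. \<not> P z)"
  by (rule wfE_min[OF foundation, of x "{y. P y}"]) (use assms in auto)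

lemma vordI: "(\<And>y z. y \<in> elts x \<Longrightarrow> z \<in> elts y \<Longrightarrow> z \<in> elts x) \<Longrightarrow> (\<And>y. y \<in> elts x \<Longrightarrow> vord y) \<Longrightarrow> vord x"
  unfolding vord_def vtransitive_def by auto

lemma vord_elts: "vord x \<Longrightarrow> y \<in> elts x \<Longrightarrow> vord y"
  unfolding vord_def vtransitive_def by blast

lemma vord_trans: "vord x \<Longrightarrow> y \<in> elts x \<Longrightarrow> z \<in> elts y \<Longrightarrow> z \<in> elts x"
  unfolding vord_def vtransitive_def by blast

text \<open>Nested membership inductions on \<open>x\<close> and \<open>y\<close>: if all three
  alternatives fail, the induction hypotheses give both sets the same elements.\<close>

lemma vord_linear:
  fixes x :: "'v::zf_universe"
  shows "vord x \<Longrightarrow> vord y \<Longrightarrow> x \<in> elts y \<or> x = y \<or> y \<in> elts x"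
proof (induction x arbitrary: y rule: mem_induct)
  case (1 x)
  note IHx = 1
  show ?case using IHx(3)
  proof (induction y rule: mem_induct)
    case (1 y)
    show ?case
    proof (rule ccontr)
      assume n: "\<not> (x \<in> elts y \<or> x = y \<or> y \<in> elts x)"
      have "elts x = elts y"
      proof (intro equalityI subsetI)
        fix z assume z: "z \<in> elts x"
        then have "z \<in> elts y \<or> z = y \<or> y \<in> elts z" using IHx(1) IHx(2) 1(2) vord_elts by blast
        then show "z \<in> elts y" using n z vord_trans[OF IHx(2) z] by auto
      next
        fix z assume z: "z \<in> elts y"
        then have "x \<in> elts z \<or> x = z \<or> z \<in> elts x" using 1(1)[OF z] 1(2) vord_elts by blast
        then show "z \<in> elts x" using n z vord_trans[OF 1(2) z] by auto
      qed
      then show False using n extensionality by blast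
    qed
  qed
qed

lemma vord_subset:
  fixes x :: "'v::zf_universe"
  shows "vord x \<Longrightarrow> vord y \<Longrightarrow> elts x \<subseteq> elts y \<longleftrightarrow> x \<in> elts y \<or> x = y"
  using vord_linear[of x y] vord_trans[of y x] mem_irrefl[of y] by blast

lemma vord_succ:
  assumes "vord (x :: 'v::zf_universe)" shows "vord (vset (insert x (elts x)))"
  by (rule vordI) (use vord_trans[OF assms] vord_elts[OF assms] assms in auto)

lemma vord_Union:
  fixes X :: "'v::zf_universe set"
  assumes "X \<in> range elts" "\<And>x. x \<in> X \<Longrightarrow> vord x"
  shows "vord (vset (\<Union>x\<in>X. elts x))" "elts (vset (\<Union>x\<in>X. elts x)) = (\<Union>x\<in>X. elts x)"
proof -
  show e: "elts (vset (\<Union>x\<in>X. elts x)) = (\<Union>x\<in>X. elts x)"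
    by (rule elts_vset) (rule small_UN[OF assms(1)])
  show "vord (vset (\<Union>x\<in>X. elts x))"
  proof (rule vordI; unfold e)
    fix y z assume "y \<in> (\<Union>x\<in>X. elts x)" "z \<in> elts y"
    then show "z \<in> (\<Union>x\<in>X. elts x)" using assms(2) vord_trans by blast
  next
    fix y assume "y \<in> (\<Union>x\<in>X. elts x)"
    then show "vord y" using assms(2) vord_elts by blast
  qed
qed

lemma vord_bound:
  fixes X :: "'v::zf_universe set"
  assumes "X \<in> range elts" "\<And>x. x \<in> X \<Longrightarrow> vord x"
  obtains \<alpha> where "vord \<alpha>" "\<And>x. x \<in> X \<Longrightarrow> x \<in> elts \<alpha>"
proof
  let ?u = "vset (\<Union>x\<in>X. elts x)"
  let ?s = "vset (insert ?u (elts ?u))"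
  note U = vord_Union[OF assms]
  show "vord ?s" by (rule vord_succ) (rule U(1))
  fix x assume x: "x \<in> X"
  then have "elts x \<subseteq> elts ?u" using U(2) by auto
  then show "x \<in> elts ?s" using vord_subset[OF assms(2)[OF x] U(1)] by auto
qed

subsection \<open>Natural numbers and sequences in the universe\<close>

lemma elts_vnat: "elts (vnat n :: 'v::zf_universe) = vnat ` {..<n}"
proof (induction n)
  case (Suc n)
  have "elts (vnat (Suc n) :: 'v) = insert (vnat n) (elts (vnat n))" by simp
  also have "\<dots> = vnat ` {..<Suc n}" unfolding Suc by (simp add: lessThan_Suc)
  finally show ?case .
qed simp

lemma vnat_less: "m < n \<Longrightarrow> vnat m \<in> elts (vnat n :: 'v::zf_universe)"
  by (simp add: elts_vnat)

lemma vnat_inject [simp]: "vnat m = (vnat n :: 'v::zf_universe) \<longleftrightarrow> m = n"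
  by (metis vnat_less linorder_neqE_nat mem_irrefl)

lemma vnat_mem [simp]: "vnat m \<in> elts (vnat n :: 'v::zf_universe) \<longleftrightarrow> m < n"
  by (auto simp: elts_vnat)

lemma elts_vseq: "elts (vseq c :: 'v::zf_universe) = range (\<lambda>i. vpair (vnat i) (c i))"
  unfolding vseq_def by (rule elts_vset, rule small_countable) simp

lemma vmove_inject [simp]: "vmove m = vmove m' \<longleftrightarrow> m = (m' :: nat \<times> 'v::zf_universe)"
  by (auto simp: vmove_def prod_eq_iff)

lemma elts_vpos: "elts (vpos p :: 'v::zf_universe) = {vpair (vnat k) (vmove (p ! k)) | k. k < length p}"
  unfolding vpos_def by (rule elts_vset, rule small_countable) (simp add: setcompr_eq_image)

text \<open>This recursion on the length shows later that a coded position is a rudimentary function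
  of the ordinals played.\<close>

lemma vpos_snoc: "vpos (p @ [a]) = vset (insert (vpair (vnat (length p)) (vmove a)) (elts (vpos p :: 'v::zf_universe)))"
proof (rule extensionality)
  have "{vpair (vnat k) (vmove ((p @ [a]) ! k)) | k. k < length (p @ [a])} =
      (\<lambda>k. vpair (vnat k) (vmove ((p @ [a]) ! k))) ` {..<Suc (length p)}" by auto
  also have "\<dots> = insert (vpair (vnat (length p)) (vmove a)) ((\<lambda>k. vpair (vnat k) (vmove (p ! k))) ` {..<length p})"
    by (simp add: lessThan_Suc nth_append)
  also have "(\<lambda>k. vpair (vnat k) (vmove (p ! k))) ` {..<length p} = elts (vpos p)"
    unfolding elts_vpos by auto
  finally show "elts (vpos (p @ [a])) = elts (vset (insert (vpair (vnat (length p)) (vmove a)) (elts (vpos p))))"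
    by (simp only: elts_vpos[of "p @ [a]"] elts_insert)
qed

lemma vpos_inject [simp]: "vpos p = vpos q \<longleftrightarrow> p = (q :: (nat \<times> 'v::zf_universe) list)"
proof
  assume "vpos p = vpos q"
  then have "elts (vpos p) = elts (vpos q)" by simp
  then have eq: "{vpair (vnat k) (vmove (p ! k)) | k. k < length p} = {vpair (vnat k) (vmove (q ! k)) | k. k < length q}"
    by (simp only: elts_vpos)
  have 1: "k < length q \<and> q ! k = p ! k" if "k < length p" for k
  proof -
    have "vpair (vnat k) (vmove (p ! k)) \<in> {vpair (vnat k) (vmove (q ! k)) | k. k < length q}"
      using that eq by blast
    then show ?thesis by auto
  qed
  have 2: "k < length p" if "k < length q" for k
  proof -
    have "vpair (vnat k) (vmove (q ! k)) \<in> {vpair (vnat k) (vmove (p ! k)) | k. k < length p}"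
      using that eq by blast
    then show ?thesis by auto
  qed
  have "length p = length q" using 1 2 by (meson linorder_neqE_nat less_irrefl)
  then show "p = q" using 1 by (auto intro!: nth_equalityI)
qed simp

section \<open>Closed unbounded classes and their increasing sequences\<close>

lemma club_class_vord: "club_class C \<Longrightarrow> \<gamma> \<in> C \<Longrightarrow> vord \<gamma>"
  unfolding club_class_def by (elim conjE) (rule bspec)

lemma club_class_unbounded: "club_class C \<Longrightarrow> vord \<alpha> \<Longrightarrow> \<exists>\<gamma>\<in>C. \<alpha> \<in> elts \<gamma>"
  unfolding club_class_def by (elim conjE) (rule mp, rule spec)

lemma club_class_closed:
  "club_class C \<Longrightarrow> vord \<mu> \<Longrightarrow> elts \<mu> \<noteq> {} \<Longrightarrow>
    (\<And>\<alpha>. \<alpha> \<in> elts \<mu> \<Longrightarrow> \<exists>\<gamma>\<in>C. \<alpha> \<in> elts \<gamma> \<and> \<gamma> \<in> elts \<mu>) \<Longrightarrow> \<mu> \<in> C"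
  unfolding club_class_def by (elim conjE, erule allE[of _ \<mu>], erule mp) (intro conjI ballI)

lemma increasing_seqs_vord: "club_class C \<Longrightarrow> c \<in> increasing_seqs C \<Longrightarrow> vord (c i)"
  by (rule club_class_vord[of C]) (simp_all add: increasing_seqs_def)

text \<open>An iterated union of a sequence coded as a set of pairs collects the indices besides the
  values; by this inclusion the indices add nothing to the supremum.\<close>

lemma vnat_subset_seq:
  fixes c :: "nat \<Rightarrow> 'v::zf_universe"
  assumes "club_class C" "c \<in> increasing_seqs C" shows "elts (vnat i) \<subseteq> elts (c i)"
proof (induction i)
  case (Suc i)
  have o: "vord (vnat i :: 'v)" for i
  proof (induction i)
    case 0
    show ?case by (rule vordI) auto
  next
    case (Suc i)
    then show ?case using vord_succ by simp
  qed
  have "vnat i \<in> elts (c (Suc i))"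
  proof -
    have "vnat i \<in> elts (c i) \<or> vnat i = c i"
      using Suc vord_subset[OF o increasing_seqs_vord[OF assms]] by blast
    moreover have "c i \<in> elts (c (Suc i))" using assms(2) by (simp add: increasing_seqs_def)
    ultimately show ?thesis using vord_trans[OF increasing_seqs_vord[OF assms, of "Suc i"]] by auto
  qed
  then show ?case using Suc vord_trans[OF increasing_seqs_vord[OF assms, of "Suc i"]] by auto
qed simp

subsection \<open>A sequence in the club with large gaps\<close>

text \<open>The part of \<open>X\<close> above \<open>\<gamma>\<close> is a proper class, so it does
  not inject into the power set of \<open>y\<close>; by comparability of cardinals the power set
  injects into it. Replacement bounds the image by some \<open>\<nu>\<close>, and an injection of
  the interval into \<open>y\<close> would then contradict Cantor's theorem.\<close>

lemma ex_not_injective: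
  fixes X :: "'v::zf_universe set" and y :: 'v
  assumes X: "\<And>x. x \<in> X \<Longrightarrow> vord x" "\<And>\<alpha>. vord \<alpha> \<Longrightarrow> \<exists>\<gamma>\<in>X. \<alpha> \<in> elts \<gamma>" and \<gamma>: "vord \<gamma>"
  shows "\<exists>\<nu>. vord \<nu> \<and> (\<forall>g. g ` {h\<in>X. \<gamma> \<in> elts h \<and> h \<in> elts \<nu>} \<subseteq> elts y \<longrightarrow>
     \<not> inj_on g {h\<in>X. \<gamma> \<in> elts h \<and> h \<in> elts \<nu>})"
proof -
  let ?Y = "{h\<in>X. \<gamma> \<in> elts h}"
  from power[of y] obtain P :: 'v where P: "elts P = {z. elts z \<subseteq> elts y}" by auto
  have nsmall: "?Y \<notin> range elts"
  proof
    assume "?Y \<in> range elts"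
    then obtain \<alpha> where \<alpha>: "vord \<alpha>" "\<And>x. x \<in> ?Y \<Longrightarrow> x \<in> elts \<alpha>" using vord_bound[of ?Y] X(1) by blast
    have "\<exists>\<alpha>'. vord \<alpha>' \<and> \<alpha> \<in> elts \<alpha>' \<and> \<gamma> \<in> elts \<alpha>'"
      using vord_bound[of "{\<alpha>,\<gamma>}"] \<alpha>(1) \<gamma> small_countable by (metis countable_finite finite.intros insertCI insertE singletonD)
    then obtain \<alpha>' where \<alpha>': "vord \<alpha>'" "\<alpha> \<in> elts \<alpha>'" "\<gamma> \<in> elts \<alpha>'" by auto
    from X(2)[OF \<alpha>'(1)] obtain h where h: "h \<in> X" "\<alpha>' \<in> elts h" by auto
    with vord_trans[OF X(1) h(2)] \<alpha>' have "\<alpha> \<in> elts h" "h \<in> ?Y" by auto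
    with \<alpha>(2) show False using mem_asym by blast
  qed
  have "(card_of (elts P), card_of ?Y) \<in> ordLeq \<or> (card_of ?Y, card_of (elts P)) \<in> ordLeq"
    by (rule ordLeq_total) (simp_all add: card_of_Well_order)
  moreover have "\<not> (card_of ?Y, card_of (elts P)) \<in> ordLeq"
  proof
    assume "(card_of ?Y, card_of (elts P)) \<in> ordLeq"
    then obtain f where f: "inj_on f ?Y" "f ` ?Y \<subseteq> elts P" unfolding card_of_ordLeq[symmetric] by blast
    have "the_inv_into ?Y f ` (f ` ?Y) = ?Y" using f(1) by (simp add: the_inv_into_onto)
    then show False using small_image[OF small_subset[OF f(2)], of "the_inv_into ?Y f"] nsmall by simp
  qed
  ultimately obtain j where j: "inj_on j (elts P)" "j ` elts P \<subseteq> ?Y" unfolding card_of_ordLeq[symmetric] by blast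
  have "j ` elts P \<in> range elts" by (rule replacement)
  moreover have "\<And>x. x \<in> j ` elts P \<Longrightarrow> vord x" using j(2) X(1) by blast
  ultimately obtain \<nu> where \<nu>: "vord \<nu>" "\<And>x. x \<in> j ` elts P \<Longrightarrow> x \<in> elts \<nu>"
    using vord_bound[of "j ` elts P"] by blast
  let ?Z = "{h\<in>X. \<gamma> \<in> elts h \<and> h \<in> elts \<nu>}"
  have False if g: "g ` ?Z \<subseteq> elts y" "inj_on g ?Z" for g
  proof -
    have jz: "j ` elts P \<subseteq> ?Z" using j(2) \<nu>(2) by blast
    have "(g \<circ> j) ` elts P \<subseteq> elts y" using jz g(1) by fastforce
    moreover have "inj_on (g \<circ> j) (elts P)" using comp_inj_on[OF j(1) inj_on_subset[OF g(2) jz]] .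
    moreover have vs: "elts (vset Z) = Z" if "Z \<subseteq> elts y" for Z
      by (rule elts_vset) (rule small_subset[OF that])
    have "vset ` Pow (elts y) \<subseteq> elts P" using P vs by auto
    moreover have "inj_on vset (Pow (elts y))"
      by (rule inj_on_inverseI[where g = elts]) (use vs in auto)
    ultimately have "inj_on (\<lambda>Z. (g \<circ> j) (vset Z)) (Pow (elts y))" "(\<lambda>Z. (g \<circ> j) (vset Z)) ` Pow (elts y) \<subseteq> elts y"
      unfolding inj_on_def image_subset_iff by blast+
    then have "(card_of (Pow (elts y)), card_of (elts y)) \<in> ordLeq" using card_of_ordLeq by blast
    then show False using card_of_Pow not_ordLess_ordLeq by blast
  qed
  with \<nu>(1) show ?thesis by blast
qed

text \<open>Largeness is expressed by HOL functions instead of cardinals of the universe, so that it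
  applies directly to the map sending an indiscernible to the strategy's answer.\<close>

definition gap_large :: "'v::zf_universe set \<Rightarrow> 'v \<Rightarrow> 'v \<Rightarrow> bool" where
  "gap_large C \<delta> \<gamma> \<longleftrightarrow> (\<forall>g. g ` {h\<in>C. \<delta> \<in> elts h \<and> h \<in> elts \<gamma>} \<subseteq> elts \<delta> \<longrightarrow>
     \<not> inj_on g {h\<in>C. \<delta> \<in> elts h \<and> h \<in> elts \<gamma>})"

lemma gap_large_mono:
  assumes "gap_large C \<delta> \<gamma>" "vord \<delta>" "vord \<gamma>'" "\<delta>' = \<delta> \<or> \<delta>' \<in> elts \<delta>" "\<gamma> = \<gamma>' \<or> \<gamma> \<in> elts \<gamma>'"
    "\<And>h. h \<in> C \<Longrightarrow> vord h"
  shows "gap_large C \<delta>' \<gamma>'"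
proof -
  have sub: "{h\<in>C. \<delta> \<in> elts h \<and> h \<in> elts \<gamma>} \<subseteq> {h\<in>C. \<delta>' \<in> elts h \<and> h \<in> elts \<gamma>'}"
    using assms vord_trans by blast
  moreover have "elts \<delta>' \<subseteq> elts \<delta>" using assms(2,4) vord_trans by blast
  ultimately show ?thesis using assms(1) unfolding gap_large_def
    by (meson image_mono inj_on_subset order_trans)
qed

definition gap_points :: "'v::zf_universe set \<Rightarrow> 'v set" where
  "gap_points C = {\<gamma>\<in>C. \<forall>\<delta>\<in>elts \<gamma>. gap_large C \<delta> \<gamma>}"

text \<open>The supremum of an \<omega>-chain in \<open>C\<close> with large gaps between
  consecutive terms works: each smaller \<open>\<delta>\<close> lies below some term, and the next
  gap is large enough for it by monotonicity.\<close>

lemma gap_points_unbounded: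
  fixes C :: "'v::zf_universe set"
  assumes C: "club_class C" and \<alpha>: "vord \<alpha>"
  shows "\<exists>\<gamma>\<in>gap_points C. \<alpha> \<in> elts \<gamma>"
proof -
  note ord = club_class_vord[OF C] and unb = club_class_unbounded[OF C]
  have step: "\<exists>\<gamma>. \<gamma> \<in> C \<and> \<beta> \<in> elts \<gamma> \<and> gap_large C \<beta> \<gamma>" if \<beta>: "vord \<beta>" for \<beta>
  proof -
    have "\<exists>\<nu>. vord \<nu> \<and> gap_large C \<beta> \<nu>"
      unfolding gap_large_def by (rule ex_not_injective) (simp_all add: ord unb \<beta>)
    then obtain \<nu> where \<nu>: "vord \<nu>" "gap_large C \<beta> \<nu>" by auto
    from vord_bound[of "{\<beta>, \<nu>}"] \<beta> \<nu>(1) obtain \<mu> where \<mu>: "vord \<mu>" "\<beta> \<in> elts \<mu>" "\<nu> \<in> elts \<mu>"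
      by (metis countable_empty countable_insert insertCI insertE singletonD small_countable)
    from unb[OF \<mu>(1)] obtain \<gamma> where "\<gamma> \<in> C" "\<mu> \<in> elts \<gamma>" by auto
    with \<mu> \<nu> \<beta> show ?thesis using gap_large_mono[OF \<nu>(2) \<beta> ord[OF \<open>\<gamma> \<in> C\<close>] _ _ ord] vord_trans[OF ord[OF \<open>\<gamma> \<in> C\<close>]] by blast
  qed
  have "\<exists>f. \<forall>n::nat. (f n \<in> C \<and> \<alpha> \<in> elts (f n)) \<and> (f n \<in> elts (f (Suc n)) \<and> gap_large C (f n) (f (Suc n)))"
  proof (rule dependent_nat_choice)
    show "\<exists>x. x \<in> C \<and> \<alpha> \<in> elts x" using unb[OF \<alpha>] by auto
    fix x n assume x: "x \<in> C \<and> \<alpha> \<in> elts x"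
    with step[OF ord, of x] obtain \<gamma> where "\<gamma> \<in> C" "x \<in> elts \<gamma>" "gap_large C x \<gamma>" by auto
    then show "\<exists>y. (y \<in> C \<and> \<alpha> \<in> elts y) \<and> x \<in> elts y \<and> gap_large C x y"
      using x vord_trans[OF ord[of \<gamma>]] by blast
  qed
  then obtain f where f: "\<And>n. f n \<in> C" "\<And>n. \<alpha> \<in> elts (f n)" "\<And>n. f n \<in> elts (f (Suc n))"
    "\<And>n. gap_large C (f n) (f (Suc n))" by blast
  define \<mu> where "\<mu> = vset (\<Union>x\<in>range f. elts x)"
  have \<mu>: "vord \<mu>" "elts \<mu> = (\<Union>x\<in>range f. elts x)"
    using vord_Union[of "range f"] f(1) ord small_countable[of "range f"] unfolding \<mu>_def by auto
  have fin: "f n \<in> elts \<mu>" for n using \<mu>(2) f(3) by auto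
  have "\<exists>\<gamma>\<in>C. \<beta> \<in> elts \<gamma> \<and> \<gamma> \<in> elts \<mu>" if "\<beta> \<in> elts \<mu>" for \<beta>
  proof -
    from that obtain n where "\<beta> \<in> elts (f n)" unfolding \<mu>(2) by auto
    then show ?thesis using f(1)[of n] fin[of n] by auto
  qed
  then have "\<mu> \<in> C" using \<mu>(1) fin[of 0] by (intro club_class_closed[OF C]) auto
  moreover have "gap_large C \<delta> \<mu>" if \<delta>: "\<delta> \<in> elts \<mu>" for \<delta>
  proof -
    from \<delta> obtain n where "\<delta> \<in> elts (f n)" using \<mu>(2) by auto
    then show ?thesis using gap_large_mono[OF f(4)[of n] ord[OF f(1)] \<mu>(1) _ _ ord] fin[of "Suc n"] by simp
  qed
  moreover have "\<alpha> \<in> elts \<mu>" using f(2)[of 0] unfolding \<mu>(2) by auto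
  ultimately show ?thesis unfolding gap_points_def by auto
qed

lemma gap_points_closed:
  assumes C: "club_class C" and \<mu>: "vord \<mu>" "elts \<mu> \<noteq> {}"
    "\<And>\<alpha>. \<alpha> \<in> elts \<mu> \<Longrightarrow> \<exists>\<gamma>\<in>gap_points C. \<alpha> \<in> elts \<gamma> \<and> \<gamma> \<in> elts \<mu>"
  shows "\<mu> \<in> gap_points C"
proof -
  note ord = club_class_vord[OF C]
  have "\<exists>\<gamma>\<in>C. \<alpha> \<in> elts \<gamma> \<and> \<gamma> \<in> elts \<mu>" if "\<alpha> \<in> elts \<mu>" for \<alpha>
    using \<mu>(3)[OF that] by (auto simp: gap_points_def)
  then have "\<mu> \<in> C" using \<mu>(1,2) by (intro club_class_closed[OF C]) auto
  moreover have "gap_large C \<delta> \<mu>" if \<delta>: "\<delta> \<in> elts \<mu>" for \<delta>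
  proof -
    from \<mu>(3)[OF \<delta>] obtain \<gamma> where "\<gamma> \<in> gap_points C" "\<delta> \<in> elts \<gamma>" "\<gamma> \<in> elts \<mu>" by auto
    then show ?thesis
      using gap_large_mono[of C \<delta> \<gamma> \<mu> \<delta>] \<mu>(1) ord vord_elts unfolding gap_points_def by blast
  qed
  ultimately show ?thesis by (simp add: gap_points_def)
qed

text \<open>
  The least \<open>\<mu>\<close> below which there are uncountably many gap points above \<open>\<alpha>\<close> is a gap point of
  uncountable cofinality.
\<close>

lemma ex_gap_point_uncountable_cof:
  fixes C :: "'v::zf_universe set"
  assumes C: "club_class C" and \<alpha>: "vord \<alpha>"
  shows "\<exists>\<mu>\<in>gap_points C. \<alpha> \<in> elts \<mu> \<and>
    (\<forall>S. countable S \<and> S \<subseteq> elts \<mu> \<longrightarrow> (\<exists>h\<in>C. h \<in> elts \<mu> \<and> (\<forall>s\<in>S. s \<in> elts h)))"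
proof -
  let ?G = "gap_points C"
  let ?U = "\<lambda>\<nu>. {h\<in>?G. \<alpha> \<in> elts h \<and> h \<in> elts \<nu>}"
  have ord: "vord h" if "h \<in> ?G" for h
    using that club_class_vord[OF C] by (simp add: gap_points_def)
  \<comment> \<open>With \<omega> as the target set, the absence of injections says that the gap
    points in the interval are uncountable.\<close>
  have "\<exists>\<nu>. vord \<nu> \<and> (\<forall>g. g ` ?U \<nu> \<subseteq> elts (vset (range vnat) :: 'v) \<longrightarrow> \<not> inj_on g (?U \<nu>))"
    by (rule ex_not_injective) (simp_all add: ord gap_points_unbounded[OF C] \<alpha>)
  then obtain \<nu> where \<nu>: "vord \<nu>" "\<forall>g. g ` ?U \<nu> \<subseteq> elts (vset (range vnat) :: 'v) \<longrightarrow> \<not> inj_on g (?U \<nu>)"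
    by blast
  have "uncountable (?U \<nu>)"
  proof
    assume "countable (?U \<nu>)"
    then obtain f :: "'v \<Rightarrow> nat" where "inj_on f (?U \<nu>)" unfolding countable_def by auto
    then have "inj_on (vnat \<circ> f :: 'v \<Rightarrow> 'v) (?U \<nu>)" by (auto simp: inj_on_def)
    moreover have "elts (vset (range vnat) :: 'v) = range vnat" by (simp add: elts_vset small_countable)
    ultimately show False using \<nu>(2)[rule_format, of "vnat \<circ> f"] by auto
  qed
  with \<nu>(1) have "\<exists>\<mu>. (vord \<mu> \<and> uncountable (?U \<mu>)) \<and> (\<forall>\<nu>\<in>elts \<mu>. \<not> (vord \<nu> \<and> uncountable (?U \<nu>)))"
    by (intro ex_mem_minimal[of "\<lambda>\<nu>. vord \<nu> \<and> uncountable (?U \<nu>)"]) simp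
  then obtain \<mu> where \<mu>: "vord \<mu>" "uncountable (?U \<mu>)"
    and "\<forall>\<nu>\<in>elts \<mu>. \<not> (vord \<nu> \<and> uncountable (?U \<nu>))" by auto
  then have min: "\<And>\<nu>. \<nu> \<in> elts \<mu> \<Longrightarrow> countable (?U \<nu>)" using vord_elts by auto
  have bd: "\<exists>h\<in>?G. \<alpha> \<in> elts h \<and> h \<in> elts \<mu> \<and> (\<forall>s\<in>S. s \<in> elts h)" if S: "countable S" "S \<subseteq> elts \<mu>" for S
  proof -
    \<comment> \<open>By minimality of \<open>\<mu>\<close>, only countably many of the gap points
      in question lie at or below some member of \<open>S\<close>; uncountably many lie below
      \<open>\<mu>\<close>, so one of them exceeds all of \<open>S\<close>.\<close>
    have "countable (\<Union>s\<in>S. ?U s \<union> {s})" using S min by auto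
    then obtain h where h: "h \<in> ?U \<mu>" "h \<notin> (\<Union>s\<in>S. ?U s \<union> {s})" using \<mu>(2)
      by (metis (no_types, lifting) countable_subset subsetI)
    have "s \<in> elts h" if "s \<in> S" for s
    proof -
      have "s \<in> elts \<mu>" using that S(2) by auto
      moreover have "h \<notin> elts s" "h \<noteq> s" using h that by auto
      ultimately show ?thesis using vord_linear[OF ord vord_elts[OF \<mu>(1)], of h s] h(1) by auto
    qed
    then show ?thesis using h(1) by auto
  qed
  obtain h where h: "h \<in> ?G" "\<alpha> \<in> elts h" "h \<in> elts \<mu>" using bd[of "{}"] by auto
  have "\<mu> \<in> ?G"
  proof (rule gap_points_closed[OF C \<mu>(1)])
    show "elts \<mu> \<noteq> {}" using h by auto
    show "\<exists>\<gamma>\<in>?G. \<beta> \<in> elts \<gamma> \<and> \<gamma> \<in> elts \<mu>" if "\<beta> \<in> elts \<mu>" for \<beta> using bd[of "{\<beta>}"] that by auto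
  qed
  moreover have "\<alpha> \<in> elts \<mu>" using vord_trans[OF \<mu>(1) h(3,2)] .
  moreover have "\<exists>h\<in>C. h \<in> elts \<mu> \<and> (\<forall>s\<in>S. s \<in> elts h)" if "countable S" "S \<subseteq> elts \<mu>" for S
    using bd[OF that] by (auto simp: gap_points_def)
  ultimately show ?thesis by auto
qed

text \<open>The second clause is for the pigeonhole argument, the third for choosing the opponent's
  ordinals one after another inside a gap.\<close>

lemma ex_spacious_seq:
  fixes C :: "'v::zf_universe set"
  assumes C: "club_class C"
  obtains c where "c \<in> increasing_seqs C"
    "\<And>i \<delta>. \<delta> \<in> elts (c i) \<Longrightarrow> gap_large C \<delta> (c i)"
    "\<And>i S. countable S \<Longrightarrow> S \<subseteq> elts (c i) \<Longrightarrow> \<exists>h\<in>C. h \<in> elts (c i) \<and> (\<forall>s\<in>S. s \<in> elts h)"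
proof -
  have ord: "vord h" if "h \<in> gap_points C" for h
    using that club_class_vord[OF C] by (simp add: gap_points_def)
  let ?P = "\<lambda>\<mu>. \<mu> \<in> gap_points C \<and>
    (\<forall>S. countable S \<and> S \<subseteq> elts \<mu> \<longrightarrow> (\<exists>h\<in>C. h \<in> elts \<mu> \<and> (\<forall>s\<in>S. s \<in> elts h)))"
  have "\<exists>c. \<forall>i::nat. ?P (c i) \<and> c i \<in> elts (c (Suc i))"
  proof (rule dependent_nat_choice)
    have "vord (vset {} :: 'v)" by (rule vordI) auto
    from ex_gap_point_uncountable_cof[OF C this] show "\<exists>\<mu>. ?P \<mu>" by auto
    show "\<exists>y. ?P y \<and> x \<in> elts y" if "?P x" for x
      using ex_gap_point_uncountable_cof[OF C ord, of x] that by auto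
  qed
  then obtain c where c0: "\<forall>i::nat. ?P (c i) \<and> c i \<in> elts (c (Suc i))" ..
  have c: "?P (c i)" "c i \<in> elts (c (Suc i))" for i using c0 by auto
  have "c i \<in> elts (c j)" if "i < j" for i j
    using that
  proof (induction j)
    case (Suc j)
    then show ?case using c(2)[of j] vord_trans[OF ord, of "c (Suc j)" "c j" "c i"] c(1)[of "Suc j"]
      by (auto simp: less_Suc_eq)
  qed simp
  then have "c \<in> increasing_seqs C" using c(1) unfolding increasing_seqs_def gap_points_def by simp
  then show thesis
  proof (rule that)
    show "gap_large C \<delta> (c i)" if "\<delta> \<in> elts (c i)" for i \<delta>
      using c(1)[of i] that by (simp add: gap_points_def)
    show "\<exists>h\<in>C. h \<in> elts (c i) \<and> (\<forall>s\<in>S. s \<in> elts h)" if "countable S" "S \<subseteq> elts (c i)" for i S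
      using c(1)[of i] that by simp
  qed
qed

subsection \<open>Recursive functions\<close>

lemma recursive_cong: "recursive k f \<Longrightarrow> (\<And>xs. length xs = k \<Longrightarrow> f xs = g xs) \<Longrightarrow> recursive k g"
  by (rule recursive.agree) auto

lemma recursive_comp1:
  assumes "recursive 1 (\<lambda>xs. F (xs ! 0))" "recursive k f"
  shows "recursive k (\<lambda>xs. F (f xs))"
  using recursive.comp[of "[f]" "\<lambda>xs. F (xs ! 0)" k] assms by simp

lemma recursive_comp2:
  assumes "recursive 2 (\<lambda>xs. F (xs ! 0) (xs ! 1))" "recursive k f" "recursive k g"
  shows "recursive k (\<lambda>xs. F (f xs) (g xs))"
  using recursive.comp[of "[f, g]" "\<lambda>xs. F (xs ! 0) (xs ! 1)" k] assms by (simp add: numeral_2_eq_2)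

lemma recursive_Suc: "recursive k f \<Longrightarrow> recursive k (\<lambda>xs. Suc (f xs))"
  by (rule recursive_comp1[OF recursive.succ])

lemma recursive_const: "recursive k (\<lambda>_. n)"
  by (induction n) (auto intro: recursive.zero recursive_Suc)

lemma recursive_primrec1:
  assumes "recursive 2 (\<lambda>xs. h (xs ! 0) (xs ! 1))"
  shows "recursive 1 (\<lambda>xs. rec_nat b h (xs ! 0))"
proof -
  have "recursive (Suc 0) (\<lambda>xs. rec_nat ((\<lambda>_. b) (tl xs))
      (\<lambda>n r. (\<lambda>xs. h (xs ! 0) (xs ! 1)) (n # r # tl xs)) (hd xs))"
    using assms by (intro recursive.prim_rec recursive_const) (simp add: numeral_2_eq_2)
  then show ?thesis
    by (auto elim!: recursive_cong simp: length_Suc_conv)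
qed

lemma recursive_primrec2:
  assumes "recursive 1 (\<lambda>xs. b (xs ! 0))" "recursive 3 (\<lambda>xs. h (xs ! 0) (xs ! 1) (xs ! 2))"
  shows "recursive 2 (\<lambda>xs. rec_nat (b (xs ! 1)) (\<lambda>n r. h n r (xs ! 1)) (xs ! 0))"
proof -
  have "recursive (Suc 1) (\<lambda>xs. rec_nat ((\<lambda>xs. b (xs ! 0)) (tl xs))
      (\<lambda>n r. (\<lambda>xs. h (xs ! 0) (xs ! 1) (xs ! 2)) (n # r # tl xs)) (hd xs))"
    using assms by (intro recursive.prim_rec) (simp_all add: numeral_3_eq_3)
  then have "recursive 2 (\<lambda>xs. rec_nat ((\<lambda>xs. b (xs ! 0)) (tl xs))
      (\<lambda>n r. (\<lambda>xs. h (xs ! 0) (xs ! 1) (xs ! 2)) (n # r # tl xs)) (hd xs))"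
    by (simp add: numeral_2_eq_2)
  then show ?thesis
    by (rule recursive_cong) (auto simp: length_Suc_conv numeral_2_eq_2)
qed

lemma recursive_add: "recursive k f \<Longrightarrow> recursive k g \<Longrightarrow> recursive k (\<lambda>xs. f xs + g xs)"
proof (rule recursive_comp2[where F = "(+)"])
  have "rec_nat m (\<lambda>n r. Suc r) n = n + m" for m n :: nat by (induction n) auto
  with recursive_primrec2[of "\<lambda>x. x" "\<lambda>n r y. Suc r"]
  show "recursive 2 (\<lambda>xs. xs ! 0 + xs ! 1)" by (simp add: recursive.proj recursive_Suc)
qed

lemma recursive_mult: "recursive k f \<Longrightarrow> recursive k g \<Longrightarrow> recursive k (\<lambda>xs. f xs * g xs)"
proof (rule recursive_comp2[where F = "(*)"])
  have "rec_nat 0 (\<lambda>n r. r + m) n = n * m" for m n :: nat by (induction n) auto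
  with recursive_primrec2[of "\<lambda>x. 0" "\<lambda>n r y. r + y"]
  show "recursive 2 (\<lambda>xs. xs ! 0 * xs ! 1)" by (simp add: recursive.proj recursive_const recursive_add)
qed

lemma recursive_diff: "recursive k f \<Longrightarrow> recursive k g \<Longrightarrow> recursive k (\<lambda>xs. f xs - g xs)"
proof -
  have "rec_nat 0 (\<lambda>n r. n) n = n - 1" for n :: nat by (cases n) auto
  with recursive_primrec1[of "\<lambda>n r. n" 0] have 1: "recursive 1 (\<lambda>xs. xs ! 0 - 1)"
    by (simp add: recursive.proj)
  have "rec_nat m (\<lambda>n r. r - 1) n = m - n" for m n :: nat by (induction n) auto
  moreover have "recursive 2 (\<lambda>xs. rec_nat (xs ! 1) (\<lambda>n r. r - 1) (xs ! 0))"
    by (rule recursive_primrec2[of "\<lambda>x. x" "\<lambda>n r y. r - 1"]) (intro recursive.proj recursive_comp1[OF 1], simp)+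
  ultimately have "recursive 2 (\<lambda>xs. xs ! 1 - xs ! 0)" by simp
  then show "recursive k f \<Longrightarrow> recursive k g \<Longrightarrow> recursive k (\<lambda>xs. f xs - g xs)"
    by (rule recursive_comp2[where F = "\<lambda>x y. y - x"])
qed

lemma recursive_rel_le:
  "recursive k f \<Longrightarrow> recursive k g \<Longrightarrow> recursive_rel k (\<lambda>xs. f xs \<le> g xs)"
  unfolding recursive_rel_def
  by (rule recursive_cong[of _ "\<lambda>xs. 1 - (f xs - g xs)"]) (auto intro!: recursive_diff recursive_const)

lemma recursive_rel_not: "recursive_rel k R \<Longrightarrow> recursive_rel k (\<lambda>xs. \<not> R xs)"
  unfolding recursive_rel_def
  by (rule recursive_cong[of _ "\<lambda>xs. 1 - (if R xs then 1 else 0)"]) (auto intro!: recursive_diff recursive_const)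

lemma recursive_rel_conj:
  "recursive_rel k R \<Longrightarrow> recursive_rel k S \<Longrightarrow> recursive_rel k (\<lambda>xs. R xs \<and> S xs)"
  unfolding recursive_rel_def
  by (rule recursive_cong[of _ "\<lambda>xs. (if R xs then 1 else 0) * (if S xs then 1 else 0)"]) (auto intro!: recursive_mult)

lemma recursive_rel_disj:
  "recursive_rel k R \<Longrightarrow> recursive_rel k S \<Longrightarrow> recursive_rel k (\<lambda>xs. R xs \<or> S xs)"
  using recursive_rel_not[OF recursive_rel_conj[OF recursive_rel_not recursive_rel_not], of k R S] by simp

lemma recursive_rel_less:
  "recursive k f \<Longrightarrow> recursive k g \<Longrightarrow> recursive_rel k (\<lambda>xs. f xs < g xs)"
  using recursive_rel_not[OF recursive_rel_le, of k g f] by (simp add: not_le)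

lemma recursive_rel_eq:
  "recursive k f \<Longrightarrow> recursive k g \<Longrightarrow> recursive_rel k (\<lambda>xs. f xs = g xs)"
  using recursive_rel_conj[OF recursive_rel_le recursive_rel_le, of k f g g f] by (simp add: eq_iff)

lemma recursive_if:
  assumes "recursive_rel k R" "recursive k f" "recursive k g"
  shows "recursive k (\<lambda>xs. if R xs then f xs else g xs)"
proof (rule recursive_cong)
  let ?c = "\<lambda>xs. if R xs then 1 else 0"
  have c: "recursive k ?c" using assms(1) by (simp add: recursive_rel_def)
  show "recursive k (\<lambda>xs. ?c xs * f xs + (1 - ?c xs) * g xs)"
    by (intro recursive_add recursive_mult recursive_diff recursive_const c assms)
qed auto

lemma recursive_rel_if:
  assumes "recursive_rel k P" "recursive_rel k Q" "recursive_rel k R"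
  shows "recursive_rel k (\<lambda>xs. if P xs then Q xs else R xs)"
  using recursive_if[OF assms(1) assms(2,3)[unfolded recursive_rel_def]] unfolding recursive_rel_def
  by (rule recursive_cong) auto

lemma recursive_Least:
  assumes "recursive_rel (Suc k) R" "\<And>xs. length xs = k \<Longrightarrow> \<exists>n. R (n # xs)"
  shows "recursive k (\<lambda>xs. LEAST n. R (n # xs))"
proof -
  have "recursive k (\<lambda>xs. LEAST n. (if \<not> R (n # xs) then 1 else 0) = (0::nat))"
    by (rule recursive.minimize)
      (use recursive_rel_not[OF assms(1)] assms(2) in \<open>auto simp: recursive_rel_def\<close>)
  moreover have "(if \<not> P then 1 else 0) = (0::nat) \<longleftrightarrow> P" for P by simp
  ultimately show ?thesis by (simp only:)
qed

text \<open>A searched number is prepended to the argument list; this makes a function of the old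
  arguments ignore it.\<close>

lemma recursive_drop1:
  "recursive k f \<Longrightarrow> recursive (Suc k) (\<lambda>xs. f (tl xs))"
proof -
  assume f: "recursive k f"
  have "recursive (Suc k) (\<lambda>xs. f (map (\<lambda>g. g xs) (map (\<lambda>i xs. xs ! Suc i) [0..<k])))"
    by (rule recursive.comp) (use f in \<open>auto intro: recursive.proj\<close>)
  then show ?thesis
  proof (rule recursive_cong)
    fix xs :: "nat list" assume "length xs = Suc k"
    then have "map (\<lambda>g. g xs) (map (\<lambda>i xs. xs ! Suc i) [0..<k]) = tl xs"
      by (intro nth_equalityI) (auto simp: nth_tl)
    then show "f (map (\<lambda>g. g xs) (map (\<lambda>i xs. xs ! Suc i) [0..<k])) = f (tl xs)" by simp
  qed
qed

lemma recursive_rel_bex: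
  assumes "recursive_rel (Suc k) R" "recursive k b"
  shows "recursive_rel k (\<lambda>xs. \<exists>n<b xs. R (n # xs))"
proof -
  \<comment> \<open>Accepting the bound itself makes the search total; a witness exists iff the
    search stops strictly below the bound.\<close>
  have "recursive_rel (Suc k) (\<lambda>xs. R xs \<or> b (tl xs) \<le> xs ! 0)"
    by (intro recursive_rel_disj recursive_rel_le assms recursive_drop1 recursive.proj) simp
  then have "recursive k (\<lambda>xs. LEAST n. (\<lambda>xs. R xs \<or> b (tl xs) \<le> xs ! 0) (n # xs))"
    by (rule recursive_Least) auto
  then have r: "recursive k (\<lambda>xs. LEAST n. R (n # xs) \<or> b xs \<le> n)" by simp
  have "(LEAST n. R (n # xs) \<or> b xs \<le> n) < b xs \<longleftrightarrow> (\<exists>n<b xs. R (n # xs))" (is "?m < _ \<longleftrightarrow> _") for xs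
  proof
    have "R (?m # xs) \<or> b xs \<le> ?m" by (rule LeastI[of _ "b xs"]) simp
    then show "?m < b xs \<Longrightarrow> \<exists>n<b xs. R (n # xs)" by auto
    assume "\<exists>n<b xs. R (n # xs)"
    then obtain n where "n < b xs" "R (n # xs)" by auto
    moreover from this have "?m \<le> n" by (intro Least_le) simp
    ultimately show "?m < b xs" by simp
  qed
  with recursive_rel_less[OF r assms(2)] show ?thesis by simp
qed

lemma recursive_rel_ball:
  assumes "recursive_rel (Suc k) R" "recursive k b"
  shows "recursive_rel k (\<lambda>xs. \<forall>n<b xs. R (n # xs))"
  using recursive_rel_not[OF recursive_rel_bex[OF recursive_rel_not[OF assms(1)] assms(2)]] by simp

lemmas recursive_intros = recursive.proj recursive_const recursive_Suc recursive_add recursive_mult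
  recursive_diff recursive_rel_le recursive_rel_less recursive_rel_eq recursive_rel_not
  recursive_rel_conj recursive_rel_disj recursive_if recursive_rel_if

subsection \<open>Recursive operations on codes of lists\<close>

lemma recursive_prod_encode:
  "recursive k f \<Longrightarrow> recursive k g \<Longrightarrow> recursive k (\<lambda>xs. prod_encode (f xs, g xs))"
proof (rule recursive_comp2[where F = "\<lambda>x y. prod_encode (x, y)"])
  have eq: "rec_nat 0 (\<lambda>n r. r + Suc n) n = triangle n" for n by (induction n) auto
  have "recursive 2 (\<lambda>xs. xs ! 1 + Suc (xs ! 0))"
    by (intro recursive_add recursive_Suc recursive.proj) auto
  from recursive_primrec1[OF this, of 0] have t: "recursive 1 (\<lambda>xs. triangle (xs ! 0))"
    by (simp only: eq)
  show "recursive 2 (\<lambda>xs. prod_encode (xs ! 0, xs ! 1))"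
    unfolding prod_encode_def prod.case
    by (intro recursive_add recursive_comp1[OF t] recursive.proj) auto
qed

text \<open>Decoding is a search through candidate components; the second one is bounded by the
  code.\<close>

lemma recursive_fst_decode: "recursive k f \<Longrightarrow> recursive k (\<lambda>xs. fst (prod_decode (f xs)))"
proof (rule recursive_comp1[where F = "\<lambda>z. fst (prod_decode z)"])
  have eq: "(LEAST m. \<exists>n<Suc z. prod_encode (m, n) = z) = fst (prod_decode z)" for z
  proof (rule Least_equality)
    have "prod_encode (fst (prod_decode z), snd (prod_decode z)) = z" by simp
    moreover from this have "snd (prod_decode z) \<le> z" by (metis le_prod_encode_2)
    ultimately show "\<exists>n<Suc z. prod_encode (fst (prod_decode z), n) = z" by (metis less_Suc_eq_le)
  qed (auto simp: prod_encode_inverse)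
  have "recursive_rel (Suc (Suc 1)) (\<lambda>xs. prod_encode (xs ! 1, xs ! 0) = xs ! 2)"
    by (intro recursive_rel_eq recursive_prod_encode recursive.proj) auto
  then have "recursive_rel (Suc 1) (\<lambda>xs. \<exists>n<Suc (xs ! 1). (\<lambda>xs. prod_encode (xs ! 1, xs ! 0) = xs ! 2) (n # xs))"
    by (rule recursive_rel_bex) (intro recursive_Suc recursive.proj, simp)
  then have "recursive 1 (\<lambda>xs. LEAST m. (\<lambda>xs. \<exists>n<Suc (xs ! 1). prod_encode (xs ! 0, n) = xs ! 1) (m # xs))"
    by (intro recursive_Least) (simp_all add: numeral_2_eq_2, metis eq_fst_iff le_prod_encode_2 less_Suc_eq_le prod_decode_inverse surj_pair)
  then show "recursive 1 (\<lambda>xs. fst (prod_decode (xs ! 0)))" by (simp add: eq)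
qed

lemma recursive_snd_decode: "recursive k f \<Longrightarrow> recursive k (\<lambda>xs. snd (prod_decode (f xs)))"
proof (rule recursive_comp1[where F = "\<lambda>z. snd (prod_decode z)"])
  have eq: "(LEAST m. prod_encode (fst (prod_decode z), m) = z) = snd (prod_decode z)" for z
    by (rule Least_equality) (simp, metis order_refl prod_encode_inverse snd_conv)
  have "recursive_rel (Suc 1) (\<lambda>xs. prod_encode (fst (prod_decode (xs ! 1)), xs ! 0) = xs ! 1)"
    by (intro recursive_rel_eq recursive_prod_encode recursive_fst_decode recursive.proj) auto
  then have "recursive 1 (\<lambda>xs. LEAST m. (\<lambda>xs. prod_encode (fst (prod_decode (xs ! 1)), xs ! 0) = xs ! 1) (m # xs))"
    by (rule recursive_Least) (simp, metis prod.collapse prod_decode_inverse)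
  then show "recursive 1 (\<lambda>xs. snd (prod_decode (xs ! 0)))" by (simp add: eq)
qed

lemma recursive_drop:
  "recursive k f \<Longrightarrow> recursive k g \<Longrightarrow> recursive k (\<lambda>xs. list_encode (drop (f xs) (list_decode (g xs))))"
proof (rule recursive_comp2[where F = "\<lambda>j s. list_encode (drop j (list_decode s))"])
  \<comment> \<open>The code of a nonempty list is the successor of a pair code, so \<open>t\<close>
    is the tail on codes and fixes the code 0 of the empty list.\<close>
  define t where "t = (\<lambda>n. if n = 0 then 0 else snd (prod_decode (n - 1)))"
  have t: "t (list_encode l) = list_encode (tl l)" for l by (cases l) (simp_all add: t_def)
  have rt: "recursive 1 (\<lambda>xs. t (xs ! 0))"
    unfolding t_def by (intro recursive_intros recursive_snd_decode) auto
  have r: "recursive 2 (\<lambda>xs. rec_nat (xs ! 1) (\<lambda>n r. t r) (xs ! 0))"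
    by (intro recursive_primrec2[where b = "\<lambda>x. x" and h = "\<lambda>n r y. t r"] recursive.proj recursive_comp1[OF rt]) auto
  have "rec_nat (list_encode l) (\<lambda>n r. t r) j = list_encode (drop j l)" for l j
    by (induction j) (simp_all add: t drop_Suc tl_drop)
  from this[of "list_decode _"] show "recursive 2 (\<lambda>xs. list_encode (drop (xs ! 0) (list_decode (xs ! 1))))"
    using r by simp
qed

lemma recursive_length: "recursive k f \<Longrightarrow> recursive k (\<lambda>xs. length (list_decode (f xs)))"
proof (rule recursive_comp1[where F = "\<lambda>z. length (list_decode z)"])
  have eq: "(LEAST j. list_encode (drop j l) = 0) = length l" for l
    by (rule Least_equality) (simp, metis drop_eq_Nil list_encode.simps(1) list_encode_eq)
  have "recursive_rel (Suc 1) (\<lambda>xs. list_encode (drop (xs ! 0) (list_decode (xs ! 1))) = 0)"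
    by (intro recursive_intros recursive_drop) auto
  then have "recursive 1 (\<lambda>xs. LEAST j. (\<lambda>xs. list_encode (drop (xs ! 0) (list_decode (xs ! 1))) = 0) (j # xs))"
    by (rule recursive_Least) (simp, metis drop_all list_encode.simps(1) order_refl)
  then show "recursive 1 (\<lambda>xs. length (list_decode (xs ! 0)))" by (simp add: eq)
qed

text \<open>The default 0 makes list access total, as recursive functions have to be.\<close>

definition nth0 :: "nat list \<Rightarrow> nat \<Rightarrow> nat" where
  "nth0 l j = (if j < length l then l ! j else 0)"

lemma recursive_nth0:
  "recursive k f \<Longrightarrow> recursive k g \<Longrightarrow> recursive k (\<lambda>xs. nth0 (list_decode (f xs)) (g xs))"
proof (rule recursive_comp2[where F = "\<lambda>s j. nth0 (list_decode s) j"])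
  have eq: "nth0 l j = (if j < length l then fst (prod_decode (list_encode (drop j l) - 1)) else 0)" for l j
    by (simp add: nth0_def flip: Cons_nth_drop_Suc)
  show "recursive 2 (\<lambda>xs. nth0 (list_decode (xs ! 0)) (xs ! 1))"
    unfolding eq by (intro recursive_intros recursive_length recursive_fst_decode recursive_drop) auto
qed

text \<open>The code is found by searching for a list with the right length and entries; recursion
  on the list is avoided.\<close>

lemma recursive_take:
  "recursive k f \<Longrightarrow> recursive k g \<Longrightarrow> recursive k (\<lambda>xs. list_encode (take (f xs) (list_decode (g xs))))"
proof (rule recursive_comp2[where F = "\<lambda>j s. list_encode (take j (list_decode s))"])
  let ?P = "\<lambda>t j s. length (list_decode t) = (if j \<le> length (list_decode s) then j else length (list_decode s)) \<and>
    (\<forall>q<length (list_decode t). nth0 (list_decode t) q = nth0 (list_decode s) q)"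
  have P: "?P t j s \<longleftrightarrow> t = list_encode (take j (list_decode s))" for t j s
  proof -
    have "?P t j s \<longleftrightarrow> list_decode t = take j (list_decode s)"
      by (auto simp: list_eq_iff_nth_eq nth0_def)
    then show ?thesis by (metis list_decode_inverse list_encode_inverse)
  qed
  have "recursive_rel (Suc 3) (\<lambda>xs. nth0 (list_decode (xs ! 1)) (xs ! 0) = nth0 (list_decode (xs ! 3)) (xs ! 0))"
    by (intro recursive_intros recursive_nth0) auto
  then have "recursive_rel 3 (\<lambda>xs. \<forall>q<length (list_decode (xs ! 0)).
      (\<lambda>xs. nth0 (list_decode (xs ! 1)) (xs ! 0) = nth0 (list_decode (xs ! 3)) (xs ! 0)) (q # xs))"
    by (rule recursive_rel_ball) (intro recursive_length recursive.proj, simp)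
  then have "recursive_rel 3 (\<lambda>xs. \<forall>q<length (list_decode (xs ! 0)). nth0 (list_decode (xs ! 0)) q = nth0 (list_decode (xs ! 2)) q)"
    by (simp add: numeral_3_eq_3 numeral_2_eq_2)
  then have "recursive_rel (Suc 2) (\<lambda>xs. ?P (xs ! 0) (xs ! 1) (xs ! 2))"
    by (intro recursive_intros recursive_length) (simp_all add: numeral_3_eq_3)
  then have "recursive 2 (\<lambda>xs. LEAST t. (\<lambda>xs. ?P (xs ! 0) (xs ! 1) (xs ! 2)) (t # xs))"
    by (rule recursive_Least) (unfold P, simp)
  then have "recursive 2 (\<lambda>xs. LEAST t. ?P t (xs ! 0) (xs ! 1))"
    by (simp add: numeral_2_eq_2 cong: if_cong)
  then show "recursive 2 (\<lambda>xs. list_encode (take (xs ! 0) (list_decode (xs ! 1))))"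
    unfolding P by (simp add: Least_equality)
qed


subsection \<open>The Kleene-Brouwer ordering\<close>

text \<open>Proper extensions come before their initial segments, so the empty sequence is the
  maximum and a branch of a tree is an infinite descent.\<close>

fun kb :: "nat list \<Rightarrow> nat list \<Rightarrow> bool" where
  "kb [] ys \<longleftrightarrow> False"
| "kb (x # xs) [] \<longleftrightarrow> True"
| "kb (x # xs) (y # ys) \<longleftrightarrow> x < y \<or> x = y \<and> kb xs ys"

lemma kb_irrefl: "\<not> kb xs xs"
  by (induction xs) auto

lemma kb_trans: "kb xs ys \<Longrightarrow> kb ys zs \<Longrightarrow> kb xs zs"
proof (induction xs ys arbitrary: zs rule: kb.induct)
  case (3 x xs y ys)
  then show ?case by (cases zs) auto
qed auto

lemma kb_total: "xs \<noteq> ys \<Longrightarrow> kb xs ys \<or> kb ys xs"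
proof (induction xs ys rule: kb.induct)
  case (1 ys)
  then show ?case by (cases ys) auto
qed auto

lemma kb_extend: "r \<noteq> [] \<Longrightarrow> kb (p @ r) p"
proof (induction p)
  case Nil
  then show ?case by (cases r) auto
qed auto

text \<open>Only bounded quantifiers and \<open>nth0\<close> occur on the right, which makes the
  ordering recursive on codes. Here \<open>q\<close> is the first place where the lists differ or
  \<open>ys\<close> ends.\<close>

lemma kb_iff:
  "kb xs ys \<longleftrightarrow> (\<exists>q<length xs. q \<le> length ys \<and> (\<forall>r<q. nth0 xs r = nth0 ys r) \<and>
     (length ys \<le> q \<or> nth0 xs q < nth0 ys q))" (is "_ \<longleftrightarrow> ?R xs ys")
proof (induction xs ys rule: kb.induct)
  case (3 x xs y ys)
  have nth0: "nth0 (z # zs) (Suc q) = nth0 zs q" "nth0 (z # zs) 0 = z" for z zs q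
    by (simp_all add: nth0_def)
  have "?R (x # xs) (y # ys) \<longleftrightarrow> x < y \<or> x = y \<and> ?R xs ys"
    by (simp add: Ex_less_Suc2 All_less_Suc2 nth0) blast
  with 3 show ?case by simp
qed (auto simp: nth0_def)

lemma decreasing_nat_stabilizes:
  fixes f :: "nat \<Rightarrow> nat"
  assumes "\<And>n. f (Suc n) \<le> f n" obtains N where "\<And>n. n \<ge> N \<Longrightarrow> f n = f N"
proof -
  define L where "L = (LEAST v. v \<in> range f)"
  have "L \<in> range f" unfolding L_def by (rule LeastI[of _ "f 0"]) simp
  then obtain N where N: "f N = L" by auto
  have "f n = f N" if "n \<ge> N" for n
  proof (rule antisym)
    show "f n \<le> f N" using that assms by (rule lift_Suc_antimono_le[of f, rotated])
    show "f N \<le> f n" unfolding N L_def by (rule Least_le) simp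
  qed
  then show thesis by (rule that)
qed

text \<open>Along a descent the first entries do not increase, hence are eventually constant;
  removing that entry leaves a descent again. Repetition reads off a branch, where
  \<open>bad p\<close> records a descent through sequences of \<open>T\<close> extending
  \<open>p\<close>.\<close>

lemma kb_descending_path:
  assumes l: "\<And>n. l n \<in> T" "\<And>n. kb (l (Suc n)) (l n)" and T: "\<And>k t. t \<in> T \<Longrightarrow> take k t \<in> T"
  obtains y where "\<And>m. map y [0..<m] \<in> T"
proof -
  define bad where "bad p \<longleftrightarrow> (\<exists>r. (\<forall>n. p @ r n \<in> T) \<and> (\<forall>n::nat. kb (r (Suc n)) (r n)))" for p
  have step: "\<exists>x. bad (p @ [x])" if "bad p" for p
  proof -
    from that obtain r where r: "\<And>n. p @ r n \<in> T" "\<And>n::nat. kb (r (Suc n)) (r n)"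
      unfolding bad_def by auto
    have ne: "r (Suc n) \<noteq> []" for n using r(2)[of n] by (metis kb.simps(1))
    have "hd (r (Suc (Suc n))) \<le> hd (r (Suc n))" for n
      using r(2)[of "Suc n"] ne[of n] ne[of "Suc n"]
      by (cases "r (Suc n)"; cases "r (Suc (Suc n))") auto
    then obtain N where N: "\<And>n. n \<ge> N \<Longrightarrow> hd (r (Suc n)) = hd (r (Suc N))"
      using decreasing_nat_stabilizes[of "\<lambda>n. hd (r (Suc n))"] by auto
    define s where "s = (\<lambda>n. tl (r (Suc (N + n))))"
    have rs: "r (Suc (N + n)) = hd (r (Suc N)) # s n" for n
      unfolding s_def using N[of "N + n"] ne[of "N + n"] by (metis le_add1 list.collapse)
    have "bad (p @ [hd (r (Suc N))])"
      unfolding bad_def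
    proof (intro exI[of _ s] conjI allI)
      show "(p @ [hd (r (Suc N))]) @ s n \<in> T" for n using r(1)[of "Suc (N + n)"] rs[of n] by simp
      show "kb (s (Suc n)) (s n)" for n using r(2)[of "Suc (N + n)"] rs[of n] rs[of "Suc n"] by simp
    qed
    then show ?thesis ..
  qed
  have "\<exists>P. \<forall>n. (bad (P n) \<and> length (P n) = n) \<and> (\<exists>x. P (Suc n) = P n @ [x])"
  proof (rule dependent_nat_choice)
    show "\<exists>p. bad p \<and> length p = 0" using l unfolding bad_def by auto
    show "\<exists>q. (bad q \<and> length q = Suc n) \<and> (\<exists>x. q = p @ [x])" if "bad p \<and> length p = n" for p n
    proof -
      from step[of p] that obtain x where "bad (p @ [x])" by auto
      then show ?thesis using that by (intro exI[of _ "p @ [x]"]) simp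
    qed
  qed
  then obtain P where P: "\<And>n. bad (P n)" "\<And>n. length (P n) = n" "\<And>n. \<exists>x. P (Suc n) = P n @ [x]"
    by auto
  have "P m = map (\<lambda>k. P (Suc k) ! k) [0..<m]" for m
  proof (induction m)
    case 0
    then show ?case using P(2)[of 0] by simp
  next
    case (Suc m)
    from P(3)[of m] obtain x where x: "P (Suc m) = P m @ [x]" ..
    then have "P (Suc m) ! m = x" using P(2)[of m] by (metis nth_append_length)
    then show ?case using Suc x by simp
  qed
  moreover have "P m \<in> T" for m
  proof -
    from P(1)[of m] obtain r :: "nat \<Rightarrow> nat list" where "P m @ r 0 \<in> T" unfolding bad_def by auto
    from T[OF this, of m] show ?thesis using P(2)[of m] by simp
  qed
  ultimately show thesis by (metis that)
qed

section \<open>Linear orderings of \<omega> attached to trees\<close>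

definition kb_class :: "nat list set \<Rightarrow> nat \<Rightarrow> nat" where
  "kb_class T k = (if k = 0 then 2 else if list_decode k \<in> T then 1 else 0)"

text \<open>
  The codes outside the tree are placed below the nonempty sequences of the tree, in their natural
  order; the code \<open>0\<close> of the empty sequence is always the maximum.
\<close>

definition kb_code :: "nat list set \<Rightarrow> nat rel" where
  "kb_code T = {(m, n). kb_class T m < kb_class T n \<or> kb_class T m = kb_class T n \<and>
     (if kb_class T m = 0 then m < n else kb (list_decode m) (list_decode n))}"

lemma kb_code_linear: "strict_linear_order_on UNIV (kb_code T)"
  unfolding strict_linear_order_on_def
proof (intro conjI)
  show "trans (kb_code T)"
    by (rule transI) (auto simp: kb_code_def intro: kb_trans split: if_splits)
  show "irrefl (kb_code T)" by (auto simp: irrefl_def kb_code_def kb_irrefl)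
  show "total (kb_code T)"
    unfolding total_on_def kb_code_def using kb_total by (auto simp: not_less) (metis linorder_neqE_nat list_decode_eq)+
qed

lemma kb_code_max: "m \<noteq> 0 \<Longrightarrow> (m, 0) \<in> kb_code T"
  by (simp add: kb_code_def kb_class_def)

text \<open>A descent eventually stays in one class. Class 0 carries the order of the natural
  numbers and class 2 is a single point, so only class 1, the nonempty sequences of the tree, can be
  ill-founded; there a descent yields a branch.\<close>

lemma wf_kb_code_iff:
  assumes T: "\<And>k t. t \<in> T \<Longrightarrow> take k t \<in> T"
  shows "wf (kb_code T) \<longleftrightarrow> (\<nexists>y. \<forall>m. map y [0..<m] \<in> T)"
proof
  assume wf: "wf (kb_code T)"
  show "\<nexists>y. \<forall>m. map y [0..<m] \<in> T"
  proof
    assume "\<exists>y. \<forall>m. map y [0..<m] \<in> T"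
    then obtain y where y: "\<And>m. map y [0..<m] \<in> T" by auto
    \<comment> \<open>Starting at length 1 avoids the empty sequence, which sits alone in class
      2.\<close>
    let ?f = "\<lambda>m. list_encode (map y [0..<Suc m])"
    have c: "kb_class T (?f m) = 1" for m
      using y[of "Suc m"] by (auto simp: kb_class_def simp del: upt_Suc) (simp add: upt_conv_Cons del: upt_Suc)
    have "\<forall>m. (?f (Suc m), ?f m) \<in> kb_code T"
    proof
      fix m
      have "kb (map y [0..<Suc m] @ [y (Suc m)]) (map y [0..<Suc m])" by (rule kb_extend) simp
      then show "(?f (Suc m), ?f m) \<in> kb_code T"
        unfolding kb_code_def by (simp only: mem_Collect_eq prod.case c) simp
    qed
    then have "\<exists>f. \<forall>i. (f (Suc i), f i) \<in> kb_code T" by (rule exI[of _ ?f])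
    with wf show False unfolding wf_iff_no_infinite_down_chain by (rule notE)
  qed
next
  assume n: "\<nexists>y. \<forall>m. map y [0..<m] \<in> T"
  show "wf (kb_code T)"
    unfolding wf_iff_no_infinite_down_chain
  proof
    assume "\<exists>f. \<forall>i. (f (Suc i), f i) \<in> kb_code T"
    then obtain f where f: "\<And>i. (f (Suc i), f i) \<in> kb_code T" by auto
    have "kb_class T (f (Suc i)) \<le> kb_class T (f i)" for i using f[of i] by (auto simp: kb_code_def)
    then obtain N where N: "\<And>i. i \<ge> N \<Longrightarrow> kb_class T (f i) = kb_class T (f N)"
      using decreasing_nat_stabilizes[of "\<lambda>i. kb_class T (f i)"] by auto
    define g where "g i = f (N + i)" for i
    have g: "(g (Suc i), g i) \<in> kb_code T" and cg: "kb_class T (g i) = kb_class T (g 0)" for i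
      using f[of "N + i"] N[of "N + i"] by (auto simp: g_def)
    have dec: "if kb_class T (g 0) = 0 then g (Suc i) < g i else kb (list_decode (g (Suc i))) (list_decode (g i))" for i
      using g[of i] cg[of i] cg[of "Suc i"] by (simp add: kb_code_def)
    consider "kb_class T (g 0) = 0" | "kb_class T (g 0) = 1" | "kb_class T (g 0) = 2"
      unfolding kb_class_def by presburger
    then show False
    proof cases
      case 1
      then have "\<forall>i. (g (Suc i), g i) \<in> {(x, y). x < y}" using dec unfolding 1 by simp
      then have "\<exists>f. \<forall>i. (f (Suc i), f i) \<in> {(x, y :: nat). x < y}" by (rule exI[of _ g])
      with wf_less show False unfolding wf_iff_no_infinite_down_chain by (rule notE)
    next
      case 2
      have "list_decode (g i) \<in> T" for i
        using trans[OF cg[of i] 2] by (simp add: kb_class_def split: if_splits)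
      moreover have "kb (list_decode (g (Suc i))) (list_decode (g i))" for i
        using dec[of i] unfolding 2 by simp
      ultimately obtain y where "\<And>m. map y [0..<m] \<in> T"
        using kb_descending_path[of "\<lambda>i. list_decode (g i)" T] T by blast
      with n show False by blast
    next
      case 3
      have "g i = 0" for i using trans[OF cg[of i] 3] by (simp add: kb_class_def split: if_splits)
      then show False using dec[of 0] unfolding 3 by simp
    qed
  qed
qed

lemma length_le_list_encode: "length xs \<le> list_encode xs"
proof (induction xs)
  case (Cons x xs)
  have "list_encode xs \<le> prod_encode (x, list_encode xs)" by (rule le_prod_encode_2)
  then show ?case using Cons by simp
qed simp

lemma length_list_decode_le: "length (list_decode n) \<le> n"
  using length_le_list_encode[of "list_decode n"] by simp

text \<open>The finite attempts at a real refuting membership in the \<Pi>11 set. The argument real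
  enters as a finite list, so that the tree can be consulted given only a code of an initial
  segment.\<close>

definition search_tree :: "(nat list \<Rightarrow> bool) \<Rightarrow> nat \<Rightarrow> nat \<Rightarrow> nat list \<Rightarrow> nat list set" where
  "search_tree R i a xs =
     {t. \<forall>j<Suc (length t). \<not> R [i, a, list_encode (take j xs), list_encode (take j t)]}"

lemma recursive_rel_kb_code:
  assumes R: "recursive_rel 4 R"
  shows "recursive_rel 5 (\<lambda>xs. (xs ! 3, xs ! 4) \<in> kb_code (search_tree R (xs ! 0) (xs ! 1) (list_decode (xs ! 2))))"
proof -
  have comp4: "recursive_rel k (\<lambda>xs. R [f xs, g xs, h xs, e xs])"
    if "recursive k f" "recursive k g" "recursive k h" "recursive k e" for k f g h e
    using recursive.comp[of "[f, g, h, e]" "\<lambda>xs. if R xs then 1 else 0" k] that R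
    by (simp add: recursive_rel_def numeral_eq_Suc)
  have tree: "recursive_rel 5 (\<lambda>xs. list_decode (f xs) \<in> search_tree R (xs ! 0) (xs ! 1) (list_decode (xs ! 2)))"
    if f: "recursive 5 f" for f
  proof -
    have "recursive_rel (Suc 5) (\<lambda>xs. \<not> R [xs ! 1, xs ! 2, list_encode (take (xs ! 0) (list_decode (xs ! 3))),
        list_encode (take (xs ! 0) (list_decode (f (tl xs))))])"
      by (intro recursive_rel_not comp4 recursive_take recursive.proj recursive_drop1 f) auto
    then have "recursive_rel 5 (\<lambda>xs. \<forall>j<Suc (length (list_decode (f xs))). (\<lambda>xs. \<not> R [xs ! 1, xs ! 2, list_encode (take (xs ! 0) (list_decode (xs ! 3))),
        list_encode (take (xs ! 0) (list_decode (f (tl xs))))]) (j # xs))"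
      by (rule recursive_rel_ball) (intro recursive_Suc recursive_length f)
    then show ?thesis by (simp add: search_tree_def numeral_eq_Suc)
  qed
  have kb: "recursive_rel 5 (\<lambda>xs. kb (list_decode (xs ! 3)) (list_decode (xs ! 4)))"
  proof -
    have "recursive_rel (Suc 6) (\<lambda>xs. nth0 (list_decode (xs ! 5)) (xs ! 0) = nth0 (list_decode (xs ! 6)) (xs ! 0))"
      by (intro recursive_rel_eq recursive_nth0 recursive.proj) auto
    then have "recursive_rel 6 (\<lambda>xs. \<forall>r<xs ! 0. (\<lambda>xs. nth0 (list_decode (xs ! 5)) (xs ! 0) = nth0 (list_decode (xs ! 6)) (xs ! 0)) (r # xs))"
      by (rule recursive_rel_ball) (intro recursive.proj, simp)
    then have "recursive_rel 6 (\<lambda>xs. \<forall>r<xs ! 0. nth0 (list_decode (xs ! 4)) r = nth0 (list_decode (xs ! 5)) r)"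
      by (simp add: numeral_eq_Suc)
    then have "recursive_rel (Suc 5) (\<lambda>xs. xs ! 0 \<le> length (list_decode (xs ! 5)) \<and>
       (\<forall>r<xs ! 0. nth0 (list_decode (xs ! 4)) r = nth0 (list_decode (xs ! 5)) r) \<and>
       (length (list_decode (xs ! 5)) \<le> xs ! 0 \<or>
        nth0 (list_decode (xs ! 4)) (xs ! 0) < nth0 (list_decode (xs ! 5)) (xs ! 0)))"
      by (intro recursive_rel_conj recursive_rel_disj recursive_rel_le recursive_rel_less recursive_nth0
          recursive_length recursive.proj) (auto simp: numeral_eq_Suc)
    then have "recursive_rel 5 (\<lambda>xs. \<exists>q<length (list_decode (xs ! 3)). (\<lambda>xs. xs ! 0 \<le> length (list_decode (xs ! 5)) \<and>
       (\<forall>r<xs ! 0. nth0 (list_decode (xs ! 4)) r = nth0 (list_decode (xs ! 5)) r) \<and>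
       (length (list_decode (xs ! 5)) \<le> xs ! 0 \<or>
        nth0 (list_decode (xs ! 4)) (xs ! 0) < nth0 (list_decode (xs ! 5)) (xs ! 0))) (q # xs))"
      by (rule recursive_rel_bex) (intro recursive_length recursive.proj, simp)
    then show ?thesis by (simp add: kb_iff[of "list_decode _"] numeral_eq_Suc)
  qed
  have cls: "recursive 5 (\<lambda>xs. kb_class (search_tree R (xs ! 0) (xs ! 1) (list_decode (xs ! 2))) (f xs))"
    if "recursive 5 f" for f
    unfolding kb_class_def by (intro recursive_if recursive_const recursive_rel_eq tree that)
  show ?thesis
    unfolding kb_code_def mem_Collect_eq prod.case
    by (intro recursive_rel_disj recursive_rel_conj recursive_rel_if recursive_rel_less recursive_rel_eq
        cls kb recursive.proj recursive_const) auto
qed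

text \<open>Membership in the \<Pi>11 set means that the tree of attempted counterexamples has no
  branch, which is well-foundedness of its Kleene-Brouwer ordering. Truncating the real at
  \<open>k\<close> does not affect the ordering on numbers below \<open>k\<close>.\<close>

lemma ex_order_assignment:
  assumes "uniformly_Pi11 B" shows "\<exists>prec. order_assignment B prec"
proof -
  from assms obtain R where R: "recursive_rel 4 R"
    and B: "\<And>i a. B (0, i, a) = {x. \<forall>y. \<exists>m. R [i, a, seg x m, seg y m]}"
    unfolding uniformly_Pi11_def by auto
  define T where "T i a x = {t. \<forall>j<Suc (length t). \<not> R [i, a, seg x j, list_encode (take j t)]}" for i a x
  have T: "take k t \<in> T i a x" if "t \<in> T i a x" for i a x t k
    using that by (auto simp: T_def min_def)
  have branch: "(\<nexists>y. \<forall>m. map y [0..<m] \<in> T i a x) \<longleftrightarrow> x \<in> B (0, i, a)" for i a x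
  proof -
    have "(\<forall>m. map y [0..<m] \<in> T i a x) \<longleftrightarrow> (\<forall>m. \<not> R [i, a, seg x m, seg y m])" for y
    proof
      assume *: "\<forall>m. map y [0..<m] \<in> T i a x"
      show "\<forall>m. \<not> R [i, a, seg x m, seg y m]"
      proof
        fix m
        from * have "map y [0..<m] \<in> T i a x" ..
        then show "\<not> R [i, a, seg x m, seg y m]"
          unfolding T_def mem_Collect_eq by (elim allE[of _ m]) (simp add: seg_def)
      qed
    qed (auto simp: T_def seg_def take_map)
    then show ?thesis unfolding B by blast
  qed
  have "order_assignment B (\<lambda>i a x. kb_code (T i a x))"
    unfolding order_assignment_def
  proof (intro conjI allI exI[of _ "\<lambda>xs. (xs ! 3, xs ! 4) \<in> kb_code (search_tree R (xs ! 0) (xs ! 1) (list_decode (xs ! 2)))"]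
      recursive_rel_kb_code R impI kb_code_linear kb_code_max)
    show "wf (kb_code (T i a x)) \<longleftrightarrow> x \<in> B (0, i, a)" for i a x
      using wf_kb_code_iff[OF T] branch by simp
    fix i a k m n :: nat and x :: baire assume "m < k" "n < k"
    \<comment> \<open>A code below \<open>k\<close> decodes to a sequence shorter than
      \<open>k\<close>, so its membership in the tree reads \<open>x\<close> only below
      \<open>k\<close>.\<close>
    have eq: "list_decode p \<in> T i a x \<longleftrightarrow> list_decode p \<in> search_tree R i a (map x [0..<k])" if "p < k" for p :: nat
    proof -
      have "length (list_decode p) < k" using length_list_decode_le[of p] that by simp
      then have "take j (map x [0..<k]) = map x [0..<j]" if "j < Suc (length (list_decode p))" for j
        using that by (simp add: take_map)
      then show ?thesis by (simp add: T_def search_tree_def seg_def)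
    qed
    have "kb_class (T i a x) p = kb_class (search_tree R i a (map x [0..<k])) p" if "p < k" for p :: nat
      using eq[OF that] by (simp add: kb_class_def)
    then show "(m, n) \<in> kb_code (T i a x) \<longleftrightarrow> ([i, a, seg x k, m, n] ! 3, [i, a, seg x k, m, n] ! 4)
       \<in> kb_code (search_tree R ([i, a, seg x k, m, n] ! 0) ([i, a, seg x k, m, n] ! 1) (list_decode ([i, a, seg x k, m, n] ! 2)))"
      using \<open>m < k\<close> \<open>n < k\<close> by (simp add: kb_code_def seg_def numeral_eq_Suc)
  qed
  then show ?thesis by (rule exI[of _ "\<lambda>i a x. kb_code (T i a x)"])
qed

section \<open>An enumeration assigning moves to the values of the embeddings\<close>

lemma prod_encode_strict_mono1: "a < b \<Longrightarrow> prod_encode (a, k) < prod_encode (b, k)"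
proof (induction b)
  case (Suc b)
  have "prod_encode (b, k) < prod_encode (Suc b, k)" by (simp add: prod_encode_def)
  then show ?case using Suc by (cases "a = b") auto
qed simp

lemma prod_encode_strict_mono2: "a < b \<Longrightarrow> prod_encode (k, a) < prod_encode (k, b)"
proof (induction b)
  case (Suc b)
  have "prod_encode (k, b) < prod_encode (k, Suc b)" by (simp add: prod_encode_def)
  then show ?case using Suc by (cases "a = b") auto
qed simp

lemma ex_enumeration: "\<exists>xi. enumeration xi"
proof -
  \<comment> \<open>The last bit carries the parity of \<open>a\<close>; the quotient
    \<open>a div 2\<close> is paired monotonically, so a larger \<open>a\<close> starts later either
    through the quotient or through the bit.\<close>
  define xi where "xi i a k = 2 * prod_encode (prod_encode (i, a div 2), k) + a mod 2" for i a k
  have half: "recursive 1 (\<lambda>xs. xs ! 0 div 2)"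
  proof -
    have "recursive_rel (Suc 1) (\<lambda>xs. xs ! 1 < 2 * xs ! 0 + 2)" by (intro recursive_intros) auto
    then have "recursive 1 (\<lambda>xs. LEAST n. (\<lambda>xs. xs ! 1 < 2 * xs ! 0 + 2) (n # xs))"
    proof (rule recursive_Least)
      show "\<exists>n. (\<lambda>xs. xs ! 1 < 2 * xs ! 0 + 2) (n # xs)" for xs :: "nat list"
        by (rule exI[of _ "xs ! 0"]) simp
    qed
    moreover have "(LEAST n. x < 2 * n + 2) = x div 2" for x :: nat
      by (rule Least_equality) auto
    ultimately show ?thesis by simp
  qed
  have "recursive 3 (\<lambda>xs. 2 * prod_encode (prod_encode (xs ! 0, xs ! 1 div 2), xs ! 2) + (xs ! 1 - 2 * (xs ! 1 div 2)))"
    by (intro recursive_add recursive_mult recursive_diff recursive_prod_encode recursive_const recursive.proj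
        recursive_comp1[OF half]) auto
  then have r: "recursive 3 (\<lambda>xs. xi (xs ! 0) (xs ! 1) (xs ! 2))"
    unfolding xi_def by (simp add: minus_mult_div_eq_mod)
  have div: "xi i a k div 2 = prod_encode (prod_encode (i, a div 2), k)" "xi i a k mod 2 = a mod 2" for i a k
    unfolding xi_def by simp_all
  have "bij (\<lambda>(i, a, k). xi i a k)"
  proof (rule bijI)
    show "inj (\<lambda>(i, a, k). xi i a k)"
    proof (rule injI)
      fix p q assume pq: "(\<lambda>(i, a, k). xi i a k) p = (\<lambda>(i, a, k). xi i a k) q"
      obtain i a k where p: "p = (i, a, k)" by (rule prod_cases3)
      obtain j b l where q: "q = (j, b, l)" by (rule prod_cases3)
      from pq have eq: "xi i a k = xi j b l" unfolding p q prod.case .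
      from arg_cong[OF eq, of "\<lambda>z. z div 2"] have "i = j" "a div 2 = b div 2" "k = l"
        unfolding div by (simp_all add: prod_encode_eq)
      moreover from arg_cong[OF eq, of "\<lambda>z. z mod 2"] have "a mod 2 = b mod 2" unfolding div .
      ultimately show "p = q" unfolding p q by (metis div_mult_mod_eq)
    qed
    show "surj (\<lambda>(i, a, k). xi i a k)"
    proof (rule surjI)
      fix z
      let ?p = "prod_decode (z div 2)" let ?q = "prod_decode (fst ?p)"
      show "(\<lambda>(i, a, k). xi i a k) (fst ?q, 2 * snd ?q + z mod 2, snd ?p) = z"
        by (simp add: xi_def)
    qed
  qed
  moreover have "even (xi i a k) \<longleftrightarrow> even a" for i a k
    by (simp add: xi_def even_iff_mod_2_eq_zero)
  moreover have "strict_mono (xi i a)" for i a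
    by (rule strict_monoI) (simp add: xi_def prod_encode_strict_mono2)
  moreover have "xi i a 0 < xi i b 0" if "a < b" for i a b
  proof (cases "a div 2 < b div 2")
    case True
    then have "prod_encode (prod_encode (i, a div 2), 0) < prod_encode (prod_encode (i, b div 2), 0)"
      by (intro prod_encode_strict_mono1 prod_encode_strict_mono2)
    then show ?thesis unfolding xi_def by presburger
  next
    case False
    then have "a div 2 = b div 2" "a mod 2 < b mod 2" using that by presburger+
    then show ?thesis by (simp add: xi_def)
  qed
  ultimately show ?thesis unfolding enumeration_def using r by blast
qed

subsection \<open>Relations and functions definable by bounded formulas\<close>

lemma tm_val_cong: "(\<And>k. k \<in> tm_fv t \<Longrightarrow> v k = v' k) \<Longrightarrow> tm_val e v t = tm_val e v' t"
  by (cases t) auto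

lemma sat_cong: "(\<And>k. k \<in> fv \<phi> \<Longrightarrow> v k = v' k) \<Longrightarrow> sat M E e v \<phi> \<longleftrightarrow> sat M E e v' \<phi>"
proof (induction \<phi> arbitrary: v v')
  case (Mem s t)
  then show ?case using tm_val_cong[of s v v' e] tm_val_cong[of t v v' e] by simp
next
  case (Eq s t)
  then show ?case using tm_val_cong[of s v v' e] tm_val_cong[of t v v' e] by simp
next
  case (Conj \<phi> \<psi>)
  from Conj.IH(1)[of v v'] Conj.IH(2)[of v v'] Conj.prems show ?case by simp
next
  case (Ex k \<phi>)
  have "sat M E e (v(k := a)) \<phi> \<longleftrightarrow> sat M E e (v'(k := a)) \<phi>" for a
    by (rule Ex.IH) (use Ex.prems in auto)
  then show ?case by simp
next
  case (Neg \<phi>)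
  from Neg.IH[of v v'] Neg.prems show ?case by simp
qed

text \<open>
  At level \<open>N\<close> the variables \<open>0, \<dots>, N - 1\<close> are free, and the next quantifier binds the variable \<open>N\<close>.
\<close>

definition D0 :: "nat \<Rightarrow> ('v::zf_universe \<Rightarrow> (nat \<Rightarrow> 'v) \<Rightarrow> bool) \<Rightarrow> bool" where
  "D0 N R \<longleftrightarrow> (\<exists>\<phi>. Delta0 \<phi> \<and> fv \<phi> \<subseteq> {..<N} \<and> R = (\<lambda>e v. sat UNIV mem e v \<phi>))"

text \<open>Jensen's simple functions: substituting them preserves \<open>\<Delta>\<^sub>0\<close> relations.\<close>

definition simple :: "nat \<Rightarrow> ('v::zf_universe \<Rightarrow> (nat \<Rightarrow> 'v) \<Rightarrow> 'v) \<Rightarrow> bool" where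
  "simple N G \<longleftrightarrow> (\<forall>e v v'. (\<forall>i<N. v i = v' i) \<longrightarrow> G e v = G e v') \<and>
     (\<forall>M\<ge>N. \<forall>R. D0 (Suc M) R \<longrightarrow> D0 M (\<lambda>e v. \<exists>x\<in>elts (G e v). R e (v(M := x))))"

lemma D0_cong: "D0 N R \<Longrightarrow> (\<And>e v. R e v \<longleftrightarrow> R' e v) \<Longrightarrow> D0 N R'"
proof -
  assume "D0 N R" "\<And>e v. R e v \<longleftrightarrow> R' e v"
  moreover from this(2) have "R = R'" by (intro ext)
  ultimately show ?thesis by simp
qed

lemma D0_supp: "D0 N R \<Longrightarrow> (\<And>i. i < N \<Longrightarrow> v i = v' i) \<Longrightarrow> R e v \<longleftrightarrow> R e v'"
  unfolding D0_def by (auto intro!: sat_cong)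

lemma D0_mono: "D0 N R \<Longrightarrow> N \<le> M \<Longrightarrow> D0 M R"
  unfolding D0_def by (elim exE conjE) (rule exI, intro conjI; (assumption | force))

lemma D0_neg: "D0 N R \<Longrightarrow> D0 N (\<lambda>e v. \<not> R e v)"
  unfolding D0_def
proof (elim exE conjE)
  fix \<phi> assume "Delta0 \<phi>" "fv \<phi> \<subseteq> {..<N}" "R = (\<lambda>e v. sat UNIV mem e v \<phi>)"
  then show "\<exists>\<phi>. Delta0 \<phi> \<and> fv \<phi> \<subseteq> {..<N} \<and> (\<lambda>e v. \<not> R e v) = (\<lambda>e v. sat UNIV mem e v \<phi>)"
    by (intro exI[of _ "Neg \<phi>"]) (simp add: Delta0.Neg)
qed

lemma D0_conj: "D0 N R \<Longrightarrow> D0 N S \<Longrightarrow> D0 N (\<lambda>e v. R e v \<and> S e v)"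
  unfolding D0_def
proof (elim exE conjE)
  fix \<phi> \<psi> assume "Delta0 \<phi>" "fv \<phi> \<subseteq> {..<N}" "R = (\<lambda>e v. sat UNIV mem e v \<phi>)"
    "Delta0 \<psi>" "fv \<psi> \<subseteq> {..<N}" "S = (\<lambda>e v. sat UNIV mem e v \<psi>)"
  then show "\<exists>\<phi>. Delta0 \<phi> \<and> fv \<phi> \<subseteq> {..<N} \<and> (\<lambda>e v. R e v \<and> S e v) = (\<lambda>e v. sat UNIV mem e v \<phi>)"
    by (intro exI[of _ "Conj \<phi> \<psi>"]) (simp add: Delta0.Conj)
qed

lemma D0_disj: "D0 N R \<Longrightarrow> D0 N S \<Longrightarrow> D0 N (\<lambda>e v. R e v \<or> S e v)"
  by (rule D0_cong[OF D0_neg[OF D0_conj[OF D0_neg D0_neg]]]) auto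

lemma D0_var_eq: "i < N \<Longrightarrow> j < N \<Longrightarrow> D0 N (\<lambda>e v. v i = v j)"
  unfolding D0_def by (intro exI[of _ "Eq (Var i) (Var j)"]) (simp add: Delta0.Eq)

lemma D0_const: "D0 N (\<lambda>e v. P)"
proof -
  have "D0 N (\<lambda>(e :: 'a) v. True)"
    unfolding D0_def by (intro exI[of _ "Eq Const Const"]) (simp add: Delta0.Eq)
  then show ?thesis using D0_neg[of N "\<lambda>e v. True"] by (cases P) auto
qed

lemma simple_mono: "simple N G \<Longrightarrow> N \<le> M \<Longrightarrow> simple M G"
  unfolding simple_def by (meson order_trans less_le_trans)

lemma simple_supp: "simple N G \<Longrightarrow> (\<And>i. i < N \<Longrightarrow> v i = v' i) \<Longrightarrow> G e v = G e v'"
  unfolding simple_def by (elim conjE) blast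

lemma simple_upd: "simple N G \<Longrightarrow> N \<le> M \<Longrightarrow> G e (v(M := x)) = G e v"
  by (rule simple_supp) auto

lemma simple_D0: "simple N G \<Longrightarrow> N \<le> M \<Longrightarrow> D0 (Suc M) R \<Longrightarrow> D0 M (\<lambda>e v. \<exists>x\<in>elts (G e v). R e (v(M := x)))"
  unfolding simple_def by (elim conjE) simp

lemma D0_bex:
  assumes "simple N G" "D0 (Suc N) (\<lambda>e v. P e v (v N))" "\<And>e v x. P e (v(N := x)) x \<longleftrightarrow> P e v x"
  shows "D0 N (\<lambda>e v. \<exists>x\<in>elts (G e v). P e v x)"
proof -
  from simple_D0[OF assms(1) order_refl assms(2)]
  have "D0 N (\<lambda>e v. \<exists>x\<in>elts (G e v). P e (v(N := x)) ((v(N := x)) N))" .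
  then show ?thesis using assms(3) by simp
qed

lemma D0_ball:
  assumes "simple N G" "D0 (Suc N) (\<lambda>e v. P e v (v N))" "\<And>e v x. P e (v(N := x)) x \<longleftrightarrow> P e v x"
  shows "D0 N (\<lambda>e v. \<forall>x\<in>elts (G e v). P e v x)"
proof -
  have "D0 N (\<lambda>e v. \<exists>x\<in>elts (G e v). \<not> P e v x)"
    by (rule D0_bex[OF assms(1)]) (use D0_neg[OF assms(2)] assms(3) in auto)
  from D0_neg[OF this] show ?thesis by simp
qed

lemma simple_var: "i < N \<Longrightarrow> simple N (\<lambda>e v. v i)"
  unfolding simple_def
proof (intro conjI allI impI)
  fix M :: nat and R :: "'a \<Rightarrow> (nat \<Rightarrow> 'a) \<Rightarrow> bool"
  assume i: "i < N" "N \<le> M" and "D0 (Suc M) R"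
  then obtain \<phi> where "Delta0 \<phi>" "fv \<phi> \<subseteq> {..<Suc M}" "R = (\<lambda>e v. sat UNIV mem e v \<phi>)"
    unfolding D0_def by auto
  with i show "D0 M (\<lambda>e v. \<exists>x\<in>elts (v i). R e (v(M := x)))"
    unfolding D0_def
    by (intro exI[of _ "Ex M (Conj (Mem (Var M) (Var i)) \<phi>)"]) (auto intro!: Delta0.BEx simp: less_Suc_eq)
qed auto

lemma simple_Const: "simple N (\<lambda>e v. e)"
  unfolding simple_def
proof (intro conjI allI impI)
  fix M :: nat and R :: "'a \<Rightarrow> (nat \<Rightarrow> 'a) \<Rightarrow> bool"
  assume "D0 (Suc M) R"
  then obtain \<phi> where "Delta0 \<phi>" "fv \<phi> \<subseteq> {..<Suc M}" "R = (\<lambda>e v. sat UNIV mem e v \<phi>)"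
    unfolding D0_def by auto
  then show "D0 M (\<lambda>e v. \<exists>x\<in>elts e. R e (v(M := x)))"
    unfolding D0_def
    by (intro exI[of _ "Ex M (Conj (Mem (Var M) Const) \<phi>)"]) (auto intro!: Delta0.BEx simp: less_Suc_eq)
qed auto

text \<open>Equality of simple values unfolds to memberships, and membership to an equality under a
  bounded quantifier. Keeping a variable on the left at first breaks this circle.\<close>

lemma D0_var_mem:
  assumes "i < N" "simple N H" shows "D0 N (\<lambda>e v. v i \<in> elts (H e v))"
proof -
  have "D0 N (\<lambda>e v. \<exists>x\<in>elts (H e v). x = v i)"
    using assms by (intro D0_bex D0_var_eq) auto
  then show ?thesis by (rule D0_cong) auto
qed

lemma D0_var_eq_simple:
  assumes i: "i < N" and H: "simple N H" shows "D0 N (\<lambda>e v. v i = H e v)"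
proof -
  have "D0 N (\<lambda>e v. (\<forall>x\<in>elts (H e v). x \<in> elts (v i)) \<and> (\<forall>x\<in>elts (v i). x \<in> elts (H e v)))"
    using i by (intro D0_conj D0_ball D0_var_mem H simple_var simple_mono[OF H]) (auto simp: simple_upd[OF H])
  then show ?thesis by (rule D0_cong) (auto intro: extensionality)
qed

lemma D0_mem:
  assumes G: "simple N G" and H: "simple N H" shows "D0 N (\<lambda>e v. G e v \<in> elts (H e v))"
proof -
  have "D0 N (\<lambda>e v. \<exists>x\<in>elts (H e v). x = G e v)"
    by (intro D0_bex H D0_var_eq_simple simple_mono[OF G]) (auto simp: simple_upd[OF G])
  then show ?thesis by (rule D0_cong) auto
qed

lemma D0_eq:
  assumes G: "simple N G" and H: "simple N H" shows "D0 N (\<lambda>e v. G e v = H e v)"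
proof -
  have "D0 N (\<lambda>e v. (\<forall>x\<in>elts (H e v). x \<in> elts (G e v)) \<and> (\<forall>x\<in>elts (G e v). x \<in> elts (H e v)))"
    by (intro D0_conj D0_ball D0_var_mem H G simple_mono[OF H] simple_mono[OF G])
      (auto simp: simple_upd[OF H] simple_upd[OF G])
  then show ?thesis by (rule D0_cong) (auto intro: extensionality)
qed

text \<open>The only delicate case is a bounded quantifier whose bound becomes a function value, and
  this is what \<open>simple\<close> provides for. The constant is replaced too, because later the
  sequence that it denotes is changed.\<close>

lemma D0_subst:
  assumes "Delta0 \<phi>" "\<And>i. i \<in> fv \<phi> \<Longrightarrow> simple N (\<rho> i)" "simple N H"
  shows "D0 N (\<lambda>e v. sat UNIV mem (H e v) (\<lambda>i. \<rho> i e v) \<phi>)"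
  using assms
proof (induction \<phi> arbitrary: N \<rho>)
  case (Mem s t)
  have "simple N (\<lambda>e v. tm_val (H e v) (\<lambda>i. \<rho> i e v) s)" "simple N (\<lambda>e v. tm_val (H e v) (\<lambda>i. \<rho> i e v) t)"
    using Mem by (cases s; cases t; auto)+
  then show ?case using D0_mem by auto
next
  case (Eq s t)
  have "simple N (\<lambda>e v. tm_val (H e v) (\<lambda>i. \<rho> i e v) s)" "simple N (\<lambda>e v. tm_val (H e v) (\<lambda>i. \<rho> i e v) t)"
    using Eq by (cases s; cases t; auto)+
  then show ?case using D0_eq by auto
next
  case (Neg \<phi>)
  then show ?case by (auto intro: D0_neg)
next
  case (Conj \<phi> \<psi>)
  then show ?case by (auto intro: D0_conj)
next
  case (BEx \<phi> t k)
  let ?t = "\<lambda>e v. tm_val (H e v) (\<lambda>i. \<rho> i e v) t"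
  have t: "simple N ?t" using BEx by (cases t) auto
  note H = \<open>simple N H\<close>
  \<comment> \<open>The bound variable \<open>k\<close> of the formula is renamed to the fresh
    variable \<open>N\<close>.\<close>
  have "D0 (Suc N) (\<lambda>e v. sat UNIV mem (H e v) (\<lambda>i. (\<rho>(k := \<lambda>e v. v N)) i e v) \<phi>)"
  proof (rule BEx.IH)
    show "simple (Suc N) ((\<rho>(k := \<lambda>e v. v N)) i)" if "i \<in> fv \<phi>" for i
      using BEx.prems(1)[of i] that simple_mono[of N "\<rho> i" "Suc N"] simple_var[of N "Suc N"] by auto
    show "simple (Suc N) H" using simple_mono[OF H, of "Suc N"] by simp
  qed
  also have "(\<lambda>e v. sat UNIV mem (H e v) (\<lambda>i. (\<rho>(k := \<lambda>e v. v N)) i e v) \<phi>) =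
      (\<lambda>e v. sat UNIV mem (H e v) ((\<lambda>i. \<rho> i e v)(k := v N)) \<phi>)"
    by (intro ext sat_cong) auto
  finally have "D0 N (\<lambda>e v. \<exists>x\<in>elts (?t e v). sat UNIV mem (H e v) ((\<lambda>i. \<rho> i e v)(k := x)) \<phi>)"
  proof (rule D0_bex[OF t])
    fix e v x
    have "H e (v(N := x)) = H e v" by (rule simple_upd[OF H]) simp
    moreover have "\<rho> i e (v(N := x)) = \<rho> i e v" if "i \<in> fv \<phi>" "i \<noteq> k" for i
      using simple_upd[of N "\<rho> i"] BEx.prems(1)[of i] that by auto
    ultimately show "sat UNIV mem (H e (v(N := x))) ((\<lambda>i. \<rho> i e (v(N := x)))(k := x)) \<phi> \<longleftrightarrow>
      sat UNIV mem (H e v) ((\<lambda>i. \<rho> i e v)(k := x)) \<phi>"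
      by (auto intro!: sat_cong)
  qed
  moreover have "tm_val (H e v) ((\<lambda>i. \<rho> i e v)(k := x)) t = ?t e v" for e v x
    using BEx.hyps(2) by (cases t) auto
  ultimately show ?case by (elim D0_cong) auto
qed

lemma D0_comp:
  assumes "D0 K R" "\<And>i. i < K \<Longrightarrow> simple N (\<rho> i)" "simple N H"
  shows "D0 N (\<lambda>e v. R (H e v) (\<lambda>i. \<rho> i e v))"
proof -
  from assms(1) obtain \<phi> where "Delta0 \<phi>" "fv \<phi> \<subseteq> {..<K}" and R: "R = (\<lambda>e v. sat UNIV mem e v \<phi>)"
    unfolding D0_def by auto
  then show ?thesis unfolding R using assms(2,3) by (intro D0_subst) auto
qed

lemma D0_upd:
  assumes "D0 (Suc M) R" "simple M G" shows "D0 M (\<lambda>e v. R e (v(M := G e v)))"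
proof -
  have "D0 M (\<lambda>e v. R e (\<lambda>i. (if i = M then G else (\<lambda>e v. v i)) e v))"
    using assms(2) by (intro D0_comp[OF assms(1)] simple_Const) (auto intro: simple_var)
  moreover have "(\<lambda>i. (if i = M then G else (\<lambda>e v. v i)) e v) = v(M := G e v)" for e v by auto
  ultimately show ?thesis by simp
qed

section \<open>Finite sets, case distinctions and unions as simple functions\<close>

definition vins :: "'v::zf_universe \<Rightarrow> 'v \<Rightarrow> 'v" where
  "vins x y = vset (insert x (elts y))"

definition vUN :: "'v::zf_universe \<Rightarrow> ('v \<Rightarrow> 'v) \<Rightarrow> 'v" where
  "vUN x f = vset (\<Union>y\<in>elts x. elts (f y))"

lemma elts_vins [simp]: "elts (vins x y) = insert x (elts y)"
  by (simp add: vins_def)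

lemma elts_vUN [simp]: "elts (vUN x f) = (\<Union>y\<in>elts x. elts (f y))"
  by (simp add: vUN_def)

lemma vpair_vins: "vpair x y = vins (vins x (vset {})) (vins (vins x (vins y (vset {}))) (vset {}))"
  by (simp add: vins_def vpair_def)

lemma simpleI:
  assumes "\<And>e v v'. (\<And>i. i < N \<Longrightarrow> v i = v' i) \<Longrightarrow> G e v = G e v'"
    "\<And>M R. N \<le> M \<Longrightarrow> D0 (Suc M) R \<Longrightarrow> D0 M (\<lambda>e v. \<exists>x\<in>elts (G e v). R e (v(M := x)))"
  shows "simple N G"
  unfolding simple_def using assms by blast

lemma simple_empty: "simple N (\<lambda>e v. vset {})"
  by (rule simpleI) (simp_all add: D0_const)

lemma simple_vins:
  assumes G: "simple N G" and H: "simple N H" shows "simple N (\<lambda>e v. vins (G e v) (H e v))"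
proof (rule simpleI)
  show "vins (G e v) (H e v) = vins (G e v') (H e v')" if "\<And>i. i < N \<Longrightarrow> v i = v' i" for e v v'
    using simple_supp[OF G, of v v' e] simple_supp[OF H, of v v' e] that by simp
  fix M and R :: "'a \<Rightarrow> (nat \<Rightarrow> 'a) \<Rightarrow> bool" assume M: "N \<le> M" and R: "D0 (Suc M) R"
  have "D0 M (\<lambda>e v. R e (v(M := G e v)) \<or> (\<exists>x\<in>elts (H e v). R e (v(M := x))))"
    by (intro D0_disj D0_upd R simple_D0[OF H M] simple_mono[OF G M])
  then show "D0 M (\<lambda>e v. \<exists>x\<in>elts (vins (G e v) (H e v)). R e (v(M := x)))" by simp
qed

lemma simple_if:
  assumes Q: "D0 N Q" and G: "simple N G" and H: "simple N H"
  shows "simple N (\<lambda>e v. if Q e v then G e v else H e v)"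
proof (rule simpleI)
  show "(if Q e v then G e v else H e v) = (if Q e v' then G e v' else H e v')"
    if "\<And>i. i < N \<Longrightarrow> v i = v' i" for e v v'
    using simple_supp[OF G, of v v' e] simple_supp[OF H, of v v' e] D0_supp[OF Q, of v v' e] that by simp
  fix M and R :: "'a \<Rightarrow> (nat \<Rightarrow> 'a) \<Rightarrow> bool" assume M: "N \<le> M" and R: "D0 (Suc M) R"
  have "D0 M (\<lambda>e v. (Q e v \<and> (\<exists>x\<in>elts (G e v). R e (v(M := x)))) \<or>
      (\<not> Q e v \<and> (\<exists>x\<in>elts (H e v). R e (v(M := x)))))"
    by (intro D0_disj D0_conj D0_neg simple_D0[OF G M R] simple_D0[OF H M R] D0_mono[OF Q M])
  then show "D0 M (\<lambda>e v. \<exists>x\<in>elts (if Q e v then G e v else H e v). R e (v(M := x)))"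
    by (rule D0_cong) auto
qed

text \<open>A quantifier over the union is a pair of nested bounded quantifiers. The hypothesis
  \<open>upd\<close> keeps \<open>f\<close> independent of the variables from \<open>N\<close> on,
  apart from its explicit argument.\<close>

lemma simple_vUN:
  assumes G: "simple N G" and f: "\<And>M. N \<le> M \<Longrightarrow> simple (Suc M) (\<lambda>e v. f e v (v M))"
    and upd: "\<And>M e v x y. N \<le> M \<Longrightarrow> f e (v(M := y)) x = f e v x"
  shows "simple N (\<lambda>e v. vUN (G e v) (f e v))"
proof (rule simpleI)
  fix e :: 'a and v v' :: "nat \<Rightarrow> 'a" assume eq: "\<And>i. i < N \<Longrightarrow> v i = v' i"
  have "f e v x = f e v' x" for x
  proof -
    have "f e v x = f e (v(N := x)) ((v(N := x)) N)" by (simp add: upd)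
    also have "\<dots> = f e (v'(N := x)) ((v'(N := x)) N)"
      by (rule simple_supp[OF f[of N]]) (use eq in \<open>auto simp: less_Suc_eq\<close>)
    also have "\<dots> = f e v' x" by (simp add: upd)
    finally show ?thesis .
  qed
  then show "vUN (G e v) (f e v) = vUN (G e v') (f e v')"
    using simple_supp[OF G, of v v' e] eq by (simp add: vUN_def)
next
  fix M and R :: "'a \<Rightarrow> (nat \<Rightarrow> 'a) \<Rightarrow> bool" assume M: "N \<le> M" and R: "D0 (Suc M) R"
  \<comment> \<open>The element of \<open>f\<close> is bound at \<open>Suc M\<close>, but
    \<open>R\<close> reads it at \<open>M\<close>, where the index of the union sits; hence the
    renaming.\<close>
  have "D0 (Suc (Suc M)) (\<lambda>e v. R e (\<lambda>i. (if i = M then (\<lambda>e v. v (Suc M)) else if i < M then (\<lambda>e v. v i) else (\<lambda>e v. e)) e v))"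
    by (intro D0_comp[OF R] simple_Const) (auto intro: simple_var)
  from simple_D0[OF f[OF M] order_refl this]
  have "D0 (Suc M) (\<lambda>e v. \<exists>z\<in>elts (f e v (v M)). R e (v(M := z)))"
    by (rule D0_cong) (intro bex_cong refl D0_supp[OF R], auto simp: less_Suc_eq)
  from simple_D0[OF G M this] have "D0 M (\<lambda>e v. \<exists>x\<in>elts (G e v). \<exists>z\<in>elts (f e v x). R e (v(M := z)))"
    by (simp add: upd M)
  then show "D0 M (\<lambda>e v. \<exists>x\<in>elts (vUN (G e v) (f e v)). R e (v(M := x)))"
    by (rule D0_cong) auto
qed

subsection \<open>Operations on sequences\<close>

text \<open>The components of a pair are elements of its elements. Taking the union over all
  candidates selects the right one by bounded quantification, since wrong candidates contribute the
  empty set.\<close>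

definition pfst :: "'v::zf_universe \<Rightarrow> 'v" where
  "pfst y = vUN y (\<lambda>s. vUN s (\<lambda>a. vUN y (\<lambda>t. vUN t (\<lambda>b. if y = vpair a b then a else vset {}))))"

definition psnd :: "'v::zf_universe \<Rightarrow> 'v" where
  "psnd y = vUN y (\<lambda>s. vUN s (\<lambda>a. vUN y (\<lambda>t. vUN t (\<lambda>b. if y = vpair a b then b else vset {}))))"

lemma elts_vpair: "elts (vpair x y) = {vset {x}, vset {x, y}}"
  by (simp add: vpair_def)

lemma pfst_vpair [simp]: "pfst (vpair x y) = x"
proof (rule extensionality, rule set_eqI)
  fix z
  show "z \<in> elts (pfst (vpair x y)) \<longleftrightarrow> z \<in> elts x"
    unfolding pfst_def elts_vUN elts_vpair by (auto split: if_splits)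
qed

lemma psnd_vpair [simp]: "psnd (vpair x y) = y"
proof (rule extensionality, rule set_eqI)
  fix z
  show "z \<in> elts (psnd (vpair x y)) \<longleftrightarrow> z \<in> elts y"
    unfolding psnd_def elts_vUN elts_vpair by (auto split: if_splits)
qed

definition vnth :: "nat \<Rightarrow> 'v::zf_universe \<Rightarrow> 'v" where
  "vnth m d = vUN d (\<lambda>y. if pfst y = vnat m then psnd y else vset {})"

text \<open>The union of \<open>vnat (Suc i)\<close> is \<open>vnat i\<close>, so the union below is a predecessor.\<close>

definition vdel :: "nat \<Rightarrow> 'v::zf_universe \<Rightarrow> 'v" where
  "vdel k d = vUN d (\<lambda>y. if pfst y \<in> elts (vnat k) then vins y (vset {})
     else if pfst y = vnat k then vset {}
     else vins (vpair (vUN (pfst y) (\<lambda>z. z)) (psnd y)) (vset {}))"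

text \<open>For a von Neumann index i, \<open>vins i i\<close> is its successor, so entries from
  \<open>k\<close> on move up by one place.\<close>

definition vadd :: "nat \<Rightarrow> 'v::zf_universe \<Rightarrow> 'v \<Rightarrow> 'v" where
  "vadd k x d = vins (vpair (vnat k) x) (vUN d (\<lambda>y. if pfst y \<in> elts (vnat k) then vins y (vset {})
     else vins (vpair (vins (pfst y) (pfst y)) (psnd y)) (vset {})))"

text \<open>Peeling off the set of pairs, the pair and its constituent reaches the indices and the
  values; the last union collects their elements.\<close>

definition vsup :: "'v::zf_universe \<Rightarrow> 'v" where
  "vsup e = vUN e (\<lambda>y. vUN y (\<lambda>s. vUN s (\<lambda>t. t)))"

definition skip_at :: "nat \<Rightarrow> nat \<Rightarrow> nat" where
  "skip_at k i = (if i < k then i else Suc i)"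

definition insert_at :: "nat \<Rightarrow> 'a \<Rightarrow> (nat \<Rightarrow> 'a) \<Rightarrow> nat \<Rightarrow> 'a" where
  "insert_at k x c i = (if i < k then c i else if i = k then x else c (i - 1))"

lemma insert_at_skip [simp]: "insert_at k x c (skip_at k i) = c i"
  by (simp add: insert_at_def skip_at_def)

lemma insert_at_same [simp]: "insert_at k x c k = x"
  by (simp add: insert_at_def)

lemma skip_at_surj: "i = k \<or> (\<exists>j. i = skip_at k j)"
proof (cases "i < k")
  case True
  then show ?thesis by (intro disjI2 exI[of _ i]) (simp add: skip_at_def)
next
  case False
  then show ?thesis by (cases "i = k") (auto intro!: exI[of _ "i - 1"] simp: skip_at_def)
qed

lemma vUN_vnat_Suc: "vUN (vnat (Suc i)) (\<lambda>z. z) = (vnat i :: 'v::zf_universe)"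
proof (rule extensionality)
  have "elts (vUN (vnat (Suc i)) (\<lambda>z. z)) = (\<Union>j\<in>{..<Suc i}. elts (vnat j :: 'v))"
    unfolding elts_vUN elts_vnat[of "Suc i"] by simp
  also have "\<dots> = elts (vnat i)" unfolding elts_vnat by force
  finally show "elts (vUN (vnat (Suc i)) (\<lambda>z. z)) = elts (vnat i :: 'v)" .
qed

lemma elts_vUN_vseq: "elts (vUN (vseq c) f) = (\<Union>i. elts (f (vpair (vnat i) (c i))))"
  unfolding elts_vUN elts_vseq by simp

lemma vnth_vseq: "vnth m (vseq c) = c m"
proof (rule extensionality)
  have "elts (vnth m (vseq c)) = (\<Union>i. if i = m then elts (c i) else {})"
    unfolding vnth_def elts_vUN_vseq pfst_vpair psnd_vpair vnat_inject by (intro SUP_cong) auto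
  then show "elts (vnth m (vseq c)) = elts (c m)" by auto
qed

lemma vdel_vseq: "vdel k (vseq c) = vseq (\<lambda>i. c (skip_at k i))"
proof (rule extensionality)
  have 1: "elts (vdel k (vseq c)) = (\<Union>i. if i < k then {vpair (vnat i) (c i)} else if i = k then {}
     else {vpair (vUN (vnat i) (\<lambda>z. z)) (c i)})"
    unfolding vdel_def elts_vUN_vseq pfst_vpair psnd_vpair vnat_inject vnat_mem by (intro SUP_cong) auto
  show "elts (vdel k (vseq c)) = elts (vseq (\<lambda>i. c (skip_at k i)))"
    unfolding 1 elts_vseq
  proof (intro set_eqI iffI)
    fix z assume "z \<in> (\<Union>i. if i < k then {vpair (vnat i) (c i)} else if i = k then {}
     else {vpair (vUN (vnat i) (\<lambda>z. z)) (c i)})"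
    then obtain i where i: "z \<in> (if i < k then {vpair (vnat i) (c i)} else if i = k then {}
     else {vpair (vUN (vnat i) (\<lambda>z. z)) (c i)})" by (elim UN_E)
    show "z \<in> range (\<lambda>i. vpair (vnat i) (c (skip_at k i)))"
    proof (cases "i < k")
      case True
      then show ?thesis using i by (intro image_eqI[of _ _ i]) (simp_all add: skip_at_def)
    next
      case False
      then have "i \<noteq> k" using i by auto
      with False obtain j where j: "i = Suc j" "\<not> j < k" by (cases i) auto
      then have "z = vpair (vnat j) (c i)" using i \<open>i \<noteq> k\<close> False by (simp only: vUN_vnat_Suc) simp
      then show ?thesis using j by (intro image_eqI[of _ _ j]) (simp_all add: skip_at_def)
    qed
  next
    fix z assume "z \<in> range (\<lambda>i. vpair (vnat i) (c (skip_at k i)))"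
    then obtain j where j: "z = vpair (vnat j) (c (skip_at k j))" by auto
    show "z \<in> (\<Union>i. if i < k then {vpair (vnat i) (c i)} else if i = k then {}
     else {vpair (vUN (vnat i) (\<lambda>z. z)) (c i)})"
    proof (rule UN_I[of "skip_at k j"])
      show "z \<in> (if skip_at k j < k then {vpair (vnat (skip_at k j)) (c (skip_at k j))} else if skip_at k j = k then {}
       else {vpair (vUN (vnat (skip_at k j)) (\<lambda>z. z)) (c (skip_at k j))})"
        unfolding j by (cases "j < k") (simp_all only: skip_at_def vUN_vnat_Suc if_True if_False, auto)
    qed simp
  qed
qed

lemma vadd_vseq: "vadd k x (vseq c) = vseq (insert_at k x c)"
proof (rule extensionality)
  have 1: "elts (vadd k x (vseq c)) = insert (vpair (vnat k) x) (\<Union>i. if i < k then {vpair (vnat i) (c i)}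
     else {vpair (vnat (Suc i)) (c i)})"
    unfolding vadd_def elts_vins elts_vUN_vseq pfst_vpair psnd_vpair vnat_inject vnat_mem
    by (intro arg_cong2[of _ _ _ _ insert] SUP_cong) (auto simp: vins_def)
  also have "(\<Union>i. if i < k then {vpair (vnat i) (c i)} else {vpair (vnat (Suc i)) (c i)}) =
     range (\<lambda>i. vpair (vnat (skip_at k i)) (c i))"
    by (auto simp only: skip_at_def split: if_splits)
  also have "insert (vpair (vnat k) x) \<dots> = range (\<lambda>i. vpair (vnat i) (insert_at k x c i))"
  proof (intro set_eqI iffI)
    fix z assume "z \<in> insert (vpair (vnat k) x) (range (\<lambda>i. vpair (vnat (skip_at k i)) (c i)))"
    then consider "z = vpair (vnat k) x" | i where "z = vpair (vnat (skip_at k i)) (c i)" by auto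
    then show "z \<in> range (\<lambda>i. vpair (vnat i) (insert_at k x c i))"
      by cases (auto intro: image_eqI[of _ _ k] image_eqI[of _ _ "skip_at k _"])
  next
    fix z assume "z \<in> range (\<lambda>i. vpair (vnat i) (insert_at k x c i))"
    then obtain i where i: "z = vpair (vnat i) (insert_at k x c i)" by auto
    from skip_at_surj[of i k] show "z \<in> insert (vpair (vnat k) x) (range (\<lambda>i. vpair (vnat (skip_at k i)) (c i)))"
      using i by (elim disjE exE) auto
  qed
  finally show "elts (vadd k x (vseq c)) = elts (vseq (insert_at k x c))" by (simp only: elts_vseq)
qed

lemma elts_vsup_vseq:
  fixes c :: "nat \<Rightarrow> 'v::zf_universe"
  assumes "\<And>i. elts (vnat i) \<subseteq> elts (c i)" shows "elts (vsup (vseq c)) = (\<Union>i. elts (c i))"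
proof -
  have "elts (vsup (vseq c)) = (\<Union>i. elts (vnat i) \<union> elts (c i))"
    unfolding vsup_def elts_vUN_vseq unfolding elts_vUN elts_vpair by (intro SUP_cong) auto
  then show ?thesis using assms by auto
qed

subsection \<open>Transitive models of KP\<close>

locale kp_set =
  fixes A :: "'v::zf_universe"
  assumes transitive: "vtransitive A" and KP: "KP_model (elts A) mem"
begin

lemma mem_A: "x \<in> elts A \<Longrightarrow> y \<in> elts x \<Longrightarrow> y \<in> elts A"
  using transitive unfolding vtransitive_def by auto

lemma tm_val_A: "e \<in> elts A \<Longrightarrow> (\<And>i. v i \<in> elts A) \<Longrightarrow> tm_val e v t \<in> elts A"
  by (cases t) auto

lemma sat_absolute:
  "Delta0 \<phi> \<Longrightarrow> e \<in> elts A \<Longrightarrow> (\<And>i. v i \<in> elts A) \<Longrightarrow> sat (elts A) mem e v \<phi> \<longleftrightarrow> sat UNIV mem e v \<phi>"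
proof (induction \<phi> arbitrary: v rule: Delta0.induct)
  case (BEx \<phi> t k)
  have t: "tm_val e (v(k := a)) t = tm_val e v t" for a using BEx.hyps(2) by (cases t) auto
  have "tm_val e v t \<in> elts A" using BEx.prems by (rule tm_val_A)
  then have "a \<in> elts A" if "a \<in> elts (tm_val e v t)" for a using mem_A that by blast
  moreover have "sat (elts A) mem e (v(k := a)) \<phi> \<longleftrightarrow> sat UNIV mem e (v(k := a)) \<phi>" if "a \<in> elts A" for a
    using BEx.prems that by (intro BEx.IH) auto
  ultimately show ?case using t by auto
qed auto

lemmas KP' = KP[unfolded KP_model_def]

lemma A_ne: "elts A \<noteq> {}"
  by (rule KP'[THEN conjunct1])

lemma A_pairing: "x \<in> elts A \<Longrightarrow> y \<in> elts A \<Longrightarrow> \<exists>z\<in>elts A. x \<in> elts z \<and> y \<in> elts z"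
  by (rule KP'[THEN conjunct2, THEN conjunct2, THEN conjunct1, rule_format])

lemma A_union:
  assumes "x \<in> elts A" shows "\<exists>u\<in>elts A. \<forall>y\<in>elts x. elts y \<subseteq> elts u"
proof -
  obtain u where u: "u \<in> elts A" "\<forall>y\<in>elts A. \<forall>z\<in>elts A. y \<in> elts x \<and> z \<in> elts y \<longrightarrow> z \<in> elts u"
    using KP'[THEN conjunct2, THEN conjunct2, THEN conjunct2, THEN conjunct1, THEN bspec, OF assms] by auto
  have "elts y \<subseteq> elts u" if "y \<in> elts x" for y
    using u(2) that assms mem_A by (meson subsetI)
  with u(1) show ?thesis by auto
qed

lemma A_separation:
  assumes R: "D0 (Suc N) R" and e: "e \<in> elts A" and v: "\<And>i. v i \<in> elts A" and x: "x \<in> elts A"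
  shows "\<exists>y\<in>elts A. elts y = {z\<in>elts x. R e (v(N := z))}"
proof -
  \<comment> \<open>The KP schema separates on variable 0 and \<open>R\<close> on variable
    \<open>N\<close>, so the parameters move up by one; entry 0 of \<open>v'\<close> below is a
    dummy.\<close>
  let ?r = "\<lambda>i. if i < N then (\<lambda>(e::'v) (v::nat\<Rightarrow>'v). v (Suc i)) else (\<lambda>e v. v 0)"
  have "D0 (Suc N) (\<lambda>e v. R e (\<lambda>i. ?r i e v))"
    by (intro D0_comp[OF R] simple_Const) (auto intro: simple_var)
  then obtain \<phi> where \<phi>: "Delta0 \<phi>" "(\<lambda>e v. R e (\<lambda>i. ?r i e v)) = (\<lambda>e v. sat UNIV mem e v \<phi>)"
    unfolding D0_def by auto
  define v' where "v' = (\<lambda>i. if i = 0 then e else v (i - 1))"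
  have v': "v' i \<in> elts A" for i using e v by (simp add: v'_def)
  from KP'[THEN conjunct2, THEN conjunct2, THEN conjunct2, THEN conjunct2, THEN conjunct1, rule_format, of \<phi> e v' x] \<phi>(1) e v' x
  obtain y where y: "y \<in> elts A" "\<forall>z\<in>elts A. z \<in> elts y \<longleftrightarrow> z \<in> elts x \<and> sat (elts A) mem e (v'(0 := z)) \<phi>"
    by auto
  have "sat (elts A) mem e (v'(0 := z)) \<phi> \<longleftrightarrow> R e (v(N := z))" if "z \<in> elts A" for z
  proof -
    have "sat (elts A) mem e (v'(0 := z)) \<phi> \<longleftrightarrow> sat UNIV mem e (v'(0 := z)) \<phi>"
      using v' that by (intro sat_absolute \<phi> e) auto
    also have "\<dots> \<longleftrightarrow> R e (\<lambda>i. ?r i e (v'(0 := z)))" using fun_cong[OF fun_cong[OF \<phi>(2)], of e "v'(0 := z)"] by simp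
    also have "\<dots> \<longleftrightarrow> R e (v(N := z))" by (rule D0_supp[OF R]) (auto simp: v'_def less_Suc_eq)
    finally show ?thesis .
  qed
  then have "elts y = {z\<in>elts x. R e (v(N := z))}" using y mem_A[OF y(1)] mem_A[OF x] by auto
  with y(1) show ?thesis by auto
qed

lemma A_collection:
  assumes R: "D0 (Suc (Suc N)) R" and e: "e \<in> elts A" and v: "\<And>i. v i \<in> elts A" and x: "x \<in> elts A"
    and ex: "\<And>y. y \<in> elts x \<Longrightarrow> \<exists>z\<in>elts A. R e (v(N := y, Suc N := z))"
  shows "\<exists>w\<in>elts A. \<forall>y\<in>elts x. \<exists>z\<in>elts w. R e (v(N := y, Suc N := z))"
proof -
  let ?r = "\<lambda>i. if i < N then (\<lambda>(e::'v) (v::nat\<Rightarrow>'v). v (Suc (Suc i))) else if i = N then (\<lambda>e v. v 0) else (\<lambda>e v. v 1)"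
  have "D0 (Suc (Suc N)) (\<lambda>e v. R e (\<lambda>i. ?r i e v))"
    by (intro D0_comp[OF R] simple_Const) (auto intro: simple_var)
  then obtain \<phi> where \<phi>: "Delta0 \<phi>" "(\<lambda>e v. R e (\<lambda>i. ?r i e v)) = (\<lambda>e v. sat UNIV mem e v \<phi>)"
    unfolding D0_def by auto
  define v' where "v' = (\<lambda>i. if i < 2 then e else v (i - 2))"
  have v': "v' i \<in> elts A" for i using e v by (simp add: v'_def)
  have eq: "sat (elts A) mem e (v'(0 := y, 1 := z)) \<phi> \<longleftrightarrow> R e (v(N := y, Suc N := z))"
    if "y \<in> elts A" "z \<in> elts A" for y z
  proof -
    have "sat (elts A) mem e (v'(0 := y, 1 := z)) \<phi> \<longleftrightarrow> sat UNIV mem e (v'(0 := y, 1 := z)) \<phi>"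
      using v' that by (intro sat_absolute \<phi> e) auto
    also have "\<dots> \<longleftrightarrow> R e (\<lambda>i. ?r i e (v'(0 := y, 1 := z)))"
      using fun_cong[OF fun_cong[OF \<phi>(2)], of e "v'(0 := y, 1 := z)"] by simp
    also have "\<dots> \<longleftrightarrow> R e (v(N := y, Suc N := z))"
      by (rule D0_supp[OF R]) (auto simp: v'_def less_Suc_eq numeral_2_eq_2)
    finally show ?thesis .
  qed
  have "\<forall>y\<in>elts A. y \<in> elts x \<longrightarrow> (\<exists>z\<in>elts A. sat (elts A) mem e (v'(0 := y, 1 := z)) \<phi>)"
    using ex eq by meson
  moreover note KP'[THEN conjunct2, THEN conjunct2, THEN conjunct2, THEN conjunct2, THEN conjunct2, THEN conjunct1,
      THEN spec[of _ \<phi>], THEN spec[of _ e], THEN spec[of _ v']]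
  ultimately obtain w where w: "w \<in> elts A"
    "\<forall>y\<in>elts A. y \<in> elts x \<longrightarrow> (\<exists>z\<in>elts A. z \<in> elts w \<and> sat (elts A) mem e (v'(0 := y, 1 := z)) \<phi>)"
    using \<phi>(1) e v' x by (elim impE) auto
  show ?thesis using w(2) eq mem_A[OF x] by (intro bexI[OF _ w(1)]) meson
qed

text \<open>Substitution into formulas interpreted over \<open>A\<close> needs both halves: bounded
  formulas must stay bounded, and the substituted values must belong to \<open>A\<close>.\<close>

definition rud :: "nat \<Rightarrow> ('v \<Rightarrow> (nat \<Rightarrow> 'v) \<Rightarrow> 'v) \<Rightarrow> bool" where
  "rud N G \<longleftrightarrow> simple N G \<and> (\<forall>e\<in>elts A. \<forall>v. (\<forall>i. v i \<in> elts A) \<longrightarrow> G e v \<in> elts A)"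

lemma rud_simple: "rud N G \<Longrightarrow> simple N G"
  by (simp add: rud_def)

lemma rud_closed: "rud N G \<Longrightarrow> e \<in> elts A \<Longrightarrow> (\<And>i. v i \<in> elts A) \<Longrightarrow> G e v \<in> elts A"
  by (simp add: rud_def)

lemma rud_mono: "rud N G \<Longrightarrow> N \<le> M \<Longrightarrow> rud M G"
  using simple_mono by (auto simp: rud_def)

lemma rud_upd: "rud N G \<Longrightarrow> N \<le> M \<Longrightarrow> G e (v(M := x)) = G e v"
  using simple_upd rud_simple by blast

lemma rud_var: "i < N \<Longrightarrow> rud N (\<lambda>e v. v i)"
  by (simp add: rud_def simple_var)

lemma rud_Const: "rud N (\<lambda>e v. e)"
  by (simp add: rud_def simple_Const)

lemma A_empty: "vset {} \<in> elts A"
proof -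
  from A_ne obtain x where x: "x \<in> elts A" by auto
  from A_separation[of 0 "\<lambda>e v. False" x "\<lambda>_. x", OF D0_const x x x]
  obtain y where "y \<in> elts A" "elts y = {}" by auto
  moreover from this have "y = vset {}" by (intro extensionality) simp
  ultimately show ?thesis by simp
qed

lemma A_vins:
  assumes x: "x \<in> elts A" and y: "y \<in> elts A" shows "vins x y \<in> elts A"
proof -
  obtain p where p: "p \<in> elts A" "x \<in> elts p" using A_pairing[OF x x] by auto
  obtain q where q: "q \<in> elts A" "p \<in> elts q" "y \<in> elts q" using A_pairing[OF p(1) y] by auto
  obtain u where u: "u \<in> elts A" "\<forall>z\<in>elts q. elts z \<subseteq> elts u" using A_union[OF q(1)] by auto
  have "D0 (Suc 2) (\<lambda>e v. v 2 = v 0 \<or> v 2 \<in> elts (v 1 :: 'v))"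
    by (intro D0_disj D0_var_eq D0_mem simple_var) auto
  moreover have "(if i = 0 then x else y) \<in> elts A" for i :: nat using x y by simp
  ultimately obtain z where z: "z \<in> elts A" "elts z = {z\<in>elts u. z = x \<or> z \<in> elts y}"
    using A_separation[of 2 "\<lambda>e v. v 2 = v 0 \<or> v 2 \<in> elts (v 1)" x "\<lambda>i. if i = 0 then x else y" u] x u(1) by auto
  have "elts z = elts (vins x y)" using z(2) u(2) p q by auto
  then show ?thesis using extensionality z(1) by metis
qed

lemma rud_empty: "rud N (\<lambda>e v. vset {})"
  by (simp add: rud_def simple_empty A_empty)

lemma rud_vins: "rud N G \<Longrightarrow> rud N H \<Longrightarrow> rud N (\<lambda>e v. vins (G e v) (H e v))"
  by (simp add: rud_def simple_vins A_vins)

lemma rud_vpair: "rud N G \<Longrightarrow> rud N H \<Longrightarrow> rud N (\<lambda>e v. vpair (G e v) (H e v))"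
  unfolding vpair_vins by (intro rud_vins rud_empty)

lemma rud_vnat: "rud N (\<lambda>e v. vnat m)"
  by (induction m) (auto intro: rud_empty dest: rud_vins simp flip: vins_def)

lemma rud_if: "D0 N Q \<Longrightarrow> rud N G \<Longrightarrow> rud N H \<Longrightarrow> rud N (\<lambda>e v. if Q e v then G e v else H e v)"
  by (simp add: rud_def simple_if)

text \<open>Collection places all values of \<open>f\<close> in one set of \<open>A\<close>; its
  union contains the required set, which is then cut out by separation.\<close>

lemma rud_vUN:
  assumes G: "rud N G" and f: "\<And>M. N \<le> M \<Longrightarrow> rud (Suc M) (\<lambda>e v. f e v (v M))"
    and upd: "\<And>M e v x y. N \<le> M \<Longrightarrow> f e (v(M := y)) x = f e v x"
  shows "rud N (\<lambda>e v. vUN (G e v) (f e v))"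
  unfolding rud_def
proof (intro conjI ballI allI impI)
  show "simple N (\<lambda>e v. vUN (G e v) (f e v))"
    by (rule simple_vUN[OF rud_simple[OF G] rud_simple[OF f] upd])
  fix e and v :: "nat \<Rightarrow> 'v" assume e: "e \<in> elts A" and "\<forall>i. v i \<in> elts A"
  then have v: "v i \<in> elts A" for i by simp
  have fA: "f e v y \<in> elts A" if "y \<in> elts A" for y
  proof -
    have "f e (v(N := y)) ((v(N := y)) N) \<in> elts A"
      by (rule rud_closed[OF f[OF order_refl] e]) (use v that in auto)
    then show ?thesis by (simp add: upd)
  qed
  have X: "G e v \<in> elts A" using rud_closed[OF G e] v by auto
  have "D0 (Suc (Suc N)) (\<lambda>e v. v (Suc N) = f e v (v N))"
    by (intro D0_eq simple_var simple_mono[OF rud_simple[OF f]]) auto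
  from A_collection[where v = v, OF this e v X] fA mem_A[OF X]
  obtain w where w: "w \<in> elts A" "\<forall>y\<in>elts (G e v). f e v y \<in> elts w"
    by (auto simp: upd)
  obtain u where u: "u \<in> elts A" "\<forall>y\<in>elts w. elts y \<subseteq> elts u" using A_union[OF w(1)] by auto
  have "D0 (Suc N) (\<lambda>e v. \<exists>y\<in>elts (G e v). v N \<in> elts (f e v y))"
    by (intro D0_bex D0_mem simple_mono[OF rud_simple[OF G]] simple_var rud_simple[OF f]) (auto simp: upd)
  from A_separation[where v = v, OF this e v u(1)]
  obtain z where z: "z \<in> elts A" "elts z = {z\<in>elts u. \<exists>y\<in>elts (G e v). z \<in> elts (f e v y)}"
    by (auto simp: upd rud_upd[OF G])
  have "elts z = elts (vUN (G e v) (f e v))" using z(2) u(2) w(2) by auto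
  then show "vUN (G e v) (f e v) \<in> elts A" using extensionality z(1) by metis
qed

lemma rud_pfst:
  assumes G: "rud N G" shows "rud N (\<lambda>e v. pfst (G e v))"
  unfolding pfst_def
  by (intro rud_vUN rud_if D0_eq rud_simple rud_vpair rud_var rud_empty rud_mono[OF G]) (auto simp: rud_upd[OF G] cong: if_cong)

lemma rud_psnd:
  assumes G: "rud N G" shows "rud N (\<lambda>e v. psnd (G e v))"
  unfolding psnd_def
  by (intro rud_vUN rud_if D0_eq rud_simple rud_vpair rud_var rud_empty rud_mono[OF G]) (auto simp: rud_upd[OF G] cong: if_cong)

lemma rud_vnth:
  assumes G: "rud N G" shows "rud N (\<lambda>e v. vnth m (G e v))"
  unfolding vnth_def
  by (intro rud_vUN rud_if D0_eq rud_simple rud_pfst rud_psnd rud_vnat rud_var rud_empty G) (auto cong: if_cong)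

lemma rud_vdel:
  assumes G: "rud N G" shows "rud N (\<lambda>e v. vdel k (G e v))"
  unfolding vdel_def
  by (intro rud_vUN[of N G] rud_if D0_eq D0_mem rud_simple rud_vins rud_vpair
      rud_vUN[of _ "\<lambda>e v. pfst (v _)" "\<lambda>e v z. z"] rud_pfst rud_psnd rud_vnat rud_var rud_empty G) (auto cong: if_cong)

lemma rud_vadd:
  assumes G: "rud N G" and H: "rud N H" shows "rud N (\<lambda>e v. vadd k (H e v) (G e v))"
  unfolding vadd_def
  by (intro rud_vUN rud_if D0_eq D0_mem rud_simple rud_vins rud_vpair rud_pfst rud_psnd rud_vnat rud_var rud_empty G H) (auto cong: if_cong)

lemma rud_vsup: "rud N (\<lambda>e v. vsup e)"
  unfolding vsup_def by (intro rud_vUN rud_var rud_Const) auto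


subsection \<open>Relations definable by Sigma formulas over a transitive model\<close>

definition agree_on_A :: "('v \<Rightarrow> (nat \<Rightarrow> 'v) \<Rightarrow> bool) \<Rightarrow> ('v \<Rightarrow> (nat \<Rightarrow> 'v) \<Rightarrow> bool) \<Rightarrow> bool" where
  "agree_on_A R R' \<longleftrightarrow> (\<forall>e\<in>elts A. \<forall>v. (\<forall>i. v i \<in> elts A) \<longrightarrow> R e v = R' e v)"

lemma agree_on_AI: "(\<And>e v. e \<in> elts A \<Longrightarrow> (\<And>i. v i \<in> elts A) \<Longrightarrow> R e v = R' e v) \<Longrightarrow> agree_on_A R R'"
  by (simp add: agree_on_A_def)

lemma agree_on_AD: "agree_on_A R R' \<Longrightarrow> e \<in> elts A \<Longrightarrow> (\<And>i. v i \<in> elts A) \<Longrightarrow> R e v = R' e v"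
  by (simp add: agree_on_A_def)

lemma agree_on_A_trans: "agree_on_A R S \<Longrightarrow> agree_on_A R T \<Longrightarrow> agree_on_A T S"
  by (simp add: agree_on_A_def)

text \<open>A semantic version of the Levy hierarchy over \<open>A\<close>, with one rule
  application per quantifier of a block. Closure under agreement on \<open>A\<close> allows
  relations that are presented by other means than formulas.\<close>

inductive Sg :: "nat \<Rightarrow> nat \<Rightarrow> ('v \<Rightarrow> (nat \<Rightarrow> 'v) \<Rightarrow> bool) \<Rightarrow> bool" where
  Sg_zero: "D0 N S \<Longrightarrow> agree_on_A R S \<Longrightarrow> Sg 0 N R"
| Sg_neg: "Sg n N S \<Longrightarrow> agree_on_A R (\<lambda>e v. \<not> S e v) \<Longrightarrow> Sg (Suc n) N R"
| Sg_ex: "Sg (Suc n) (Suc N) S \<Longrightarrow> agree_on_A R (\<lambda>e v. \<exists>x\<in>elts A. S e (v(N := x))) \<Longrightarrow> Sg (Suc n) N R"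

lemma Sg_agree: "Sg n N R \<Longrightarrow> agree_on_A R R' \<Longrightarrow> Sg n N R'"
  by (erule Sg.cases) (auto intro: Sg.intros agree_on_A_trans)

lemma Sg_cong:
  assumes "Sg n N R" "\<And>e v. e \<in> elts A \<Longrightarrow> (\<And>i. v i \<in> elts A) \<Longrightarrow> R e v = R' e v"
  shows "Sg n N R'"
  by (rule Sg_agree[OF assms(1) agree_on_AI[OF assms(2)]])

lemma Sg_formula:
  "Sg n N R \<Longrightarrow> \<exists>\<phi>\<in>Sigma_fm n. fv \<phi> \<subseteq> {..<N} \<and> agree_on_A R (\<lambda>e v. sat (elts A) mem e v \<phi>)"
proof (induction rule: Sg.induct)
  case (Sg_zero N S R)
  from Sg_zero(1) obtain \<phi> where \<phi>: "Delta0 \<phi>" "fv \<phi> \<subseteq> {..<N}" "S = (\<lambda>e v. sat UNIV mem e v \<phi>)"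
    unfolding D0_def by auto
  have "agree_on_A R (\<lambda>e v. sat (elts A) mem e v \<phi>)"
    by (rule agree_on_AI) (use agree_on_AD[OF Sg_zero(2)] sat_absolute[OF \<phi>(1)] \<phi>(3) in auto)
  with \<phi> show ?case by auto
next
  case (Sg_neg n N S R)
  then obtain \<phi> where \<phi>: "\<phi> \<in> Sigma_fm n" "fv \<phi> \<subseteq> {..<N}" "agree_on_A S (\<lambda>e v. sat (elts A) mem e v \<phi>)" by auto
  have "agree_on_A R (\<lambda>e v. sat (elts A) mem e v (Neg \<phi>))"
    by (rule agree_on_AI) (use agree_on_AD[OF Sg_neg(2)] agree_on_AD[OF \<phi>(3)] in auto)
  moreover have "foldr Ex [] (Neg \<phi>) \<in> Sigma_fm (Suc n)" using \<phi>(1) unfolding Sigma_fm.simps by blast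
  ultimately show ?case using \<phi>(2) by (intro bexI[of _ "Neg \<phi>"]) simp_all
next
  case (Sg_ex n N S R)
  then obtain \<phi> where \<phi>: "\<phi> \<in> Sigma_fm (Suc n)" "fv \<phi> \<subseteq> {..<Suc N}" "agree_on_A S (\<lambda>e v. sat (elts A) mem e v \<phi>)" by auto
  from \<phi>(1) obtain ks \<psi> where "\<phi> = foldr Ex ks (Neg \<psi>)" "\<psi> \<in> Sigma_fm n" by auto
  then have "Ex N \<phi> = foldr Ex (N # ks) (Neg \<psi>)" by simp
  with \<open>\<psi> \<in> Sigma_fm n\<close> have "Ex N \<phi> \<in> Sigma_fm (Suc n)" unfolding Sigma_fm.simps by blast
  moreover have "agree_on_A R (\<lambda>e v. sat (elts A) mem e v (Ex N \<phi>))"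
    by (rule agree_on_AI) (use agree_on_AD[OF Sg_ex(2)] agree_on_AD[OF \<phi>(3)] in auto)
  moreover have "fv (Ex N \<phi>) \<subseteq> {..<N}" using \<phi>(2) by (auto simp: less_Suc_eq)
  ultimately show ?case by (intro bexI[of _ "Ex N \<phi>"] conjI)
qed

text \<open>The quantifier prefix survives unchanged up to renaming and only the matrix absorbs the
  functions, so the level is exactly preserved.\<close>

lemma Sg_subst:
  "\<phi> \<in> Sigma_fm n \<Longrightarrow> (\<And>i. rud N (\<rho> i)) \<Longrightarrow> rud N H \<Longrightarrow> Sg n N (\<lambda>e v. sat (elts A) mem (H e v) (\<lambda>i. \<rho> i e v) \<phi>)"
proof (induction n arbitrary: \<phi> N \<rho>)
  case 0
  have "D0 N (\<lambda>e v. sat UNIV mem (H e v) (\<lambda>i. \<rho> i e v) \<phi>)"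
    using 0 by (intro D0_subst rud_simple) auto
  then show ?case
  proof (rule Sg_zero, intro agree_on_AI)
    fix e and v :: "nat \<Rightarrow> 'v" assume e: "e \<in> elts A" and v: "\<And>i. v i \<in> elts A"
    have "\<rho> i e v \<in> elts A" for i by (rule rud_closed[OF 0(2) e v])
    moreover have "H e v \<in> elts A" by (rule rud_closed[OF 0(3) e v])
    moreover have "Delta0 \<phi>" using 0(1) by simp
    ultimately show "sat (elts A) mem (H e v) (\<lambda>i. \<rho> i e v) \<phi> = sat UNIV mem (H e v) (\<lambda>i. \<rho> i e v) \<phi>"
      by (intro sat_absolute)
  qed
next
  case (Suc n)
  from Suc.prems(1) obtain ks \<psi> where \<phi>: "\<phi> = foldr Ex ks (Neg \<psi>)" "\<psi> \<in> Sigma_fm n" by auto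
  from Suc.prems(2,3) show ?case unfolding \<phi>(1)
  proof (induction ks arbitrary: N \<rho>)
    case Nil
    have "Sg n N (\<lambda>e v. sat (elts A) mem (H e v) (\<lambda>i. \<rho> i e v) \<psi>)"
      by (rule Suc.IH[OF \<phi>(2)]) (rule Nil)+
    then show ?case by (rule Sg_neg) (simp add: agree_on_AI)
  next
    case (Cons k ks)
    let ?\<rho> = "\<rho>(k := \<lambda>e v. v N)"
    have "Sg (Suc n) (Suc N) (\<lambda>e v. sat (elts A) mem (H e v) (\<lambda>i. ?\<rho> i e v) (foldr Ex ks (Neg \<psi>)))"
    proof (rule Cons.IH)
      show "rud (Suc N) (?\<rho> i)" for i using rud_mono[OF Cons.prems(1)] by (auto intro: rud_var)
      show "rud (Suc N) H" by (rule rud_mono[OF Cons.prems(2)]) simp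
    qed
    then show ?case
    proof (rule Sg_ex)
      have "(\<lambda>i. ?\<rho> i e (v(N := x))) = (\<lambda>i. \<rho> i e v)(k := x)" for e and v :: "nat \<Rightarrow> 'v" and x
        by (rule ext) (simp add: rud_upd[OF Cons.prems(1)])
      then show "agree_on_A (\<lambda>e v. sat (elts A) mem (H e v) (\<lambda>i. \<rho> i e v) (foldr Ex (k # ks) (Neg \<psi>)))
        (\<lambda>e v. \<exists>x\<in>elts A. sat (elts A) mem (H e (v(N := x))) (\<lambda>i. ?\<rho> i e (v(N := x))) (foldr Ex ks (Neg \<psi>)))"
        by (simp add: agree_on_AI rud_upd[OF Cons.prems(2)])
    qed
  qed
qed

lemma Sg_comp:
  assumes "Sg n K R" "\<And>i. rud N (\<rho> i)" "rud N H" shows "Sg n N (\<lambda>e v. R (H e v) (\<lambda>i. \<rho> i e v))"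
proof -
  from Sg_formula[OF assms(1)] obtain \<phi> where \<phi>: "\<phi> \<in> Sigma_fm n" "agree_on_A R (\<lambda>e v. sat (elts A) mem e v \<phi>)" by auto
  have "Sg n N (\<lambda>e v. sat (elts A) mem (H e v) (\<lambda>i. \<rho> i e v) \<phi>)"
    by (rule Sg_subst[OF \<phi>(1)]) (rule assms(2,3))+
  then show ?thesis
  proof (rule Sg_cong)
    fix e and v :: "nat \<Rightarrow> 'v" assume e: "e \<in> elts A" and v: "\<And>i. v i \<in> elts A"
    have "\<rho> i e v \<in> elts A" for i by (rule rud_closed[OF assms(2) e v])
    moreover have "H e v \<in> elts A" by (rule rud_closed[OF assms(3) e v])
    ultimately show "sat (elts A) mem (H e v) (\<lambda>i. \<rho> i e v) \<phi> = R (H e v) (\<lambda>i. \<rho> i e v)"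
      by (intro agree_on_AD[OF \<phi>(2), symmetric])
  qed
qed

lemma Sg_supp:
  assumes "Sg n N R" "e \<in> elts A" "\<And>i. v i \<in> elts A" "\<And>i. v' i \<in> elts A" "\<And>i. i < N \<Longrightarrow> v i = v' i"
  shows "R e v \<longleftrightarrow> R e v'"
proof -
  from Sg_formula[OF assms(1)] obtain \<phi> where \<phi>: "fv \<phi> \<subseteq> {..<N}" "agree_on_A R (\<lambda>e v. sat (elts A) mem e v \<phi>)" by auto
  have "sat (elts A) mem e v \<phi> \<longleftrightarrow> sat (elts A) mem e v' \<phi>" by (rule sat_cong) (use \<phi>(1) assms(5) in auto)
  then show ?thesis using agree_on_AD[OF \<phi>(2)] assms(2-4) by auto
qed

lemma Sg_mono:
  assumes R: "Sg n N R" and "N \<le> M" shows "Sg n M R"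
proof -
  have "Sg n M (\<lambda>e v. R e (\<lambda>i. (if i < M then (\<lambda>e v. v i) else (\<lambda>e v. e)) e v))"
    by (intro Sg_comp[OF R] rud_Const) (auto intro: rud_var rud_Const)
  then show ?thesis
    by (rule Sg_cong) (rule Sg_supp[OF R]; use assms(2) in auto)
qed

lemma Sg_D0: "D0 N R \<Longrightarrow> Sg n N R"
proof (induction n arbitrary: R)
  case 0
  then show ?case by (rule Sg_zero) (rule agree_on_AI, simp)
next
  case (Suc n)
  show ?case by (rule Sg_neg[OF Suc.IH[OF D0_neg[OF Suc.prems]]]) (rule agree_on_AI, simp)
qed

text \<open>Negation exchanges the two connectives, so each level needs both from the level below.
  Within a level the two quantifier blocks are moved outside one after the other.\<close>

lemma Sg_conj_disj:
  "Sg n N R \<Longrightarrow> Sg n N S \<Longrightarrow> Sg n N (\<lambda>e v. R e v \<and> S e v) \<and> Sg n N (\<lambda>e v. R e v \<or> S e v)"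
proof (induction n arbitrary: N R S)
  case 0
  from 0(1) obtain R' where R: "D0 N R'" "agree_on_A R R'" by (cases rule: Sg.cases) auto
  from 0(2) obtain S' where S: "D0 N S'" "agree_on_A S S'" by (cases rule: Sg.cases) auto
  show ?case
    by (intro conjI; rule Sg_zero, rule D0_conj D0_disj, rule R(1), rule S(1))
      (use R(2) S(2) in \<open>auto simp: agree_on_A_def\<close>)
next
  case (Suc n)
  have neg_neg: "Sg (Suc n) N (\<lambda>e v. \<not> R e v \<and> \<not> S e v) \<and> Sg (Suc n) N (\<lambda>e v. \<not> R e v \<or> \<not> S e v)"
    if "Sg n N R" "Sg n N S" for N R S
    using Sg_neg[of n N "\<lambda>e v. R e v \<or> S e v" "\<lambda>e v. \<not> R e v \<and> \<not> S e v"]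
      Sg_neg[of n N "\<lambda>e v. R e v \<and> S e v" "\<lambda>e v. \<not> R e v \<or> \<not> S e v"] Suc.IH[OF that]
    by (auto simp: agree_on_A_def)
  \<comment> \<open>The quantifiers of the second relation are pulled out while the first is still a
    bare negation; those of the first follow afterwards.\<close>
  have neg_any: "Sg m N S \<Longrightarrow> m = Suc n \<Longrightarrow> Sg n N R \<Longrightarrow> Sg (Suc n) N (\<lambda>e v. \<not> R e v \<and> S e v) \<and> Sg (Suc n) N (\<lambda>e v. \<not> R e v \<or> S e v)"
    for m N S R
  proof (induction arbitrary: R rule: Sg.induct)
    case (Sg_neg m N S' S)
    then have "Sg (Suc n) N (\<lambda>e v. \<not> R e v \<and> \<not> S' e v) \<and> Sg (Suc n) N (\<lambda>e v. \<not> R e v \<or> \<not> S' e v)"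
      using neg_neg[of N R S'] by simp
    note * = this
    show ?case
    proof
      show "Sg (Suc n) N (\<lambda>e v. \<not> R e v \<and> S e v)"
        by (rule Sg_agree[OF *[THEN conjunct1]]) (use Sg_neg(2) in \<open>simp add: agree_on_A_def\<close>)
      show "Sg (Suc n) N (\<lambda>e v. \<not> R e v \<or> S e v)"
        by (rule Sg_agree[OF *[THEN conjunct2]]) (use Sg_neg(2) in \<open>simp add: agree_on_A_def\<close>)
    qed
  next
    case (Sg_ex m N S' S)
    have R: "Sg n (Suc N) R" by (rule Sg_mono[OF Sg_ex.prems(2)]) simp
    from Sg_ex.IH[OF Sg_ex.prems(1) R]
    have *: "Sg (Suc n) (Suc N) (\<lambda>e v. \<not> R e v \<and> S' e v)" "Sg (Suc n) (Suc N) (\<lambda>e v. \<not> R e v \<or> S' e v)" by auto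
    have up: "R e (v(N := x)) = R e v" if "e \<in> elts A" "\<And>i. v i \<in> elts A" "x \<in> elts A" for e v x
      by (rule Sg_supp[OF Sg_ex.prems(2)]) (use that in auto)
    have S: "S e v = (\<exists>x\<in>elts A. S' e (v(N := x)))" if "e \<in> elts A" "\<And>i. v i \<in> elts A" for e v
      using agree_on_AD[OF Sg_ex.hyps(2)] that .
    show ?case
    proof
      show "Sg (Suc n) N (\<lambda>e v. \<not> R e v \<and> S e v)"
        by (rule Sg.Sg_ex[OF *(1)], rule agree_on_AI) (simp add: S up cong: bex_cong)
      \<comment> \<open>Moving the quantifier across a disjunction is valid because \<open>A\<close>
        is nonempty.\<close>
      show "Sg (Suc n) N (\<lambda>e v. \<not> R e v \<or> S e v)"
        by (rule Sg.Sg_ex[OF *(2)], rule agree_on_AI) (use A_ne in \<open>auto simp add: S up\<close>)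
    qed
  qed simp
  have "Sg m N R \<Longrightarrow> m = Suc n \<Longrightarrow> Sg m N S \<Longrightarrow> Sg (Suc n) N (\<lambda>e v. R e v \<and> S e v) \<and> Sg (Suc n) N (\<lambda>e v. R e v \<or> S e v)"
    for m N S R
  proof (induction arbitrary: S rule: Sg.induct)
    case (Sg_neg m N R' R)
    then have "Sg (Suc n) N (\<lambda>e v. \<not> R' e v \<and> S e v) \<and> Sg (Suc n) N (\<lambda>e v. \<not> R' e v \<or> S e v)"
      using neg_any[of "Suc n" N S R'] by simp
    note * = this
    show ?case
    proof
      show "Sg (Suc n) N (\<lambda>e v. R e v \<and> S e v)"
        by (rule Sg_agree[OF *[THEN conjunct1]]) (use Sg_neg(2) in \<open>simp add: agree_on_A_def\<close>)
      show "Sg (Suc n) N (\<lambda>e v. R e v \<or> S e v)"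
        by (rule Sg_agree[OF *[THEN conjunct2]]) (use Sg_neg(2) in \<open>simp add: agree_on_A_def\<close>)
    qed
  next
    case (Sg_ex m N R' R)
    have S: "Sg (Suc m) (Suc N) S" by (rule Sg_mono[OF Sg_ex.prems(2)]) simp
    from Sg_ex.IH[OF Sg_ex.prems(1) S]
    have *: "Sg (Suc n) (Suc N) (\<lambda>e v. R' e v \<and> S e v)" "Sg (Suc n) (Suc N) (\<lambda>e v. R' e v \<or> S e v)" by auto
    have up: "S e (v(N := x)) = S e v" if "e \<in> elts A" "\<And>i. v i \<in> elts A" "x \<in> elts A" for e v x
      by (rule Sg_supp[OF Sg_ex.prems(2)]) (use that in auto)
    have R: "R e v = (\<exists>x\<in>elts A. R' e (v(N := x)))" if "e \<in> elts A" "\<And>i. v i \<in> elts A" for e v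
      using agree_on_AD[OF Sg_ex.hyps(2)] that .
    show ?case
    proof
      show "Sg (Suc n) N (\<lambda>e v. R e v \<and> S e v)"
        by (rule Sg.Sg_ex[OF *(1)], rule agree_on_AI) (simp add: R up cong: bex_cong)
      show "Sg (Suc n) N (\<lambda>e v. R e v \<or> S e v)"
        by (rule Sg.Sg_ex[OF *(2)], rule agree_on_AI) (use A_ne in \<open>auto simp add: R up\<close>)
    qed
  qed simp
  with Suc.prems show ?case by blast
qed

lemma Sg_conj: "Sg n N R \<Longrightarrow> Sg n N S \<Longrightarrow> Sg n N (\<lambda>e v. R e v \<and> S e v)"
  using Sg_conj_disj by blast

lemma Sg_All_less:
  "(\<And>m. m < k \<Longrightarrow> Sg n N (R m)) \<Longrightarrow> Sg n N (\<lambda>e v. \<forall>m<k. R m e v)" for k :: nat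
proof (induction k)
  case 0
  then show ?case using Sg_D0[OF D0_const[of N True]] by simp
next
  case (Suc k)
  then have "Sg n N (\<lambda>e v. (\<forall>m<k. R m e v) \<and> R k e v)" by (intro Sg_conj) auto
  then show ?case by (simp add: All_less_Suc conj_commute)
qed

lemma vsup_A: "e \<in> elts A \<Longrightarrow> x \<in> elts (vsup e) \<Longrightarrow> x \<in> elts A"
  using rud_closed[where v = "\<lambda>_. e", OF rud_vsup[of 0]] mem_A by blast

text \<open>At level 0 the quantifier is bounded by a simple function; at higher levels it joins the
  existential block, guarded by a bounded membership.\<close>

lemma Sg_ex_vsup:
  assumes R: "Sg n (Suc N) R" shows "Sg n N (\<lambda>e v. \<exists>x\<in>elts (vsup e). R e (v(N := x)))"
proof (cases n)
  case 0
  with R obtain S where S: "D0 (Suc N) S" "agree_on_A R S" by (cases rule: Sg.cases) auto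
  have "D0 N (\<lambda>e v. \<exists>x\<in>elts (vsup e). S e (v(N := x)))"
    by (rule simple_D0[OF rud_simple[OF rud_vsup] order_refl S(1)])
  moreover have "agree_on_A (\<lambda>e v. \<exists>x\<in>elts (vsup e). R e (v(N := x))) (\<lambda>e v. \<exists>x\<in>elts (vsup e). S e (v(N := x)))"
  proof (rule agree_on_AI, rule bex_cong[OF refl])
    fix e x and v :: "nat \<Rightarrow> 'v" assume e: "e \<in> elts A" and v: "\<And>i. v i \<in> elts A" and "x \<in> elts (vsup e)"
    then have "x \<in> elts A" using vsup_A by blast
    then show "R e (v(N := x)) = S e (v(N := x))" by (intro agree_on_AD[OF S(2) e]) (simp add: v)
  qed
  ultimately show ?thesis unfolding 0 by (rule Sg_zero)
next
  case (Suc m)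
  have "Sg n (Suc N) (\<lambda>e v. v N \<in> elts (vsup e) \<and> R e v)"
    by (intro Sg_conj R Sg_D0 D0_mem simple_var rud_simple rud_vsup) simp
  then have "Sg (Suc m) (Suc N) (\<lambda>e v. v N \<in> elts (vsup e) \<and> R e v)" unfolding Suc .
  then show ?thesis unfolding Suc
  proof (rule Sg_ex, intro agree_on_AI)
    fix e and v :: "nat \<Rightarrow> 'v" assume e: "e \<in> elts A"
    then have "x \<in> elts A" if "x \<in> elts (vsup e)" for x
      using that by (rule vsup_A)
    then show "(\<exists>x\<in>elts (vsup e). R e (v(N := x))) =
         (\<exists>x\<in>elts A. (v(N := x)) N \<in> elts (vsup e) \<and> R e (v(N := x)))" by auto
  qed
qed

lemma Sg_ex_vsup_var:
  assumes R: "Sg n N R" and k: "k < N"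
  shows "Sg n N (\<lambda>e v. \<exists>x\<in>elts (vsup e). R e (v(k := x)))"
proof -
  let ?\<rho> = "\<lambda>i. if i = k then (\<lambda>e v. v N) else if i < N then (\<lambda>e v. v i) else (\<lambda>(e::'v) (v::nat\<Rightarrow>'v). e)"
  have "Sg n (Suc N) (\<lambda>e v. R e (\<lambda>i. ?\<rho> i e v))"
    by (rule Sg_comp[OF R _ rud_Const]) (auto intro: rud_var rud_Const)
  from Sg_ex_vsup[OF this] show ?thesis
  proof (rule Sg_cong)
    fix e and v :: "nat \<Rightarrow> 'v" assume e: "e \<in> elts A" and v: "\<And>i. v i \<in> elts A"
    have "x \<in> elts A" if "x \<in> elts (vsup e)" for x
      using e that by (rule vsup_A)
    then have "R e (\<lambda>i. ?\<rho> i e (v(N := x))) = R e (v(k := x))" if "x \<in> elts (vsup e)" for x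
      by (intro Sg_supp[OF R e]) (use that e v k in auto)
    then show "(\<exists>x\<in>elts (vsup e). R e (\<lambda>i. ?\<rho> i e (v(N := x)))) = (\<exists>x\<in>elts (vsup e). R e (v(k := x)))"
      by (rule bex_cong[OF refl])
  qed
qed

lemma Sg_ex_vsup_set:
  assumes R: "Sg n N R" and K: "finite K" "K \<subseteq> {..<N}"
  shows "Sg n N (\<lambda>e v. \<exists>y. (\<forall>i\<in>K. y i \<in> elts (vsup e)) \<and> R e (\<lambda>i. if i \<in> K then y i else v i))"
  using K
proof (induction K rule: finite_induct)
  case empty
  show ?case using R by simp
next
  case (insert k K)
  then have "Sg n N (\<lambda>e v. \<exists>y. (\<forall>i\<in>K. y i \<in> elts (vsup e)) \<and> R e (\<lambda>i. if i \<in> K then y i else v i))" by simp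
  from Sg_ex_vsup_var[OF this, of k] insert.prems
  have "Sg n N (\<lambda>e v. \<exists>x\<in>elts (vsup e). \<exists>y. (\<forall>i\<in>K. y i \<in> elts (vsup e)) \<and>
      R e (\<lambda>i. if i \<in> K then y i else (v(k := x)) i))" by simp
  then show ?case
  proof (rule Sg_cong)
    fix e v
    show "(\<exists>x\<in>elts (vsup e). \<exists>y. (\<forall>i\<in>K. y i \<in> elts (vsup e)) \<and> R e (\<lambda>i. if i \<in> K then y i else (v(k := x)) i)) \<longleftrightarrow>
      (\<exists>y. (\<forall>i\<in>insert k K. y i \<in> elts (vsup e)) \<and> R e (\<lambda>i. if i \<in> insert k K then y i else v i))" (is "?l \<longleftrightarrow> ?r")
    proof
      assume ?l
      then obtain x y where xy: "x \<in> elts (vsup e)" "\<forall>i\<in>K. y i \<in> elts (vsup e)"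
        "R e (\<lambda>i. if i \<in> K then y i else (v(k := x)) i)" by auto
      have "(\<lambda>i. if i \<in> K then y i else (v(k := x)) i) = (\<lambda>i. if i \<in> insert k K then (y(k := x)) i else v i)"
        using insert.hyps(2) by auto
      with xy insert.hyps(2) show ?r by (intro exI[of _ "y(k := x)"]) auto
    next
      assume ?r
      then obtain y where y: "\<forall>i\<in>insert k K. y i \<in> elts (vsup e)"
        "R e (\<lambda>i. if i \<in> insert k K then y i else v i)" by auto
      have "(\<lambda>i. if i \<in> insert k K then y i else v i) = (\<lambda>i. if i \<in> K then y i else (v(k := y k)) i)" by auto
      with y show ?l by (intro bexI[of _ "y k"] exI[of _ y]) auto
    qed
  qed
qed

end

subsection \<open>Indiscernibility\<close>

lemma least_model_is_least: "\<exists>A. is_least_model T c A \<Longrightarrow> is_least_model T c (least_model T c)"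
  unfolding least_model_def
proof (rule theI')
  assume "\<exists>A. is_least_model T c A"
  then obtain A where A: "is_least_model T c A" ..
  show "\<exists>!A. is_least_model T c A"
  proof (rule ex1I[of _ A], rule A)
    fix B assume "is_least_model T c B"
    with A have "elts A \<subseteq> elts B" "elts B \<subseteq> elts A" by (simp_all add: is_least_model_def)
    then show "B = A" by (intro extensionality) simp
  qed
qed

locale indiscernibles =
  fixes n :: nat and T :: "fm set" and C :: "'v::zf_universe set"
  assumes extends_KP: "theory_extending_KP TYPE('v) T" and generating: "generating_indiscernibles n T C"
begin

lemma club: "club_class C"
  using generating unfolding generating_indiscernibles_def by (elim conjE)

lemma least: "c \<in> increasing_seqs C \<Longrightarrow> is_least_model T c (least_model T c)"
  using generating unfolding generating_indiscernibles_def
  by (elim conjE) (rule least_model_is_least, erule (1) bspec)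

lemma kp_set_model: "transitive_model T c A \<Longrightarrow> kp_set A" for A :: 'v
  using extends_KP unfolding transitive_model_def theory_extending_KP_def
  by (intro kp_set.intro; elim conjE) simp_all

lemma kp_set_least: "c \<in> increasing_seqs C \<Longrightarrow> kp_set (least_model T c)"
  using least kp_set_model unfolding is_least_model_def by blast

lemma vseq_least: "c \<in> increasing_seqs C \<Longrightarrow> vseq c \<in> elts (least_model T c)"
  using least unfolding is_least_model_def transitive_model_def by blast

lemma seq_mem_least:
  assumes c: "c \<in> increasing_seqs C" shows "c i \<in> elts (least_model T c)"
proof -
  interpret kp_set "least_model T c" by (rule kp_set_least[OF c])
  have "vnth i (vseq c) \<in> elts (least_model T c)"
    by (rule rud_closed[where v = "\<lambda>_. vseq c", OF rud_vnth[OF rud_Const[of 0]]]) (rule vseq_least[OF c])+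
  then show ?thesis by (simp add: vnth_vseq)
qed

lemma least_model_le:
  assumes "c \<in> increasing_seqs C" "d \<in> increasing_seqs C" "vseq d \<in> elts (least_model T c)"
  shows "elts (least_model T d) \<subseteq> elts (least_model T c)"
  using least[OF assms(1)] least[OF assms(2)] assms(3) unfolding is_least_model_def transitive_model_def by blast

lemma vord_seq: "c \<in> increasing_seqs C \<Longrightarrow> vord (c i)"
  by (rule increasing_seqs_vord[OF club])

lemma seq_less: "c \<in> increasing_seqs C \<Longrightarrow> i < j \<Longrightarrow> c i \<in> elts (c j)"
  by (simp add: increasing_seqs_def)

lemma seq_C: "c \<in> increasing_seqs C \<Longrightarrow> c i \<in> C"
  by (simp add: increasing_seqs_def)

lemma elts_vsup_seq: "c \<in> increasing_seqs C \<Longrightarrow> elts (vsup (vseq c)) = (\<Union>i. elts (c i))"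
  by (rule elts_vsup_vseq) (rule vnat_subset_seq[OF club])

section \<open>Inserting an indiscernible into the sequence\<close>

definition slot :: "(nat \<Rightarrow> 'v) \<Rightarrow> 'v \<Rightarrow> nat" where
  "slot c x = (LEAST k. x \<in> elts (c k))"

lemma insert_at_increasing:
  assumes c: "c \<in> increasing_seqs C" and x: "x \<in> C" "x \<in> elts (c j)" "x \<notin> range c"
  shows "insert_at (slot c x) x c \<in> increasing_seqs C"
proof -
  let ?k = "slot c x"
  have k: "x \<in> elts (c ?k)" unfolding slot_def using x(2) by (rule LeastI)
  have above: "x \<in> elts (c i)" if "?k \<le> i" for i
    using that k seq_less[OF c, of ?k i] vord_trans[OF vord_seq[OF c, of i]] by (cases "i = ?k") auto
  have below: "c i \<in> elts x" if "i < ?k" for i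
  proof -
    have "x \<notin> elts (c i)" using not_less_Least[OF that[unfolded slot_def]] .
    moreover have "x \<noteq> c i" using x(3) by auto
    ultimately show ?thesis using vord_linear[OF club_class_vord[OF club x(1)] vord_seq[OF c]] by blast
  qed
  have "insert_at ?k x c i \<in> C" for i using x(1) seq_C[OF c] by (simp add: insert_at_def)
  moreover have "insert_at ?k x c i \<in> elts (insert_at ?k x c j)" if "i < j" for i j
    using that above[of "j - 1"] below[of i] seq_less[OF c, of i j] seq_less[OF c, of i "j - 1"] seq_less[OF c, of "i - 1" "j - 1"]
    by (auto simp: insert_at_def)
  ultimately show ?thesis by (simp add: increasing_seqs_def)
qed

text \<open>The inserted ordinal lies below an entry of \<open>c\<close> and so belongs to the model
  by transitivity. Each sequence is then rudimentary in the other, by \<open>vadd\<close> and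
  \<open>vdel\<close>, and minimality gives both inclusions.\<close>

lemma least_model_insert_at:
  assumes c: "c \<in> increasing_seqs C" and x: "x \<in> C" "x \<in> elts (c j)" "x \<notin> range c"
  shows "least_model T (insert_at (slot c x) x c) = least_model T c"
proof (rule extensionality, rule equalityI)
  let ?d = "insert_at (slot c x) x c"
  have d: "?d \<in> increasing_seqs C" by (rule insert_at_increasing[OF assms])
  interpret c: kp_set "least_model T c" by (rule kp_set_least[OF c])
  interpret d: kp_set "least_model T ?d" by (rule kp_set_least[OF d])
  have "x \<in> elts (least_model T c)" using c.mem_A[OF seq_mem_least[OF c] x(2)] .
  then have "vadd (slot c x) x (vseq c) \<in> elts (least_model T c)"
    using c.rud_closed[where v = "\<lambda>_. x", OF c.rud_vadd[OF c.rud_Const c.rud_var[of 0 1]] vseq_least[OF c]] by simp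
  then show "elts (least_model T ?d) \<subseteq> elts (least_model T c)"
    using least_model_le[OF c d] by (simp add: vadd_vseq)
  have "vdel (slot c x) (vseq ?d) \<in> elts (least_model T ?d)"
    by (rule d.rud_closed[where v = "\<lambda>_. vseq ?d", OF d.rud_vdel[OF d.rud_Const[of 0]]]) (rule vseq_least[OF d])+
  then show "elts (least_model T c) \<subseteq> elts (least_model T ?d)"
    using least_model_le[OF d c] by (simp add: vdel_vseq)
qed

text \<open>By linearity of the ordinals, the listed memberships and equalities determine all order
  relations among the parameters and the sequence.\<close>

definition same_type :: "(nat \<Rightarrow> 'v) \<Rightarrow> (nat \<Rightarrow> 'v) \<Rightarrow> nat \<Rightarrow> (nat \<Rightarrow> 'v) \<Rightarrow> (nat \<Rightarrow> 'v) \<Rightarrow> bool" where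
  "same_type c c' N v v' \<longleftrightarrow>
     (\<forall>i<N. \<forall>j. (v i \<in> elts (c j) \<longleftrightarrow> v' i \<in> elts (c' j)) \<and> (v i = c j \<longleftrightarrow> v' i = c' j)) \<and>
     (\<forall>i<N. \<forall>j<N. v i \<in> elts (v j) \<longleftrightarrow> v' i \<in> elts (v' j))"

text \<open>Induction on the number of parameters: the last one is absorbed into the sequence, and
  \<open>R\<close> is adapted by rudimentary functions reading it back. Without parameters the
  statement is that of generating indiscernibles. The sequences vary in the induction while
  \<open>A\<close> stays fixed.\<close>

theorem indiscernible:
  assumes "kp_set.Sg A n N R" "c \<in> increasing_seqs C" "c' \<in> increasing_seqs C"
    "least_model T c = A" "least_model T c' = A" "same_type c c' N v v'"
    "\<And>i. i < N \<Longrightarrow> v i \<in> C \<and> v' i \<in> C \<and> (\<exists>j. v i \<in> elts (c j))"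
    "\<And>i. v i \<in> elts A" "\<And>i. v' i \<in> elts A"
  shows "R (vseq c) v \<longleftrightarrow> R (vseq c') v'"
  using assms
proof (induction N arbitrary: R c c')
  case 0
  interpret kp_set A using kp_set_least 0 by blast
  from Sg_formula[OF 0(1)] obtain \<phi> where \<phi>: "\<phi> \<in> Sigma_fm n" "fv \<phi> = {}" "agree_on_A R (\<lambda>e v. sat (elts A) mem e v \<phi>)"
    by auto
  have e: "vseq c \<in> elts A" "vseq c' \<in> elts A" using vseq_least[OF 0(2)] vseq_least[OF 0(3)] 0(4,5) by auto
  have "A_sat T c (\<lambda>_. vseq c) \<phi> \<longleftrightarrow> A_sat T c' (\<lambda>_. vseq c') \<phi>"
    using generating 0(2,3) \<phi>(1,2) unfolding generating_indiscernibles_def by (elim conjE) blast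
  then have "sat (elts A) mem (vseq c) (\<lambda>_. vseq c) \<phi> \<longleftrightarrow> sat (elts A) mem (vseq c') (\<lambda>_. vseq c') \<phi>"
    by (simp add: A_sat_def 0(4,5))
  moreover have "sat (elts A) mem (vseq c) v \<phi> \<longleftrightarrow> sat (elts A) mem (vseq c) (\<lambda>_. vseq c) \<phi>"
    "sat (elts A) mem (vseq c') v' \<phi> \<longleftrightarrow> sat (elts A) mem (vseq c') (\<lambda>_. vseq c') \<phi>"
    by (rule sat_cong, simp add: \<phi>(2))+
  moreover have "R (vseq c) v \<longleftrightarrow> sat (elts A) mem (vseq c) v \<phi>" "R (vseq c') v' \<longleftrightarrow> sat (elts A) mem (vseq c') v' \<phi>"
    using agree_on_AD[OF \<phi>(3)] e 0(8,9) by auto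
  ultimately show ?case by simp
next
  case (Suc N)
  note c = Suc.prems(2) and c' = Suc.prems(3)
  interpret kp_set A using kp_set_least Suc.prems(2,4) by blast
  let ?x = "v N" let ?x' = "v' N"
  have ty: "(v i \<in> elts (c j) \<longleftrightarrow> v' i \<in> elts (c' j)) \<and> (v i = c j \<longleftrightarrow> v' i = c' j)" if "i \<le> N" for i j
    using Suc.prems(6) that unfolding same_type_def by simp
  have ty2: "v i \<in> elts (v j) \<longleftrightarrow> v' i \<in> elts (v' j)" if "i \<le> N" "j \<le> N" for i j
    using Suc.prems(6) that unfolding same_type_def by simp
  have in_C: "v i \<in> C" "v' i \<in> C" "\<exists>j. v i \<in> elts (c j)" if "i \<le> N" for i using Suc.prems(7)[of i] that by auto
  have ty3: "v i = v j \<longleftrightarrow> v' i = v' j" if "i \<le> N" "j \<le> N" for i j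
    using ty2[OF that] ty2[OF that(2,1)] vord_linear[of "v i" "v j"] vord_linear[of "v' i" "v' j"]
      in_C[OF that(1)] in_C[OF that(2)] club_class_vord[OF club] mem_irrefl by metis
  have \<rho>: "rud N (\<lambda>e v. if i < N then v i else G e v)" if "rud N G" for i G
    using that rud_var[of i N] by (cases "i < N") simp_all
  show ?case
  proof (cases "\<exists>j. ?x = c j")
    case True
    then obtain j where j: "?x = c j" "?x' = c' j" using ty[of N] by auto
    \<comment> \<open>A parameter that is already an entry is simply read off from the
      sequence.\<close>
    have R: "Sg n N (\<lambda>e v. R e (\<lambda>i. if i < N then v i else vnth j e))"
      by (rule Sg_comp[OF Suc.prems(1) \<rho> rud_Const]) (intro rud_vnth rud_Const)
    have "R (vseq c) (\<lambda>i. if i < N then v i else vnth j (vseq c)) \<longleftrightarrow>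
      R (vseq c') (\<lambda>i. if i < N then v' i else vnth j (vseq c'))"
      by (rule Suc.IH[OF R c c' Suc.prems(4,5)]) (use Suc.prems(6-9) in \<open>auto simp: same_type_def\<close>)
    moreover have "R (vseq c) (\<lambda>i. if i < N then v i else vnth j (vseq c)) \<longleftrightarrow> R (vseq c) v"
      by (rule Sg_supp[OF Suc.prems(1)])
        (use vseq_least[OF c] Suc.prems(4,8) seq_mem_least[OF c] j in \<open>auto simp: vnth_vseq less_Suc_eq\<close>)
    moreover have "R (vseq c') (\<lambda>i. if i < N then v' i else vnth j (vseq c')) \<longleftrightarrow> R (vseq c') v'"
      by (rule Sg_supp[OF Suc.prems(1)])
        (use vseq_least[OF c'] Suc.prems(5,9) seq_mem_least[OF c'] j in \<open>auto simp: vnth_vseq less_Suc_eq\<close>)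
    ultimately show ?thesis by simp
  next
    case False
    let ?k = "slot c ?x"
    have k: "slot c' ?x' = ?k" using ty[of N] by (simp add: slot_def)
    from in_C(3)[of N] obtain j where j: "?x \<in> elts (c j)" "?x' \<in> elts (c' j)" using ty[of N] by auto
    have nr: "?x \<notin> range c" "?x' \<notin> range c'" using False ty[of N] by auto
    let ?d = "insert_at ?k ?x c" let ?d' = "insert_at ?k ?x' c'"
    have d: "?d \<in> increasing_seqs C" "?d' \<in> increasing_seqs C"
      using insert_at_increasing[OF c in_C(1)[of N] j(1) nr(1)] insert_at_increasing[OF c' in_C(2)[of N] j(2) nr(2)] k by auto
    have lm: "least_model T ?d = A" "least_model T ?d' = A"
      using least_model_insert_at[OF c in_C(1)[of N] j(1) nr(1)] least_model_insert_at[OF c' in_C(2)[of N] j(2) nr(2)]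
        k Suc.prems(4,5) by auto
    \<comment> \<open>From the enlarged sequence the old one is recovered by deleting entry
      \<open>?k\<close>, and the parameter is that entry; equality of types makes the slot the same
      on both sides.\<close>
    have R: "Sg n N (\<lambda>e v. R (vdel ?k e) (\<lambda>i. if i < N then v i else vnth ?k e))"
      by (rule Sg_comp[OF Suc.prems(1) \<rho>]) (intro rud_vnth rud_vdel rud_Const)+
    have st: "same_type ?d ?d' N v v'"
      unfolding same_type_def
    proof (intro conjI allI impI)
      fix i m assume i: "i < N"
      show "v i \<in> elts (?d m) \<longleftrightarrow> v' i \<in> elts (?d' m)" "v i = ?d m \<longleftrightarrow> v' i = ?d' m"
        using skip_at_surj[of m ?k] ty[of i] ty2[of i N] ty3[of i N] i by (elim disjE exE; simp)+
    next
      fix i m assume "i < N" "m < N"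
      then show "v i \<in> elts (v m) \<longleftrightarrow> v' i \<in> elts (v' m)" using ty2[of i m] by simp
    qed
    have inC: "v i \<in> C \<and> v' i \<in> C \<and> (\<exists>j. v i \<in> elts (?d j))" if "i < N" for i
      using in_C[of i] that insert_at_skip[of ?k ?x c] by (metis less_imp_le)
    have "R (vdel ?k (vseq ?d)) (\<lambda>i. if i < N then v i else vnth ?k (vseq ?d)) \<longleftrightarrow>
      R (vdel ?k (vseq ?d')) (\<lambda>i. if i < N then v' i else vnth ?k (vseq ?d'))"
      by (rule Suc.IH[OF R d lm st inC Suc.prems(8,9)])
    then have "R (vseq c) (\<lambda>i. if i < N then v i else ?x) \<longleftrightarrow> R (vseq c') (\<lambda>i. if i < N then v' i else ?x')"
      by (simp add: vdel_vseq vnth_vseq cong: if_cong)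
    moreover have "R (vseq c) (\<lambda>i. if i < N then v i else ?x) \<longleftrightarrow> R (vseq c) v"
      by (rule Sg_supp[OF Suc.prems(1)]) (use vseq_least[OF c] Suc.prems(4,8) in \<open>auto simp: less_Suc_eq\<close>)
    moreover have "R (vseq c') (\<lambda>i. if i < N then v' i else ?x') \<longleftrightarrow> R (vseq c') v'"
      by (rule Sg_supp[OF Suc.prems(1)]) (use vseq_least[OF c'] Suc.prems(5,9) in \<open>auto simp: less_Suc_eq\<close>)
    ultimately show ?thesis by simp
  qed
qed

end

subsection \<open>The auxiliary game\<close>

lemma turn_other: "turn pl m \<longleftrightarrow> (even m \<longleftrightarrow> pl = I)"
  by (cases pl) auto

locale aux_strategy = indiscernibles n T C + aux_game c B prec xi
  for n :: nat and T :: "fm set" and C :: "'v::zf_universe set" and c :: "nat \<Rightarrow> 'v"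
    and B :: "index \<Rightarrow> baire set" and prec :: "nat \<Rightarrow> nat \<Rightarrow> baire \<Rightarrow> nat rel"
    and xi :: "nat \<Rightarrow> nat \<Rightarrow> nat \<Rightarrow> nat" +
  fixes pl :: player and \<sigma> :: "(nat \<times> 'v) list \<Rightarrow> nat \<times> 'v"
  assumes c: "c \<in> increasing_seqs C"
    and gap: "\<And>i \<delta>. \<delta> \<in> elts (c i) \<Longrightarrow> gap_large C \<delta> (c i)"
    and cof: "\<And>i S. countable S \<Longrightarrow> S \<subseteq> elts (c i) \<Longrightarrow> \<exists>h\<in>C. h \<in> elts (c i) \<and> (\<forall>s\<in>S. s \<in> elts h)"
    and orders: "order_assignment B prec"
    and enum: "enumeration xi"
    and winning: "winning_strategy (aux_moves c) payoff pl \<sigma>"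
    and definable: "Sigma_definable_strategy n T c pl \<sigma>"
begin

abbreviation "A \<equiv> least_model T c"

sublocale kp_set A
  by (rule kp_set_least[OF c])

abbreviation U :: "'v set" where "U \<equiv> (\<Union>i. elts (c i))"

lemma U_A: "x \<in> U \<Longrightarrow> x \<in> elts A"
  using seq_mem_least[OF c] mem_A by blast

lemma elts_vsup_c: "elts (vsup (vseq c)) = U"
  by (rule elts_vsup_seq[OF c])

lemma c_U: "c i \<in> U"
  using seq_less[OF c, of i "Suc i"] by blast

lemma c_mono: "i \<le> j \<Longrightarrow> x \<in> elts (c i) \<Longrightarrow> x \<in> elts (c j)"
  using seq_less[OF c, of i j] vord_trans[OF vord_seq[OF c, of j]] by (cases "i = j") auto

lemma ord_C: "x \<in> C \<Longrightarrow> vord x"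
  by (rule club_class_vord[OF club])

lemma ord_c: "x \<in> elts (c i) \<Longrightarrow> vord x"
  using vord_elts[OF vord_seq[OF c]] .

subsubsection \<open>Positions\<close>

text \<open>Read backwards, the enumeration says that move \<open>m\<close> supplies the value at
  \<open>pk m\<close> of the embedding with index \<omega> * \<open>pi m\<close> +
  \<open>pb m\<close>.\<close>

definition idx :: "nat \<Rightarrow> nat \<times> nat \<times> nat" where
  "idx = inv (\<lambda>(i, a, k). xi i a k)"

definition pi :: "nat \<Rightarrow> nat" where "pi m = fst (idx m)"
definition pb :: "nat \<Rightarrow> nat" where "pb m = fst (snd (idx m))"
definition pk :: "nat \<Rightarrow> nat" where "pk m = snd (snd (idx m))"

lemma xi_idx [simp]: "xi (pi m) (pb m) (pk m) = m"
proof -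
  have "surj (\<lambda>(i, a, k). xi i a k)" using enum by (simp add: enumeration_def bij_is_surj)
  from surj_f_inv_f[OF this, of m] show ?thesis by (simp add: idx_def pi_def pb_def pk_def split_beta)
qed

lemma idx_xi [simp]: "pi (xi i a k) = i" "pb (xi i a k) = a" "pk (xi i a k) = k"
proof -
  have "inj (\<lambda>(i, a, k). xi i a k)" using enum by (simp add: enumeration_def bij_is_inj)
  from inv_f_f[OF this, of "(i, a, k)"] have "idx (xi i a k) = (i, a, k)" by (simp add: idx_def)
  then show "pi (xi i a k) = i" "pb (xi i a k) = a" "pk (xi i a k) = k" by (simp_all add: pi_def pb_def pk_def)
qed

lemma turn_xi [simp]: "turn pl (xi i a k) \<longleftrightarrow> turn pl a"
  using enum by (simp add: enumeration_def turn_other)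

lemma turn_pb: "turn pl (pb m) \<longleftrightarrow> turn pl m"
  using turn_xi[of "pi m" "pb m" "pk m"] by simp

lemma xi_mono: "strict_mono (xi i a)"
  using enum by (simp add: enumeration_def)

lemma xi_ge: "k \<le> xi i a k"
  using strict_mono_imp_increasing[OF xi_mono] .

lemma pk_le: "pk m \<le> m"
  using xi_ge[of "pk m" "pi m" "pb m"] by simp

lemma xi_zero_less: "a < b \<Longrightarrow> xi i a 0 < xi i b k"
proof -
  assume "a < b"
  then have "xi i a 0 < xi i b 0" using enum by (simp add: enumeration_def)
  also have "\<dots> \<le> xi i b k" using strict_mono_less_eq[OF xi_mono] by simp
  finally show ?thesis .
qed

text \<open>The order that the opponent's ordinals are to realize. Whole blocks are stacked by
  \<open>pi\<close> and \<open>pb\<close>, so that the blocks before a given index are an initial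
  segment.\<close>

definition lt :: "baire \<Rightarrow> nat \<Rightarrow> nat \<Rightarrow> bool" where
  "lt x m m' \<longleftrightarrow> pi m < pi m' \<or> pi m = pi m' \<and>
     (pb m < pb m' \<or> pb m = pb m' \<and> (pk m, pk m') \<in> prec (pi m) (pb m) x)"

lemma prec_linear: "strict_linear_order_on UNIV (prec i a x)"
  and prec_max: "k \<noteq> 0 \<Longrightarrow> (k, 0) \<in> prec i a x"
  and wf_prec: "wf (prec i a x) \<longleftrightarrow> x \<in> B (0, i, a)"
  using orders by (simp_all add: order_assignment_def)

lemma prec_cong:
  assumes "\<And>j. j < N \<Longrightarrow> x j = x' j" "k < N" "l < N"
  shows "(k, l) \<in> prec i a x \<longleftrightarrow> (k, l) \<in> prec i a x'"
proof -
  obtain R where R: "\<And>i a x N k l. k < N \<Longrightarrow> l < N \<Longrightarrow> (k, l) \<in> prec i a x \<longleftrightarrow> R [i, a, seg x N, k, l]"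
    using orders unfolding order_assignment_def by auto
  have "seg x N = seg x' N"
    unfolding seg_def using assms(1) by (intro arg_cong[of _ _ list_encode] map_cong) auto
  then show ?thesis using R[OF assms(2,3)] by simp
qed

lemma lt_irrefl: "\<not> lt x m m"
  using prec_linear unfolding lt_def strict_linear_order_on_def irrefl_def by simp

lemma lt_trans: "lt x m m' \<Longrightarrow> lt x m' m'' \<Longrightarrow> lt x m m''"
proof -
  have "trans (prec (pi m) (pb m) x)" using prec_linear by (simp add: strict_linear_order_on_def)
  then show "lt x m m' \<Longrightarrow> lt x m' m'' \<Longrightarrow> lt x m m''" unfolding lt_def by (auto dest: transD)
qed

lemma lt_total: "m \<noteq> m' \<Longrightarrow> lt x m m' \<or> lt x m' m"
proof -
  assume ne: "m \<noteq> m'"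
  have "total (prec (pi m) (pb m) x)" using prec_linear by (simp add: strict_linear_order_on_def)
  moreover have "pk m \<noteq> pk m'" if "pi m = pi m'" "pb m = pb m'" using ne that xi_idx[of m] xi_idx[of m'] by metis
  ultimately show ?thesis unfolding lt_def total_on_def by (metis UNIV_I linorder_neqE_nat)
qed

lemma lt_cong: "(\<And>j. j < N \<Longrightarrow> x j = x' j) \<Longrightarrow> m < N \<Longrightarrow> m' < N \<Longrightarrow> lt x m m' \<longleftrightarrow> lt x' m m'"
  unfolding lt_def using prec_cong[of N x x' "pk m" "pk m'"] pk_le[of m] pk_le[of m'] by auto

lemma lt_pi: "lt x m m' \<Longrightarrow> pi m \<le> pi m'"
  by (auto simp: lt_def)

text \<open>Induction on the block in lexicographic order, with an inner induction along
  \<open>prec\<close>. Blocks that may be ill-founded contain no element of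
  \<open>P\<close>.\<close>

lemma lt_wf:
  assumes "\<And>m. m \<in> P \<Longrightarrow> x \<in> B (0, pi m, pb m)"
  shows "wf {(m', m). m' \<in> P \<and> m \<in> P \<and> lt x m' m}"
proof (rule wfUNIVI)
  fix Q m assume *: "\<forall>m. (\<forall>m'. (m', m) \<in> {(m', m). m' \<in> P \<and> m \<in> P \<and> lt x m' m} \<longrightarrow> Q m') \<longrightarrow> Q m"
  have "\<forall>k. Q (xi i b k)" for i b
  proof (induction "(i, b)" arbitrary: i b rule: less_induct)
    case less
    show ?case
    proof (cases "x \<in> B (0, i, b)")
      case True
      then have wf: "wf (prec i b x)" by (simp add: wf_prec)
      show ?thesis
      proof
        fix k show "Q (xi i b k)"
        proof (induction k rule: wf_induct_rule[OF wf])
          case (1 k)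
          have "Q m'" if "lt x m' (xi i b k)" for m'
          proof (cases "(pi m', pb m') = (i, b)")
            case True
            then have "(pk m', k) \<in> prec i b x" using that lt_def by auto
            from 1[OF this] show ?thesis using True xi_idx[of m'] by auto
          next
            case False
            then have "(pi m', pb m') < (i, b)" using that lt_def by (auto simp: less_prod_def)
            from less[OF this] show ?thesis using xi_idx[of m'] by metis
          qed
          with * show ?case by blast
        qed
      qed
    next
      case False
      then have "xi i b k \<notin> P" for k using assms[of "xi i b k"] by auto
      with * show ?thesis by blast
    qed
  qed
  then show "Q m" using xi_idx[of m] by metis
qed

subsubsection \<open>Plays against the strategy\<close>

primrec hist :: "baire \<Rightarrow> (nat \<Rightarrow> 'v) \<Rightarrow> nat \<Rightarrow> (nat \<times> 'v) list" where
  "hist x v 0 = []"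
| "hist x v (Suc m) = hist x v m @ [if turn pl m then \<sigma> (hist x v m) else (x m, v m)]"

definition play :: "baire \<Rightarrow> (nat \<Rightarrow> 'v) \<Rightarrow> nat \<Rightarrow> nat \<times> 'v" where
  "play x v m = (if turn pl m then \<sigma> (hist x v m) else (x m, v m))"

lemma hist_play: "hist x v m = map (play x v) [0..<m]"
  by (induction m) (simp_all add: play_def)

lemma play_own: "turn pl m \<Longrightarrow> play x v m = \<sigma> (map (play x v) [0..<m])"
  by (simp add: play_def hist_play)

lemma play_other: "\<not> turn pl m \<Longrightarrow> play x v m = (x m, v m)"
  by (simp add: play_def)

lemma play_cong:
  assumes "\<And>j. j \<le> m \<Longrightarrow> \<not> turn pl j \<Longrightarrow> x j = x' j \<and> v j = v' j"
  shows "play x v m = play x' v' m"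
  using assms
proof (induction m rule: less_induct)
  case (less m)
  then have eq: "map (play x v) [0..<m] = map (play x' v') [0..<m]" by (intro map_cong refl) auto
  show ?case
  proof (cases "turn pl m")
    case True
    then show ?thesis by (simp only: play_own eq)
  next
    case False
    then show ?thesis using less.prems[of m] by (simp add: play_other)
  qed
qed

lemma play_moves: "(\<And>j. v j \<in> U) \<Longrightarrow> play x v m \<in> aux_moves c"
proof (induction m rule: less_induct)
  case (less m)
  show ?case
  proof (cases "turn pl m")
    case True
    have "map (play x v) [0..<m] \<in> lists (aux_moves c)" using less by auto
    then show ?thesis using winning True by (simp add: winning_strategy_def play_own)
  next
    case False
    then show ?thesis using less.prems by (auto simp: play_other aux_moves_def)
  qed
qed

lemma play_wins:
  assumes "\<And>j. v j \<in> U" shows "play x v \<in> payoff \<longleftrightarrow> pl = I"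
  using winning play_moves[of v x, OF assms] play_own unfolding winning_strategy_def by blast

text \<open>In contrast to \<open>play\<close>, this is a relation on given integers and ordinals,
  and as such inherits definability from the graph of \<open>\<sigma>\<close>.\<close>

definition run :: "baire \<Rightarrow> nat \<Rightarrow> (nat \<Rightarrow> 'v) \<Rightarrow> bool" where
  "run x N w \<longleftrightarrow> (\<forall>m<N. turn pl m \<longrightarrow> \<sigma> (map (\<lambda>j. (x j, w j)) [0..<m]) = (x m, w m))"

lemma run_play:
  assumes "\<And>m. m < N \<Longrightarrow> fst (play x v m) = x m" shows "run x N (\<lambda>m. snd (play x v m))"
  unfolding run_def
proof (intro allI impI)
  fix m assume m: "m < N" "turn pl m"
  have eq: "map (\<lambda>j. (x j, snd (play x v j))) [0..<m] = map (play x v) [0..<m]"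
    using assms m(1) by (intro map_cong refl) (auto simp: prod_eq_iff)
  show "\<sigma> (map (\<lambda>j. (x j, snd (play x v j))) [0..<m]) = (x m, snd (play x v m))"
    unfolding eq play_own[OF m(2), symmetric] using assms[OF m(1)] by (simp add: prod_eq_iff)
qed

lemma run_unique:
  assumes "run x N w" "\<And>m. m < N \<Longrightarrow> \<not> turn pl m \<Longrightarrow> w m = v m"
  shows "m < N \<Longrightarrow> play x v m = (x m, w m)"
proof (induction m rule: less_induct)
  case (less m)
  then have eq: "map (play x v) [0..<m] = map (\<lambda>j. (x j, w j)) [0..<m]" by (intro map_cong refl) auto
  show ?case
  proof (cases "turn pl m")
    case True
    then show ?thesis using assms(1) less.prems unfolding run_def by (simp only: play_own eq)
  next
    case False
    then show ?thesis using assms(2) less.prems by (simp add: play_other)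
  qed
qed

lemma run_cong: "(\<And>m. m < N \<Longrightarrow> w m = w' m) \<Longrightarrow> run x N w \<longleftrightarrow> run x N w'"
proof -
  assume eq: "\<And>m. m < N \<Longrightarrow> w m = w' m"
  have "map (\<lambda>j. (x j, w j)) [0..<m] = map (\<lambda>j. (x j, w' j)) [0..<m]" if "m < N" for m
    using that eq by simp
  then show ?thesis unfolding run_def using eq by (metis (no_types, lifting))
qed

lemma rud_vpos: "m \<le> N \<Longrightarrow> rud N (\<lambda>e v. vpos (map (\<lambda>j. (x j, v j)) [0..<m]))"
proof (induction m)
  case 0
  then show ?case using rud_empty by (simp add: vpos_def)
next
  case (Suc m)
  have "vpos (map (\<lambda>j. (x j, v j)) [0..<Suc m]) = vins (vpair (vnat m) (vpair (vnat (x m)) (v m)))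
     (vpos (map (\<lambda>j. (x j, v j)) [0..<m]))" for v :: "nat \<Rightarrow> 'v"
    by (simp add: vpos_snoc vins_def vmove_def)
  moreover have "rud N (\<lambda>e v. vins (vpair (vnat m) (vpair (vnat (x m)) (v m))) (vpos (map (\<lambda>j. (x j, v j)) [0..<m])))"
    using Suc by (intro rud_vins rud_vpair rud_vnat rud_var) auto
  ultimately show ?case by simp
qed

text \<open>A run is a finite conjunction of instances of the formula defining
  \<open>\<sigma>\<close>, with coded positions substituted as rudimentary functions; the integers
  of \<open>x\<close> enter as the constants \<open>vnat\<close>.\<close>

lemma run_Sg:
  assumes "N \<le> M"
  shows "\<exists>S. Sg n M S \<and> (\<forall>w. (\<forall>i. w i \<in> U) \<longrightarrow> S (vseq c) w = run x N w)"
proof -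
  obtain \<phi> where \<phi>: "\<phi> \<in> Sigma_fm n" "\<And>u w. u \<in> elts A \<Longrightarrow> w \<in> elts A \<Longrightarrow>
      A_sat T c (\<lambda>k. if k = 0 then u else w) \<phi> \<longleftrightarrow>
      (\<exists>p\<in>lists (aux_moves c). turn pl (length p) \<and> u = vpos p \<and> w = vmove (\<sigma> p))"
    using definable unfolding Sigma_definable_strategy_def by blast
  define \<rho> where "\<rho> m i = (if i = 0 then (\<lambda>(e::'v) (v::nat \<Rightarrow> 'v). vpos (map (\<lambda>j. (x j, v j)) [0..<m])) else (\<lambda>e v. vmove (x m, v m)))"
    for m i :: nat
  have \<rho>: "rud M (\<rho> m i)" if "m < N" for m i
    using that assms rud_vpos[of m M x] rud_vpair[OF rud_vnat rud_var[of m M]] by (simp add: \<rho>_def vmove_def)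
  define S where "S m = (if turn pl m then (\<lambda>e v. sat (elts A) mem e (\<lambda>i. \<rho> m i e v) \<phi>) else (\<lambda>e v. True))" for m
  have "Sg n M (S m)" if "m < N" for m
    unfolding S_def using Sg_subst[OF \<phi>(1) \<rho>[OF that] rud_Const] Sg_D0[OF D0_const[of M True]] by simp
  then have "Sg n M (\<lambda>e v. \<forall>m<N. S m e v)" by (rule Sg_All_less)
  moreover have "(\<forall>m<N. S m (vseq c) w) \<longleftrightarrow> run x N w" if w: "\<And>i. w i \<in> U" for w
  proof -
    have "S m (vseq c) w \<longleftrightarrow> (turn pl m \<longrightarrow> \<sigma> (map (\<lambda>j. (x j, w j)) [0..<m]) = (x m, w m))" if "m < N" for m
    proof (cases "turn pl m")
      case True
      let ?p = "map (\<lambda>j. (x j, w j)) [0..<m]"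
      have "\<rho> m i (vseq c) w \<in> elts A" for i
        by (rule rud_closed[OF \<rho>[OF that] vseq_least[OF c] U_A[OF w]])
      from this[of 0] this[of 1] have A: "vpos ?p \<in> elts A" "vmove (x m, w m) \<in> elts A" by (simp_all add: \<rho>_def)
      have "(\<lambda>i. \<rho> m i (vseq c) w) = (\<lambda>k. if k = 0 then vpos ?p else vmove (x m, w m))" by (auto simp: \<rho>_def)
      then have "S m (vseq c) w \<longleftrightarrow> A_sat T c (\<lambda>k. if k = 0 then vpos ?p else vmove (x m, w m)) \<phi>"
        using True by (simp add: S_def A_sat_def)
      also have "\<dots> \<longleftrightarrow> (\<exists>p\<in>lists (aux_moves c). turn pl (length p) \<and> ?p = p \<and> (x m, w m) = \<sigma> p)"
        by (simp only: \<phi>(2)[OF A] vpos_inject vmove_inject)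
      also have "\<dots> \<longleftrightarrow> \<sigma> ?p = (x m, w m)"
      proof -
        have "?p \<in> lists (aux_moves c)" using w by (auto simp: aux_moves_def)
        moreover have "turn pl (length ?p)" using True by simp
        ultimately show ?thesis by metis
      qed
      finally show ?thesis using True by simp
    qed (simp add: S_def)
    then show ?thesis by (simp add: run_def)
  qed
  ultimately show ?thesis by (intro exI[of _ "\<lambda>e v. \<forall>m<N. S m e v"] conjI allI impI) simp_all
qed

text \<open>The variables in \<open>K\<close> hold answers of \<open>\<sigma>\<close>, for which
  only membership in \<open>U\<close> is known, so they are quantified away; indiscernibility is
  applied to the remaining parameters.\<close>

lemma transfer:
  assumes S: "Sg n N S" and K: "K \<subseteq> {..<N}"
    and v: "\<And>i. v i \<in> U" "\<And>i. v' i \<in> U" "\<And>i. i < N \<Longrightarrow> i \<notin> K \<Longrightarrow> v i \<in> C \<and> v' i \<in> C"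
    and ty: "\<And>i j. i < N \<Longrightarrow> i \<notin> K \<Longrightarrow> (v i \<in> elts (c j) \<longleftrightarrow> v' i \<in> elts (c j)) \<and> (v i = c j \<longleftrightarrow> v' i = c j)"
      "\<And>i j. i < N \<Longrightarrow> i \<notin> K \<Longrightarrow> j < N \<Longrightarrow> j \<notin> K \<Longrightarrow> v i \<in> elts (v j) \<longleftrightarrow> v' i \<in> elts (v' j)"
    and ex: "\<And>i. y i \<in> U" "S (vseq c) (\<lambda>i. if i \<in> K then y i else v i)"
  shows "\<exists>y'. (\<forall>i. y' i \<in> U) \<and> S (vseq c) (\<lambda>i. if i \<in> K then y' i else v' i)"
proof -
  define E where "E e v \<longleftrightarrow> (\<exists>y. (\<forall>i\<in>K. y i \<in> elts (vsup e)) \<and> S e (\<lambda>i. if i \<in> K then y i else v i))"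
    for e and v :: "nat \<Rightarrow> 'v"
  have "Sg n N E" unfolding E_def by (rule Sg_ex_vsup_set[OF S finite_subset[OF K] K]) simp
  \<comment> \<open>Quantified places are filled with \<open>c 0\<close>, since
    \<open>indiscernible\<close> expects every parameter in \<open>C\<close>.\<close>
  define u where "u v i = (if i \<in> K then c 0 else v i)" for v :: "nat \<Rightarrow> 'v" and i
  have "E (vseq c) (u v) \<longleftrightarrow> E (vseq c) (u v')"
  proof (rule indiscernible[OF \<open>Sg n N E\<close> c c refl refl])
    show "same_type c c N (u v) (u v')"
    proof -
      \<comment> \<open>Comparisons of the dummy \<open>c 0\<close> with a parameter are already
        decided by the parameter's position relative to the sequence.\<close>
      have "c 0 \<in> elts z \<longleftrightarrow> z \<notin> elts (c 0) \<and> z \<noteq> c 0" if "z \<in> U" for z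
        using that vord_linear[OF vord_seq[OF c, of 0], of z] ord_c mem_asym[of "c 0" z] by auto
      then have "c 0 \<in> elts (v j) \<longleftrightarrow> c 0 \<in> elts (v' j)" if "j < N" "j \<notin> K" for j
        using ty(1)[OF that, of 0] v(1,2) by metis
      then show ?thesis unfolding same_type_def u_def using ty by auto
    qed
    show "u v i \<in> C \<and> u v' i \<in> C \<and> (\<exists>j. u v i \<in> elts (c j))" if "i < N" for i
      using v(1)[of i] v(3)[of i] that seq_C[OF c] c_U[of 0] by (auto simp: u_def)
    show "u v i \<in> elts A" "u v' i \<in> elts A" for i using v(1,2) c_U[of 0] U_A by (simp_all add: u_def)
  qed
  moreover have "E (vseq c) (u v)" unfolding E_def elts_vsup_c
    using ex by (intro exI[of _ y]) (simp add: u_def cong: if_cong)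
  ultimately obtain y' where y': "\<forall>i\<in>K. y' i \<in> U" "S (vseq c) (\<lambda>i. if i \<in> K then y' i else u v' i)"
    unfolding E_def elts_vsup_c by auto
  show ?thesis
  proof (intro exI[of _ "\<lambda>i. if i \<in> K then y' i else c 0"] conjI allI)
    show "(if i \<in> K then y' i else c 0) \<in> U" for i using y'(1) c_U[of 0] by simp
    have "(\<lambda>i. if i \<in> K then (if i \<in> K then y' i else c 0) else v' i) = (\<lambda>i. if i \<in> K then y' i else u v' i)"
      by (auto simp: u_def)
    then show "S (vseq c) (\<lambda>i. if i \<in> K then (if i \<in> K then y' i else c 0) else v' i)" using y'(2) by simp
  qed
qed


subsubsection \<open>Ordinals for the opponent\<close>

definition opp :: "nat \<Rightarrow> nat set" where
  "opp N = {m. m < N \<and> \<not> turn pl m}"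

text \<open>The interval below \<open>c (pi m)\<close> fixes the order type over \<open>c\<close>,
  and \<open>lt\<close> the order of the values among themselves; so good tuples for the same
  \<open>x\<close> have the same type.\<close>

definition good_on :: "baire \<Rightarrow> nat set \<Rightarrow> (nat \<Rightarrow> 'v) \<Rightarrow> bool" where
  "good_on x P v \<longleftrightarrow> (\<forall>m\<in>P. v m \<in> C \<and> v m \<in> elts (c (pi m)) \<and> (\<forall>j<pi m. c j \<in> elts (v m)) \<and>
     (\<forall>m'\<in>P. lt x m' m \<longrightarrow> v m' \<in> elts (v m)))"

definition good :: "baire \<Rightarrow> nat \<Rightarrow> (nat \<Rightarrow> 'v) \<Rightarrow> bool" where
  "good x N v \<longleftrightarrow> (\<forall>m. v m \<in> U) \<and> good_on x (opp N) v"

lemma finite_opp: "finite (opp N)"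
  by (simp add: opp_def)

lemma good_on_subset: "good_on x P v \<Longrightarrow> Q \<subseteq> P \<Longrightarrow> good_on x Q v"
  unfolding good_on_def by (simp add: subset_iff)

lemma good_mono: "good x N v \<Longrightarrow> M \<le> N \<Longrightarrow> good x M v"
  unfolding good_def by (auto simp: opp_def elim: good_on_subset)

lemma good_cong:
  assumes "\<And>j. j < N \<Longrightarrow> x j = x' j" shows "good x N v \<longleftrightarrow> good x' N v"
  unfolding good_def good_on_def using lt_cong[of N x x', OF assms] by (auto simp: opp_def)

lemma good_on_types:
  assumes "good_on x P v" "m \<in> P"
  shows "v m \<in> elts (c j) \<longleftrightarrow> pi m \<le> j" "v m \<noteq> c j" "m' \<in> P \<Longrightarrow> v m \<in> elts (v m') \<longleftrightarrow> lt x m m'"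
proof -
  have v: "v m \<in> elts (c (pi m))" "\<And>j. j < pi m \<Longrightarrow> c j \<in> elts (v m)" using assms by (auto simp: good_on_def)
  show 1: "v m \<in> elts (c j) \<longleftrightarrow> pi m \<le> j"
    using v c_mono[of "pi m" j "v m"] mem_asym[of "c j" "v m"] by (cases "pi m \<le> j") auto
  show "v m \<noteq> c j"
  proof (cases "pi m \<le> j")
    case True
    then show ?thesis using 1 by auto
  next
    case False
    then show ?thesis using v(2)[of j] by auto
  qed
  show "v m \<in> elts (v m') \<longleftrightarrow> lt x m m'" if "m' \<in> P"
  proof
    show "lt x m m' \<Longrightarrow> v m \<in> elts (v m')" using assms that by (auto simp: good_on_def)
    assume "v m \<in> elts (v m')"
    moreover from this have "m \<noteq> m'" by auto
    moreover have "v m' \<in> elts (v m)" if "lt x m' m" using that assms \<open>m' \<in> P\<close> by (auto simp: good_on_def)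
    ultimately show "lt x m m'" using lt_total[of m m' x] mem_asym[of "v m" "v m'"] by blast
  qed
qed

text \<open>Well-founded recursion: each value is an element of \<open>C\<close> above the countably
  many ordinals that it has to exceed, available by the cofinality of
  \<open>c (pi m)\<close>.\<close>

lemma embed:
  assumes wf: "wf {(m', m). m' \<in> P \<and> m \<in> P \<and> lt x m' m}"
    and base: "\<And>m. m \<in> P \<Longrightarrow> base m \<in> elts (c (pi m))"
  shows "\<exists>v. (\<forall>m. v m \<in> U) \<and> good_on x P v \<and> (\<forall>m\<in>P. base m \<in> elts (v m))"
proof -
  let ?r = "{(m', m). m' \<in> P \<and> m \<in> P \<and> lt x m' m}"
  \<comment> \<open>In the recursion \<open>cut\<close> gives unspecified values off the
    predecessors of \<open>m\<close>; the guard below \<open>c (pi m)\<close> makes them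
    harmless.\<close>
  define step where "step g m h \<longleftrightarrow> h \<in> C \<and> h \<in> elts (c (pi m)) \<and> base m \<in> elts h \<and> (\<forall>j<pi m. c j \<in> elts h) \<and>
     (\<forall>m'. g m' \<in> elts (c (pi m)) \<longrightarrow> g m' \<in> elts h)" for g :: "nat \<Rightarrow> 'v" and m and h :: 'v
  have ex: "\<exists>h. step g m h" if "m \<in> P" for g m
  proof -
    let ?S = "{base m} \<union> c ` {..<pi m} \<union> g ` {m'. g m' \<in> elts (c (pi m))}"
    have "countable ?S" by simp
    moreover have "?S \<subseteq> elts (c (pi m))" using base[OF that] seq_less[OF c] by auto
    ultimately obtain h where "h \<in> C" "h \<in> elts (c (pi m))" "\<forall>s\<in>?S. s \<in> elts h" using cof by blast
    then show ?thesis by (intro exI[of _ h]) (auto simp: step_def)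
  qed
  define H where "H g m = (SOME h. step g m h)" for g m
  define v where "v = wfrec ?r H"
  have v: "step (cut v ?r m) m (v m)" if "m \<in> P" for m
  proof -
    have "v m = H (cut v ?r m) m" unfolding v_def by (rule wfrec[OF wf])
    then show ?thesis using someI_ex[OF ex[OF that]] by (simp add: H_def)
  qed
  have vc: "v m \<in> elts (c (pi m))" if "m \<in> P" for m using v[OF that] by (simp add: step_def)
  have lt: "v m' \<in> elts (v m)" if "m \<in> P" "m' \<in> P" "lt x m' m" for m m'
  proof -
    have eq: "cut v ?r m m' = v m'" using that by (simp add: cut_def)
    have "cut v ?r m m' \<in> elts (c (pi m)) \<longrightarrow> cut v ?r m m' \<in> elts (v m)"
      using v[OF that(1)] unfolding step_def by (elim conjE) (rule spec)
    then show ?thesis unfolding eq using c_mono[OF lt_pi[OF that(3)] vc[OF that(2)]] by (rule mp)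
  qed
  let ?v = "\<lambda>m. if m \<in> P then v m else c 0"
  have "good_on x P ?v" unfolding good_on_def using v lt by (simp add: step_def)
  moreover have "?v m \<in> U" for m using vc[of m] c_U[of 0] by auto
  moreover have "\<forall>m\<in>P. base m \<in> elts (?v m)" using v by (simp add: step_def)
  ultimately show ?thesis by (intro exI[of _ ?v]) simp
qed

lemma lt_wf_finite:
  assumes "finite P" shows "wf {(m', m). m' \<in> P \<and> m \<in> P \<and> lt x m' m}"
proof (rule finite_acyclic_wf)
  have "{(m', m). m' \<in> P \<and> m \<in> P \<and> lt x m' m} \<subseteq> P \<times> P" by auto
  then show "finite {(m', m). m' \<in> P \<and> m \<in> P \<and> lt x m' m}"
    using assms by (rule finite_subset[OF _ finite_cartesian_product]) (rule assms)
  have "trans {(m', m). m' \<in> P \<and> m \<in> P \<and> lt x m' m}" by (rule transI) (auto intro: lt_trans)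
  then show "acyclic {(m', m). m' \<in> P \<and> m \<in> P \<and> lt x m' m}"
    by (intro acyclicI) (auto simp: trancl_id lt_irrefl)
qed

lemma c_nonempty: "\<exists>h. h \<in> elts (c i)"
  using cof[of "{}" i] by auto

lemma ex_good: "\<exists>v. good x N v"
proof -
  from c_nonempty have "\<forall>i. \<exists>h. h \<in> elts (c i)" ..
  then obtain base where "\<And>i. base i \<in> elts (c i)" by metis
  then have "\<exists>v. (\<forall>m. v m \<in> U) \<and> good_on x (opp N) v \<and> (\<forall>m\<in>opp N. base (pi m) \<in> elts (v m))"
    by (intro embed lt_wf_finite finite_opp)
  then show ?thesis by (auto simp: good_def)
qed

subsubsection \<open>The integer strategy\<close>

definition extend :: "nat list \<Rightarrow> baire" where
  "extend s m = (if m < length s then s ! m else 0)"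

text \<open>The integer answered by \<open>\<sigma>\<close> when the opponent's ordinals are an
  arbitrary good tuple; independence of that choice is what \<open>play_fst\<close>
  provides.\<close>

definition tau :: "nat list \<Rightarrow> nat" where
  "tau s = fst (play (extend s) (SOME v. good (extend s) (length s) v) (length s))"

definition consistent :: "baire \<Rightarrow> bool" where
  "consistent x \<longleftrightarrow> (\<forall>m. turn pl m \<longrightarrow> x m = tau (map x [0..<m]))"

lemma snd_play_U: "(\<And>j. v j \<in> U) \<Longrightarrow> snd (play x v m) \<in> U"
  using play_moves[of v x m] by (auto simp: aux_moves_def mem_Times_iff)

text \<open>Good tuples share their type, so a run against one yields a run with the same integers
  against the other. The integers \<open>x'\<close> are separate from the real \<open>x\<close> that
  governs the orderings.\<close>

lemma run_transfer:
  assumes v: "good x M v" "good x M v'" and N: "opp N \<subseteq> opp M"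
    and w: "\<And>i. w i \<in> U" "run x' N w" "\<And>m. m \<in> opp N \<Longrightarrow> w m = v m"
  obtains w' where "run x' N w'" "\<And>m. m \<in> opp N \<Longrightarrow> w' m = v' m"
proof -
  obtain S where S: "Sg n N S" and run: "\<forall>w. (\<forall>i. w i \<in> U) \<longrightarrow> S (vseq c) w = run x' N w"
    using run_Sg[OF order_refl, of N x'] by auto
  let ?K = "{m. m < N \<and> turn pl m}"
  have vU: "\<And>i. v i \<in> U" "\<And>i. v' i \<in> U" using v by (auto simp: good_def)
  have g: "good_on x (opp M) v" "good_on x (opp M) v'" using v by (auto simp: good_def)
  have o: "i \<in> opp M" if "i < N" "i \<notin> ?K" for i using N that by (auto simp: opp_def)
  have "run x' N (\<lambda>i. if i \<in> ?K then w i else v i) \<longleftrightarrow> run x' N w"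
    by (rule run_cong) (use w(3) in \<open>auto simp: opp_def\<close>)
  then have "S (vseq c) (\<lambda>i. if i \<in> ?K then w i else v i)"
    using w(1,2) vU(1) run[rule_format, of "\<lambda>i. if i \<in> ?K then w i else v i"] by simp
  have "\<exists>w'. (\<forall>i. w' i \<in> U) \<and> S (vseq c) (\<lambda>i. if i \<in> ?K then w' i else v' i)"
  proof (rule transfer[OF S _ vU])
    show "S (vseq c) (\<lambda>i. if i \<in> ?K then w i else v i)" by fact
    show "?K \<subseteq> {..<N}" by auto
    show "v i \<in> C \<and> v' i \<in> C" if "i < N" "i \<notin> ?K" for i
      using g o[OF that] by (auto simp: good_on_def)
    show "(v i \<in> elts (c j) \<longleftrightarrow> v' i \<in> elts (c j)) \<and> (v i = c j \<longleftrightarrow> v' i = c j)" if "i < N" "i \<notin> ?K" for i j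
      using good_on_types(1,2)[OF g(1) o[OF that]] good_on_types(1,2)[OF g(2) o[OF that]] by simp
    show "v i \<in> elts (v j) \<longleftrightarrow> v' i \<in> elts (v' j)" if "i < N" "i \<notin> ?K" "j < N" "j \<notin> ?K" for i j
      using good_on_types(3)[OF g(1) o[OF that(1,2)] o[OF that(3,4)]]
        good_on_types(3)[OF g(2) o[OF that(1,2)] o[OF that(3,4)]] by simp
    show "w i \<in> U" for i by (rule w(1))
  qed
  then obtain w' where w': "\<forall>i. w' i \<in> U" "S (vseq c) (\<lambda>i. if i \<in> ?K then w' i else v' i)" by auto
  show thesis
  proof (rule that)
    show "run x' N (\<lambda>i. if i \<in> ?K then w' i else v' i)"
      using w' vU(2) run[rule_format, of "\<lambda>i. if i \<in> ?K then w' i else v' i"] by simp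
    show "(if m \<in> ?K then w' m else v' m) = v' m" if "m \<in> opp N" for m using that by (auto simp: opp_def)
  qed
qed

text \<open>The integers produced by the strategy do not depend on the ordinals of the opponent.\<close>

lemma play_fst:
  assumes x: "consistent x"
  shows "good x m v \<Longrightarrow> fst (play x v m) = x m"
proof (induction m arbitrary: v rule: less_induct)
  case (less m)
  show ?case
  proof (cases "turn pl m")
    case True
    let ?s = "map x [0..<m]"
    define v0 where "v0 = (SOME v. good (extend ?s) m v)"
    have ext: "extend ?s j = x j" if "j < m" for j using that by (simp add: extend_def)
    have "good (extend ?s) m v0" unfolding v0_def by (rule someI_ex[OF ex_good])
    then have v0: "good x m v0" using good_cong[of m "extend ?s" x v0] ext by simp
    have xm: "x m = fst (play x v0 m)"
    proof -
      have "x m = fst (play (extend ?s) v0 m)" using x True by (simp add: consistent_def tau_def v0_def)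
      also have "play (extend ?s) v0 m = play x v0 m"
      proof (rule play_cong)
        fix j assume "j \<le> m" "\<not> turn pl j"
        then have "j < m" using True by (cases "j = m") auto
        then show "extend ?s j = x j \<and> v0 j = v0 j" using ext by simp
      qed
      finally show ?thesis .
    qed
    \<comment> \<open>The move at \<open>m\<close> is replaced by the integer actually answered
      against \<open>v\<close>. Transferring this run to \<open>v0\<close> shows that the same
      integer is answered there, where it is \<open>x m\<close> by definition of
      \<open>tau\<close>.\<close>
    define x' where "x' = x(m := fst (play x v m))"
    have x'_play: "play x' u j = play x u j" if "j \<le> m" for u j
      by (rule play_cong) (use that True in \<open>auto simp: x'_def\<close>)
    have fst': "fst (play x' v j) = x' j" if "j < Suc m" for j
    proof (cases "j = m")
      case True
      then show ?thesis using x'_play[of m v] by (simp add: x'_def)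
    next
      case False
      then have "j < m" using that by simp
      then show ?thesis using less.IH[of j v] good_mono[OF less.prems, of j] x'_play[of j v] False by (simp add: x'_def)
    qed
    have vU: "v i \<in> U" for i using less.prems by (simp add: good_def)
    have opp: "opp (Suc m) = opp m" using True by (auto simp: opp_def less_Suc_eq)
    obtain w where w: "run x' (Suc m) w" "\<And>j. j \<in> opp (Suc m) \<Longrightarrow> w j = v0 j"
      by (rule run_transfer[OF less.prems v0, of "Suc m" "\<lambda>m. snd (play x' v m)" x'])
        (use opp run_play[of "Suc m", OF fst'] snd_play_U[of v, OF vU] in \<open>auto simp: opp_def play_other\<close>)
    from run_unique[OF w(1), of v0 m] w(2) have "play x' v0 m = (x' m, w m)" by (auto simp: opp_def)
    then have "fst (play x v0 m) = x' m" using x'_play[of m v0] by simp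
    then show ?thesis using xm by (simp add: x'_def)
  next
    case False
    then show ?thesis by (simp add: play_other)
  qed
qed

definition ordinal :: "baire \<Rightarrow> (nat \<Rightarrow> 'v) \<Rightarrow> nat \<Rightarrow> 'v" where
  "ordinal x v m = snd (play x v m)"

lemma ordinal_U: "good x N v \<Longrightarrow> ordinal x v m \<in> U"
  unfolding ordinal_def by (rule snd_play_U) (simp add: good_def)

lemma ordinal_opp: "\<not> turn pl m \<Longrightarrow> ordinal x v m = v m"
  by (simp add: ordinal_def play_other)

lemma run_ordinal: "consistent x \<Longrightarrow> good x N v \<Longrightarrow> run x N (ordinal x v)"
  unfolding ordinal_def using run_play play_fst good_mono by (metis less_imp_le)

lemma fails_at_mono: "fails_at f N i b \<Longrightarrow> N \<le> M \<Longrightarrow> fails_at f M i b"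
  unfolding fails_at_def embeds_def by (auto dest: less_le_trans)

text \<open>Otherwise the least failing b at the shortest bad position would have the parity of the
  owner of \<open>\<sigma>\<close>, making the play badly lost for that player, against the choice
  of a winning strategy.\<close>

lemma no_failure:
  assumes v: "\<And>m. v m \<in> U" and opp: "\<And>i b. \<not> turn pl b \<Longrightarrow> \<not> fails_at (play x v) N i b"
  shows "\<not> fails_at (play x v) N i b"
proof
  let ?f = "play x v"
  assume fails: "fails_at ?f N i b"
  let ?M = "shortest_bad ?f"
  from fails have "\<exists>i b. fails_at ?f N i b" by blast
  then have M: "\<exists>i b. fails_at ?f ?M i b" "?M \<le> N"
    unfolding shortest_bad_def by (rule LeastI, rule Least_le)
  let ?b = "LEAST b. \<exists>i. fails_at ?f ?M i b"
  from M(1) have "\<exists>b i. fails_at ?f ?M i b" by blast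
  then have "\<exists>i. fails_at ?f ?M i ?b" by (rule LeastI_ex)
  then obtain j where "fails_at ?f ?M j ?b" by blast
  from fails_at_mono[OF this M(2)] opp have b: "turn pl ?b" by blast
  have "badly_lost ?f" using fails unfolding badly_lost_def fails_at_def embeds_def by blast
  then have "?f \<in> payoff \<longleftrightarrow> odd ?b" using play_moves[of v x, OF v] by (simp add: payoff_def)
  with play_wins[of v x, OF v] b show False by (simp add: turn_other)
qed

lemma real_part_play: "consistent x \<Longrightarrow> good x N v \<Longrightarrow> m < N \<Longrightarrow> real_part (play x v) m = x m"
  unfolding real_part_def by (rule play_fst) (auto elim: good_mono)

lemma embeds_good:
  assumes x: "consistent x" and v: "good x N v"
  shows "\<not> fails_at (play x v) N i b"
proof (rule no_failure)
  show "v m \<in> U" for m using v by (simp add: good_def)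
  have g: "good_on x (opp N) v" using v by (simp add: good_def)
  fix i b assume b: "\<not> turn pl b"
  have o: "xi i b k \<in> opp N" if "xi i b k < N" for k using that b by (simp add: opp_def)
  have F: "F (play x v) i b k = v (xi i b k)" for k using b by (simp add: F_def play_other)
  show "\<not> fails_at (play x v) N i b"
    unfolding fails_at_def embeds_def F not_not
  proof (intro conjI ballI impI)
    fix k assume k: "k \<in> {k. xi i b k < N}"
    then show "v (xi i b k) \<in> elts (c i)" using g o unfolding good_on_def by force
    fix l assume l: "l \<in> {k. xi i b k < N}" and "(k, l) \<in> prec i b (real_part (play x v))"
    then have "(k, l) \<in> prec i b x"
      using prec_cong[of N "real_part (play x v)" x k l i b] real_part_play[OF x v] k xi_ge[of k i b] xi_ge[of l i b] by auto
    then have "lt x (xi i b k) (xi i b l)" by (simp add: lt_def)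
    then show "v (xi i b k) \<in> elts (v (xi i b l))" using g o k l unfolding good_on_def by blast
  qed
qed

lemma ordinal_embeds:
  assumes x: "consistent x" and v: "good x N v" and k: "xi i b k < N"
  shows "ordinal x v (xi i b k) \<in> elts (c i)"
    and "xi i b l < N \<Longrightarrow> (k, l) \<in> prec i b x \<Longrightarrow> ordinal x v (xi i b k) \<in> elts (ordinal x v (xi i b l))"
proof -
  have e: "embeds {k. xi i b k < N} (prec i b (real_part (play x v))) (F (play x v) i b) (c i)"
    using embeds_good[OF x v] by (simp add: fails_at_def)
  then show "ordinal x v (xi i b k) \<in> elts (c i)" using k by (simp add: embeds_def F_def ordinal_def)
  assume l: "xi i b l < N" "(k, l) \<in> prec i b x"
  then have "(k, l) \<in> prec i b (real_part (play x v))"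
    using prec_cong[of N "real_part (play x v)" x k l i b] real_part_play[OF x v] k xi_ge[of k i b] xi_ge[of l i b] by auto
  then show "ordinal x v (xi i b k) \<in> elts (ordinal x v (xi i b l))"
    using e k l(1) by (simp add: embeds_def F_def ordinal_def)
qed

subsubsection \<open>Independence of the higher indiscernibles\<close>

text \<open>The hypothesis \<open>eq\<close> is a definable statement about two simultaneous runs
  whose opponents differ only at \<open>p\<close>, and the larger type with the extra ordinal is the
  same on both sides.\<close>

lemma ordinal_eq_transfer:
  assumes x: "consistent x" and m: "m < N" "turn pl m" "p \<in> opp N"
    and v: "good x N v" "good x N (v(p := h))" "v p \<in> elts h"
    and v': "good x N v'" "good x N (v'(p := h'))" "v' p \<in> elts h'"
    and eq: "ordinal x v m = ordinal x (v(p := h)) m"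
  shows "ordinal x v' m = ordinal x (v'(p := h')) m"
proof -
  let ?M = "Suc (2 * N)"
  have "N \<le> ?M" by simp
  from run_Sg[OF this, of x] obtain S where S: "Sg n ?M S"
    and run': "\<forall>w. (\<forall>i. w i \<in> U) \<longrightarrow> S (vseq c) w = run x N w" by blast
  have run: "S (vseq c) w = run x N w" if "\<And>i. w i \<in> U" for w using run' that by blast
  \<comment> \<open>Variables below \<open>N\<close> carry the first run, \<open>N + i\<close> the
    strategy's answer at \<open>i\<close> in the second, and \<open>2 * N\<close> the new ordinal at
    \<open>p\<close>; \<open>\<rho>\<close> reads off the second run.\<close>
  define \<rho> where "\<rho> i = (if i = p then 2 * N else if i < N then if turn pl i then N + i else i else 2 * N)" for i
  have \<rho>: "\<rho> i < ?M" for i by (simp add: \<rho>_def)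
  let ?S = "\<lambda>e u. S e u \<and> S e (\<lambda>i. u (\<rho> i)) \<and> u m = u (N + m)"
  have S': "Sg n ?M ?S"
    using m by (intro Sg_conj S Sg_comp[OF S] rud_Const rud_var \<rho> Sg_D0 D0_var_eq) auto
  let ?K = "{i. i < N \<and> turn pl i} \<union> {N..<2 * N}"
  define a where "a v h i = (if i < N then v i else h)" for v :: "nat \<Rightarrow> 'v" and h :: 'v and i
  have p: "p < N" "\<not> turn pl p" using m(3) by (auto simp: opp_def)
  have aU: "a v h i \<in> U" if "good x N v" "good x N (v(p := h))" for v h i
  proof -
    have "v i \<in> U" "(v(p := h)) p \<in> U" using that unfolding good_def by blast+
    then show ?thesis by (simp add: a_def)
  qed
  have free: "i \<in> opp N \<or> i = 2 * N" if "i < ?M" "i \<notin> ?K" for i using that by (auto simp: opp_def)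
  have ty_h: "h \<in> elts (c j) \<longleftrightarrow> pi p \<le> j" "h \<noteq> c j" "h \<in> C" if "good x N (v(p := h))" for v h j
    using good_on_types(1,2)[of x "opp N" "v(p := h)" p j] that m(3) by (auto simp: good_def good_on_def)
  have ty_v: "v i \<in> elts (c j) \<longleftrightarrow> pi i \<le> j" "v i \<noteq> c j" "v i \<in> C" if "good x N v" "i \<in> opp N" for v i j
    using good_on_types(1,2)[of x "opp N" v i j] that by (auto simp: good_def good_on_def)
  have ty_vv: "v i \<in> elts (v j) \<longleftrightarrow> lt x i j" if "good x N v" "i \<in> opp N" "j \<in> opp N" for v i j
    using good_on_types(3)[of x "opp N" v i j] that by (auto simp: good_def)
  have ty_vh: "v i \<in> elts h \<longleftrightarrow> i = p \<or> lt x i p" "h \<in> elts (v i) \<longleftrightarrow> i \<noteq> p \<and> lt x p i"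
    if "good x N v" "good x N (v(p := h))" "v p \<in> elts h" "i \<in> opp N" for v h i
    using ty_vv[OF that(2,4) m(3)] ty_vv[OF that(2) m(3) that(4)] that(3) mem_asym[of "v p" h] by (auto split: if_splits)
  have aN: "a v h i = v i" if "i \<in> opp N" for v h i using that by (simp add: a_def opp_def)
  have a2: "a v h (2 * N) = h" for v h by (simp add: a_def)
  define y where "y i = (if i < N then ordinal x v i else ordinal x (v(p := h)) (i - N))" for i
  have yU: "y i \<in> U" for i using ordinal_U[OF v(1)] ordinal_U[OF v(2)] by (simp add: y_def)
  let ?w = "\<lambda>i. if i \<in> ?K then y i else a v h i"
  have wU: "?w i \<in> U" for i using yU aU[OF v(1,2)] by simp
  have "run x N ?w \<longleftrightarrow> run x N (ordinal x v)"
    by (rule run_cong) (auto simp: y_def a_def ordinal_opp)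
  then have 1: "S (vseq c) ?w" using run[of ?w, OF wU] run_ordinal[OF x v(1)] by simp
  have "run x N (\<lambda>i. ?w (\<rho> i)) \<longleftrightarrow> run x N (ordinal x (v(p := h)))"
    by (rule run_cong) (use p in \<open>auto simp: y_def a_def \<rho>_def ordinal_opp\<close>)
  then have 2: "S (vseq c) (\<lambda>i. ?w (\<rho> i))" using run[of "\<lambda>i. ?w (\<rho> i)", OF wU] run_ordinal[OF x v(2)] by simp
  have 3: "?w m = ?w (N + m)" using m eq by (simp add: y_def)
  from 1 2 3 have 4: "?S (vseq c) ?w" by blast
  have "\<exists>y'. (\<forall>i. y' i \<in> U) \<and> ?S (vseq c) (\<lambda>i. if i \<in> ?K then y' i else a v' h' i)"
  proof (rule transfer[OF S' _ aU[OF v(1,2)] aU[OF v'(1,2)] _ _ _ yU 4])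
    show "?K \<subseteq> {..<?M}" by auto
    show "a v h i \<in> C \<and> a v' h' i \<in> C" if "i < ?M" "i \<notin> ?K" for i
      using free[OF that] ty_h(3)[OF v(2)] ty_h(3)[OF v'(2)] ty_v(3)[OF v(1)] ty_v(3)[OF v'(1)] aN[of i] a2 by auto
    show "(a v h i \<in> elts (c j) \<longleftrightarrow> a v' h' i \<in> elts (c j)) \<and> (a v h i = c j \<longleftrightarrow> a v' h' i = c j)"
      if "i < ?M" "i \<notin> ?K" for i j
      using free[OF that] ty_h(1,2)[OF v(2)] ty_h(1,2)[OF v'(2)] ty_v(1,2)[OF v(1)] ty_v(1,2)[OF v'(1)] aN[of i] a2 by auto
    show "a v h i \<in> elts (a v h j) \<longleftrightarrow> a v' h' i \<in> elts (a v' h' j)"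
      if "i < ?M" "i \<notin> ?K" "j < ?M" "j \<notin> ?K" for i j
      using free[OF that(1,2)] free[OF that(3,4)]
    proof (elim disjE)
      assume "i \<in> opp N" "j \<in> opp N"
      then show ?thesis using ty_vv[OF v(1)] ty_vv[OF v'(1)] by (simp add: aN)
    next
      assume "i \<in> opp N" "j = 2 * N"
      then show ?thesis using ty_vh(1)[OF v] ty_vh(1)[OF v'] by (simp add: aN a2)
    next
      assume "i = 2 * N" "j \<in> opp N"
      then show ?thesis using ty_vh(2)[OF v] ty_vh(2)[OF v'] by (simp add: aN a2)
    next
      assume "i = 2 * N" "j = 2 * N"
      then show ?thesis by (simp add: a2)
    qed
  qed
  then obtain y' where y': "\<forall>i. y' i \<in> U" "?S (vseq c) (\<lambda>i. if i \<in> ?K then y' i else a v' h' i)" by blast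
  let ?w' = "\<lambda>i. if i \<in> ?K then y' i else a v' h' i"
  have wU': "?w' i \<in> U" for i using y'(1) aU[OF v'(1,2)] by simp
  have r: "run x N ?w'" "run x N (\<lambda>i. ?w' (\<rho> i))"
    using y'(2) run[of ?w', OF wU'] run[of "\<lambda>i. ?w' (\<rho> i)", OF wU'] by blast+
  have "play x v' m = (x m, ?w' m)"
    by (rule run_unique[OF r(1) _ m(1)]) (simp add: a_def)
  moreover have "play x (v'(p := h')) m = (x m, ?w' (\<rho> m))"
    by (rule run_unique[OF r(2) _ m(1)]) (use p in \<open>simp add: a_def \<rho>_def\<close>)
  moreover have "\<rho> m = N + m" using m p by (auto simp: \<rho>_def)
  moreover have "?w' m = ?w' (N + m)" using y'(2) by blast
  ultimately show ?thesis by (simp add: ordinal_def)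
qed


text \<open>Each remaining position gets a base above the prescribed one and above all relevant
  values on \<open>L\<close>; \<open>embed\<close> then works above these bases.\<close>

lemma extend_good:
  assumes L: "L \<subseteq> opp N" "\<And>l m. l \<in> L \<Longrightarrow> m \<in> opp N \<Longrightarrow> lt x m l \<Longrightarrow> m \<in> L"
    and v: "good_on x L v" and base: "\<And>m. m \<in> opp N - L \<Longrightarrow> base m \<in> elts (c (pi m))"
  shows "\<exists>t. good x N t \<and> (\<forall>m\<in>L. t m = v m) \<and> (\<forall>m\<in>opp N - L. base m \<in> elts (t m))"
proof -
  let ?S = "\<lambda>m. insert (base m) (v ` {l\<in>L. v l \<in> elts (c (pi m))})"
  have "\<exists>h. h \<in> elts (c (pi m)) \<and> (\<forall>s\<in>?S m. s \<in> elts h)" if "m \<in> opp N - L" for m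
  proof -
    have "countable (?S m)" by simp
    moreover have "?S m \<subseteq> elts (c (pi m))" using base[OF that] by auto
    ultimately show ?thesis using cof by blast
  qed
  then obtain b where b: "\<And>m. m \<in> opp N - L \<Longrightarrow> b m \<in> elts (c (pi m)) \<and> (\<forall>s\<in>?S m. s \<in> elts (b m))"
    by metis
  have "finite (opp N - L)" using finite_opp by simp
  from embed[OF lt_wf_finite[OF this], of b x] b
  obtain g where g: "\<And>m. g m \<in> U" "good_on x (opp N - L) g" "\<And>m. m \<in> opp N - L \<Longrightarrow> b m \<in> elts (g m)" by blast
  let ?t = "\<lambda>m. if m \<in> L then v m else g m"
  have above: "s \<in> elts (g m)" if "m \<in> opp N - L" "s \<in> ?S m" for s m
  proof -
    have "vord (g m)" using g(2) that(1) ord_C by (auto simp: good_on_def)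
    then show ?thesis using vord_trans[of "g m" "b m" s] g(3)[OF that(1)] b[OF that(1)] that(2) by blast
  qed
  have "good_on x (opp N) ?t"
    unfolding good_on_def
  proof (intro ballI conjI impI allI)
    fix m assume m: "m \<in> opp N"
    show "?t m \<in> C" "?t m \<in> elts (c (pi m))" using v g(2) m by (auto simp: good_on_def)
    show "c j \<in> elts (?t m)" if "j < pi m" for j using v g(2) m that by (auto simp: good_on_def)
    fix m' assume m': "m' \<in> opp N" "lt x m' m"
    show "?t m' \<in> elts (?t m)"
    proof (cases "m \<in> L")
      case True
      then have "m' \<in> L" using L(2) m' by blast
      then show ?thesis using True v m' by (auto simp: good_on_def)
    next
      case False
      show ?thesis
      proof (cases "m' \<in> L")
        case True
        then have "v m' \<in> elts (c (pi m))"
          using v c_mono[OF lt_pi[OF m'(2)]] by (auto simp: good_on_def)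
        then have "v m' \<in> ?S m" using True by auto
        then show ?thesis using above[of m "v m'"] True False m by simp
      next
        case False
        then show ?thesis using \<open>m \<notin> L\<close> g(2) m m' by (auto simp: good_on_def)
      qed
    qed
  qed
  moreover have "?t m \<in> U" for m using v g(1) by (auto simp: good_on_def)
  moreover have "\<forall>m\<in>opp N - L. base m \<in> elts (?t m)" using above by auto
  ultimately show ?thesis by (intro exI[of _ ?t]) (auto simp: good_def)
qed

section \<open>Exchanging a single ordinal of the opponent\<close>

definition fits :: "nat set \<Rightarrow> (nat \<Rightarrow> 'v) \<Rightarrow> nat \<Rightarrow> 'v \<Rightarrow> bool" where
  "fits L v p h \<longleftrightarrow> h \<in> C \<and> h \<in> elts (c (pi p)) \<and> (\<forall>j<pi p. c j \<in> elts h) \<and> (\<forall>l\<in>L. v l \<in> elts h)"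

text \<open>Placing all later values above \<open>h2\<close>, the larger candidate, allows either
  candidate at \<open>p\<close> without changing the rest.\<close>

lemma extend_two:
  assumes L: "L \<subseteq> opp N" "\<And>l m. l \<in> L \<Longrightarrow> m \<in> opp N \<Longrightarrow> lt x m l \<Longrightarrow> m \<in> L"
    and p: "p \<in> opp N - L" "\<And>m. m \<in> opp N \<Longrightarrow> lt x m p \<Longrightarrow> m \<in> L"
    and v: "good_on x L v" and h: "fits L v p h1" "fits L v p h2" "h1 \<in> elts h2"
  shows "\<exists>t. good x N t \<and> good x N (t(p := h2)) \<and> (\<forall>m\<in>L. t m = v m) \<and> t p = h1 \<and>
    (\<forall>m\<in>opp N - insert p L. h2 \<in> elts (t m))"
proof -
  let ?L = "insert p L"
  have after: "lt x p m" if "m \<in> opp N - ?L" for m using that p lt_total[of p m x] by auto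
  have before: "lt x l p" if "l \<in> L" for l using that p(1) L lt_total[of l p x] by auto
  have goodL: "good_on x ?L (v(p := h))" if "fits L v p h" for h
    unfolding good_on_def
  proof (intro ballI conjI impI allI)
    fix m assume m: "m \<in> ?L"
    have pL: "p \<notin> L" using p(1) by simp
    show "(v(p := h)) m \<in> C" "(v(p := h)) m \<in> elts (c (pi m))"
      using m that v by (auto simp: good_on_def fits_def)
    show "c j \<in> elts ((v(p := h)) m)" if "j < pi m" for j
      using m \<open>fits L v p h\<close> that v by (auto simp: good_on_def fits_def)
    fix m' assume m': "m' \<in> ?L" "lt x m' m"
    show "(v(p := h)) m' \<in> elts ((v(p := h)) m)"
    proof (cases "m = p")
      case True
      then have "m' \<in> L" using m' lt_irrefl by auto
      then show ?thesis using True that pL by (auto simp: fits_def)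
    next
      case False
      then have "m \<in> L" using m by simp
      moreover from this have "m' \<noteq> p" using before[of m] lt_trans[OF m'(2), of p] lt_irrefl by blast
      ultimately show ?thesis using m' v False by (auto simp: good_on_def)
    qed
  qed
  have "\<exists>t. good x N t \<and> (\<forall>m\<in>?L. t m = (v(p := h1)) m) \<and> (\<forall>m\<in>opp N - ?L. h2 \<in> elts (t m))"
  proof (rule extend_good)
    show "?L \<subseteq> opp N" using L(1) p(1) by auto
    show "m \<in> ?L" if "l \<in> ?L" "m \<in> opp N" "lt x m l" for l m using that L(2) p(2) by auto
    show "good_on x ?L (v(p := h1))" by (rule goodL[OF h(1)])
    show "h2 \<in> elts (c (pi m))" if "m \<in> opp N - ?L" for m
      using c_mono[OF lt_pi[OF after[OF that]]] h(2) by (simp add: fits_def)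
  qed
  then obtain t where t: "good x N t" "\<And>m. m \<in> ?L \<Longrightarrow> t m = (v(p := h1)) m" "\<And>m. m \<in> opp N - ?L \<Longrightarrow> h2 \<in> elts (t m)"
    by blast
  have tg: "good_on x (opp N) t" using t(1) by (simp add: good_def)
  have "good_on x (opp N) (t(p := h2))"
    unfolding good_on_def
  proof (intro ballI conjI impI allI)
    fix m assume m: "m \<in> opp N"
    show "(t(p := h2)) m \<in> C" "(t(p := h2)) m \<in> elts (c (pi m))"
      using m h(2) tg by (auto simp: good_on_def fits_def)
    show "c j \<in> elts ((t(p := h2)) m)" if "j < pi m" for j
      using m h(2) that tg by (auto simp: good_on_def fits_def)
    fix m' assume m': "m' \<in> opp N" "lt x m' m"
    show "(t(p := h2)) m' \<in> elts ((t(p := h2)) m)"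
    proof (cases "m = p")
      case True
      then have "m' \<in> L" using m' p(2) by simp
      moreover from this have "t m' = v m'" "m' \<noteq> p" using t(2)[of m'] p(1) by auto
      ultimately show ?thesis using True h(2) by (simp add: fits_def)
    next
      case False
      show ?thesis
      proof (cases "m' = p")
        case True
        then have "m \<notin> ?L" using False m' before[of m] lt_trans[of x m p m] lt_irrefl by blast
        then show ?thesis using True False t(3)[of m] m by simp
      next
        case False
        then show ?thesis using \<open>m \<noteq> p\<close> m m' tg by (auto simp: good_on_def)
      qed
    qed
  qed
  moreover have "(t(p := h2)) m \<in> U" for m using t(1) h(2) by (auto simp: good_def fits_def)
  ultimately have "good x N (t(p := h2))" by (simp add: good_def)
  moreover have "\<forall>m\<in>L. t m = v m" using t(2) p(1) by auto
  moreover have "t p = h1" using t(2)[of p] by simp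
  ultimately show ?thesis using t(1,3) by blast
qed

text \<open>
  \<open>low\<close> are the opponent's positions whose ordinals are held fixed; the others get ordinals
  above \<open>\<delta>\<close>. By the pigeonhole principle, a value below \<open>\<delta>\<close> cannot depend on them.
\<close>

lemma ordinal_independent:
  assumes x: "consistent x" and m0: "m0 < N" "turn pl m0"
    and low: "\<And>l m. l \<in> low \<Longrightarrow> m \<in> opp N \<Longrightarrow> lt x m l \<Longrightarrow> m \<in> low"
    and \<delta>: "\<And>m. m \<in> opp N - low \<Longrightarrow> \<delta> \<in> elts (c (pi m))"
    and bounded: "\<And>v. good x N v \<Longrightarrow> (\<And>m. m \<in> opp N \<inter> low \<Longrightarrow> v m = u m) \<Longrightarrow>
      (\<And>m. m \<in> opp N - low \<Longrightarrow> \<delta> \<in> elts (v m)) \<Longrightarrow> ordinal x v m0 \<in> elts \<delta>"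
    and v: "good x N v" "\<And>m. m \<in> opp N \<inter> low \<Longrightarrow> v m = u m" "\<And>m. m \<in> opp N - low \<Longrightarrow> \<delta> \<in> elts (v m)"
    and v': "good x N v'" "\<And>m. m \<in> opp N \<inter> low \<Longrightarrow> v' m = u m" "\<And>m. m \<in> opp N - low \<Longrightarrow> \<delta> \<in> elts (v' m)"
  shows "ordinal x v m0 = ordinal x v' m0"
proof -
  define adm where "adm v \<longleftrightarrow> good x N v \<and> (\<forall>m\<in>opp N \<inter> low. v m = u m) \<and> (\<forall>m\<in>opp N - low. \<delta> \<in> elts (v m))" for v
  \<comment> \<open>Induction on the number of positions outside an initial segment \<open>L\<close>
    on which the two tuples agree.\<close>
  have main: "ordinal x v m0 = ordinal x v' m0"
    if "opp N \<inter> low \<subseteq> L" "L \<subseteq> opp N" "\<And>l m. l \<in> L \<Longrightarrow> m \<in> opp N \<Longrightarrow> lt x m l \<Longrightarrow> m \<in> L"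
      "adm v" "adm v'" "\<And>m. m \<in> L \<Longrightarrow> v m = v' m" for L v v'
    using that
  proof (induction "card (opp N - L)" arbitrary: L v v' rule: less_induct)
    case less
    note L = less.prems(1-3)
    show ?case
    proof (cases "L = opp N")
      case True
      have "play x v m0 = play x v' m0"
        by (rule play_cong) (use True less.prems(6) m0 in \<open>auto simp: opp_def\<close>)
      then show ?thesis by (simp add: ordinal_def)
    next
      case False
      then have ne: "\<exists>p. p \<in> opp N - L" using L(2) by blast
      have wf: "wf {(m', m). m' \<in> opp N \<and> m \<in> opp N \<and> lt x m' m}" by (rule lt_wf_finite[OF finite_opp])
      from ne obtain q where "q \<in> opp N - L" ..
      from wfE_min'[OF wf, of "opp N - L"] this obtain p where p: "p \<in> opp N - L"
        and min: "\<And>m. (m, p) \<in> {(m', m). m' \<in> opp N \<and> m \<in> opp N \<and> lt x m' m} \<Longrightarrow> m \<notin> opp N - L"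
        by blast
      have pmin: "m \<in> L" if "m \<in> opp N" "lt x m p" for m using that min[of m] p by simp
      have plow: "p \<in> opp N - low" using p L(1) by auto
      let ?L = "insert p L"
      have L': "opp N \<inter> low \<subseteq> ?L" "?L \<subseteq> opp N" "\<And>l m. l \<in> ?L \<Longrightarrow> m \<in> opp N \<Longrightarrow> lt x m l \<Longrightarrow> m \<in> ?L"
        using L p pmin by auto
      have "opp N - ?L \<subset> opp N - L" using p by auto
      then have card: "card (opp N - ?L) < card (opp N - L)" using finite_opp by (intro psubset_card_mono) auto
      have IH: "ordinal x w m0 = ordinal x w' m0" if "adm w" "adm w'" "\<And>m. m \<in> ?L \<Longrightarrow> w m = w' m" for w w'
        by (rule less.hyps[OF card L'(1,2) _ that]) (use L'(3) in blast)
      \<comment> \<open>By the induction hypothesis the answer depends only on \<open>L\<close> and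
        the ordinal at the next position \<open>p\<close>. It remains to compare two such ordinals,
        of which the first may be taken smaller.\<close>
      have sym: "ordinal x v m0 = ordinal x v' m0"
        if vv: "adm v" "adm v'" "\<And>m. m \<in> L \<Longrightarrow> v m = v' m" "v p \<in> elts (v' p)" for v v'
      proof -
        have g: "good_on x (opp N) v" "good_on x (opp N) v'" using vv(1,2) by (auto simp: adm_def good_def)
        have gL: "good_on x L v" using g(1) L(2) by (rule good_on_subset)
        have before: "lt x l p" if "l \<in> L" for l using that p L(3) lt_total[of l p x] by auto
        have fits_v: "fits L v p (v p)" "fits L v p (v' p)"
        proof -
          have "v l \<in> elts (v p)" "v' l \<in> elts (v' p)" if "l \<in> L" for l
            using g p L(2) before[OF that] that unfolding good_on_def by blast+
          then have "\<forall>l\<in>L. v l \<in> elts (v p)" "\<forall>l\<in>L. v l \<in> elts (v' p)" using vv(3) by simp_all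
          then show "fits L v p (v p)" "fits L v p (v' p)"
            using g p unfolding fits_def good_on_def by blast+
        qed
        have two: "\<exists>t. good x N t \<and> good x N (t(p := h2)) \<and> (\<forall>m\<in>L. t m = v m) \<and> t p = h1 \<and>
          (\<forall>m\<in>opp N - ?L. h2 \<in> elts (t m))" if h: "fits L v p h1" "fits L v p h2" "h1 \<in> elts h2" for h1 h2
        proof (rule extend_two[OF L(2) _ p _ gL h])
          show "m \<in> L" if "l \<in> L" "m \<in> opp N" "lt x m l" for l m using L(3) that by blast
          show "m \<in> L" if "m \<in> opp N" "lt x m p" for m using pmin that by blast
        qed
        have adm2: "adm t \<and> adm (t(p := h2))"
          if "good x N t" "good x N (t(p := h2))" "\<forall>m\<in>L. t m = v m" "t p = h1" "\<delta> \<in> elts h1" "h1 \<in> elts h2" "h2 \<in> C"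
            "\<forall>m\<in>opp N - ?L. h2 \<in> elts (t m)" for t h1 h2
        proof -
          have \<delta>h2: "\<delta> \<in> elts h2" using vord_trans[OF ord_C[OF that(7)] that(6,5)] .
          have "\<delta> \<in> elts (t m)" if "m \<in> opp N - ?L" for m
          proof -
            have "vord (t m)" using \<open>good x N t\<close> that ord_C by (auto simp: good_def good_on_def)
            moreover have "h2 \<in> elts (t m)" using that \<open>\<forall>m\<in>opp N - ?L. h2 \<in> elts (t m)\<close> by blast
            ultimately show ?thesis using vord_trans \<delta>h2 by blast
          qed
          moreover have "\<delta> \<in> elts (t m)" if "m \<in> L - low" for m
            using that \<open>\<forall>m\<in>L. t m = v m\<close> vv(1) L(2) by (auto simp: adm_def)
          ultimately have "\<delta> \<in> elts (t m)" if "m \<in> opp N - low" "m \<noteq> p" for m using that by blast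
          then show ?thesis
            using that(1-5) \<delta>h2 vv(1) L(1) p plow unfolding adm_def by auto
        qed
        \<comment> \<open>Everything that a candidate at \<open>p\<close> must exceed. With
          \<open>\<beta>\<close> above it, all elements of \<open>C\<close> between
          \<open>\<beta>\<close> and \<open>c (pi p)\<close> are candidates.\<close>
        let ?S = "{\<delta>} \<union> c ` {..<pi p} \<union> v ` L"
        have "?S \<subseteq> elts (c (pi p))"
          using \<delta>[OF plow] seq_less[OF c] fits_v(1) vord_trans[OF vord_seq[OF c]] unfolding fits_def by blast
        moreover have "countable ?S" using finite_subset[OF L(2) finite_opp] by (auto intro: countable_finite)
        ultimately obtain \<beta> where \<beta>: "\<beta> \<in> C" "\<beta> \<in> elts (c (pi p))" "\<forall>s\<in>?S. s \<in> elts \<beta>" using cof by blast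
        have up: "s \<in> elts h" if "s \<in> ?S" "\<beta> \<in> elts h" "h \<in> C" for s h
          using vord_trans[OF ord_C[OF that(3)] that(2)] \<beta>(3) that(1) by blast
        let ?H = "{h\<in>C. \<beta> \<in> elts h \<and> h \<in> elts (c (pi p))}"
        have fitsH: "fits L v p h" if "h \<in> ?H" for h
          using that up unfolding fits_def by blast
        have "\<exists>t. adm t \<and> (\<forall>m\<in>L. t m = v m) \<and> t p = h" if h: "h \<in> ?H" for h
        proof -
          have "{h} \<subseteq> elts (c (pi p))" using h by simp
          then obtain h' where h': "h' \<in> C" "h' \<in> elts (c (pi p))" "h \<in> elts h'" using cof[of "{h}"] by auto
          have "\<beta> \<in> elts h'" using vord_trans[OF ord_C[OF h'(1)] h'(3)] h by blast
          with h' have "h' \<in> ?H" by simp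
          from two[OF fitsH[OF h] fitsH[OF this] h'(3)]
          obtain t where t: "good x N t" "good x N (t(p := h'))" "\<forall>m\<in>L. t m = v m" "t p = h"
            "\<forall>m\<in>opp N - ?L. h' \<in> elts (t m)" by blast
          have "\<delta> \<in> elts h" using up[of \<delta> h] h by blast
          from adm2[OF t(1-4) this h'(3,1) t(5)] t(3,4) show ?thesis by blast
        qed
        then have "\<forall>h\<in>?H. \<exists>t. adm t \<and> (\<forall>m\<in>L. t m = v m) \<and> t p = h" ..
        from bchoice[OF this] obtain t where "\<forall>h\<in>?H. adm (t h) \<and> (\<forall>m\<in>L. t h m = v m) \<and> t h p = h" ..
        then have t: "adm (t h) \<and> (\<forall>m\<in>L. t h m = v m) \<and> t h p = h" if "h \<in> ?H" for h
          using that by (rule bspec)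
        have val: "ordinal x w m0 \<in> elts \<delta>" if "adm w" for w
          by (rule bounded) (use that in \<open>auto simp: adm_def\<close>)
        have "elts \<delta> \<subseteq> elts \<beta>"
        proof -
          have "\<delta> \<in> elts \<beta>" using \<beta>(3) by blast
          then show ?thesis using vord_trans[OF ord_C[OF \<beta>(1)]] by blast
        qed
        \<comment> \<open>All answers lie below \<open>\<delta>\<close> and hence below
          \<open>\<beta>\<close>, while the gap above \<open>\<beta>\<close> is too large to be
          mapped injectively there.\<close>
        then have "(\<lambda>h. ordinal x (t h) m0) ` ?H \<subseteq> elts \<beta>" using t val by blast
        with gap[OF \<beta>(2)] have "\<not> inj_on (\<lambda>h. ordinal x (t h) m0) ?H" unfolding gap_large_def by blast
        then obtain g1 g2 where g12: "g1 \<in> ?H" "g2 \<in> ?H" "g1 \<noteq> g2" "ordinal x (t g1) m0 = ordinal x (t g2) m0"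
          unfolding inj_on_def by blast
        have "\<exists>h1 h2. h1 \<in> ?H \<and> h2 \<in> ?H \<and> h1 \<in> elts h2 \<and> ordinal x (t h1) m0 = ordinal x (t h2) m0"
          using vord_linear[of g1 g2] g12 ord_C by (metis (no_types, lifting) mem_Collect_eq)
        then obtain h1 h2 where h: "h1 \<in> ?H" "h2 \<in> ?H" "h1 \<in> elts h2" "ordinal x (t h1) m0 = ordinal x (t h2) m0"
          by blast
        from two[OF fitsH[OF h(1)] fitsH[OF h(2)] h(3)]
        obtain s where s: "good x N s" "good x N (s(p := h2))" "\<forall>m\<in>L. s m = v m" "s p = h1"
          "\<forall>m\<in>opp N - ?L. h2 \<in> elts (s m)" by blast
        have "\<delta> \<in> elts h1" using up[of \<delta> h1] h(1) by blast
        with adm2[OF s(1-4) _ h(3) _ s(5)] h(2) have as: "adm s" "adm (s(p := h2))" by auto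
        \<comment> \<open>The two colliding choices came with unrelated later ordinals; the
          induction hypothesis replaces these by common ones.\<close>
        have "ordinal x s m0 = ordinal x (t h1) m0"
          by (rule IH[OF as(1)]) (use t[OF h(1)] s(3,4) in auto)
        moreover have "ordinal x (s(p := h2)) m0 = ordinal x (t h2) m0"
          by (rule IH[OF as(2)]) (use t[OF h(2)] s(3,4) p in auto)
        ultimately have eq: "ordinal x s m0 = ordinal x (s(p := h2)) m0" using h(4) by simp
        from two[OF fits_v vv(4)]
        obtain r where r: "good x N r" "good x N (r(p := v' p))" "\<forall>m\<in>L. r m = v m" "r p = v p"
          "\<forall>m\<in>opp N - ?L. v' p \<in> elts (r m)" by blast
        have "\<delta> \<in> elts (v p)" using vv(1) plow by (simp add: adm_def)
        with adm2[OF r(1-4) _ vv(4) _ r(5)] fits_v(2) have ar: "adm r" "adm (r(p := v' p))" by (auto simp: fits_def)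
        have "p \<in> opp N" using p by simp
        have "s p \<in> elts h2" "r p \<in> elts (v' p)" using s(4) h(3) r(4) vv(4) by simp_all
        \<comment> \<open>A coincidence for one increasing pair at \<open>p\<close> is carried by
          indiscernibility to the given pair.\<close>
        then have "ordinal x r m0 = ordinal x (r(p := v' p)) m0"
          using ordinal_eq_transfer[OF x m0 \<open>p \<in> opp N\<close> s(1,2) _ r(1,2) _ eq] by blast
        moreover have "ordinal x v m0 = ordinal x r m0"
          by (rule IH[OF vv(1) ar(1)]) (use r(3,4) in auto)
        moreover have "ordinal x v' m0 = ordinal x (r(p := v' p)) m0"
          by (rule IH[OF vv(2) ar(2)]) (use r(3) vv(3) p in auto)
        ultimately show ?thesis by simp
      qed
      have "vord (v p)" "vord (v' p)"
        using less.prems(4,5) p ord_C by (auto simp: adm_def good_def good_on_def)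
      then consider "v p \<in> elts (v' p)" | "v p = v' p" | "v' p \<in> elts (v p)" using vord_linear by blast
      then show ?thesis
      proof cases
        case 1
        with sym less.prems(4-6) show ?thesis by blast
      next
        case 2
        with less.prems(4-6) show ?thesis by (intro IH) auto
      next
        case 3
        with sym[OF less.prems(5,4)] less.prems(6) show ?thesis by metis
      qed
    qed
  qed
  show ?thesis
    by (rule main[of "opp N \<inter> low"]) (use low v v' in \<open>auto simp: adm_def\<close>)
qed


subsubsection \<open>The strategy wins\<close>

lemma wf_own:
  assumes x: "consistent x" and b: "turn pl b" and below: "\<And>i' b'. (i', b') < (i, b) \<Longrightarrow> x \<in> B (0, i', b')"
  shows "x \<in> B (0, i, b)"
proof -
  \<comment> \<open>These blocks have well-founded orderings by \<open>below\<close>, so one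
    infinite tuple \<open>u\<close> serves them at every stage.\<close>
  define low where "low = {m. \<not> turn pl m \<and> (pi m, pb m) < (i, b)}"
  have low_down: "m \<in> low" if "l \<in> low" "m \<in> opp N" "lt x m l" for l m N
    using that by (auto simp: low_def opp_def lt_def less_prod_simp)
  have "wf {(m', m). m' \<in> low \<and> m \<in> low \<and> lt x m' m}"
    by (rule lt_wf) (use below in \<open>auto simp: low_def\<close>)
  moreover from c_nonempty have "\<forall>i. \<exists>h. h \<in> elts (c i)" ..
  then obtain base where "\<And>i. base i \<in> elts (c i)" by metis
  ultimately have "\<exists>u. (\<forall>m. u m \<in> U) \<and> good_on x low u \<and> (\<forall>m\<in>low. base (pi m) \<in> elts (u m))"
    by (intro embed)
  then obtain u where u: "good_on x low u" by blast
  have high: "i < pi m \<or> i = pi m \<and> b < pb m" if "m \<in> opp N - low" for m N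
  proof -
    have "\<not> (pi m, pb m) < (i, b)" "pb m \<noteq> b" using that b turn_pb[of m] by (auto simp: low_def opp_def)
    then show ?thesis by (auto simp: less_prod_simp)
  qed
  define adm where "adm \<delta> N v \<longleftrightarrow> good x N v \<and> (\<forall>m\<in>opp N \<inter> low. v m = u m) \<and> (\<forall>m\<in>opp N - low. \<delta> \<in> elts (v m))"
    for \<delta> N v
  have ex_adm: "\<exists>v. adm \<delta> N v" if "\<And>m. m \<in> opp N - low \<Longrightarrow> \<delta> \<in> elts (c (pi m))" for \<delta> N
  proof -
    have "\<exists>t. good x N t \<and> (\<forall>m\<in>opp N \<inter> low. t m = u m) \<and> (\<forall>m\<in>opp N - opp N \<inter> low. \<delta> \<in> elts (t m))"
    proof (rule extend_good)
      show "m \<in> opp N \<inter> low" if "l \<in> opp N \<inter> low" "m \<in> opp N" "lt x m l" for l m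
        using that low_down by blast
      show "good_on x (opp N \<inter> low) u" by (rule good_on_subset[OF u]) simp
      show "\<delta> \<in> elts (c (pi m))" if "m \<in> opp N - opp N \<inter> low" for m using \<open>\<And>m. m \<in> opp N - low \<Longrightarrow> \<delta> \<in> elts (c (pi m))\<close> that by blast
    qed simp
    then show ?thesis by (auto simp: adm_def)
  qed
  have indep: "ordinal x v m = ordinal x v' m"
    if "m < N" "turn pl m" "\<And>m. m \<in> opp N - low \<Longrightarrow> \<delta> \<in> elts (c (pi m))"
      "\<And>v. adm \<delta> N v \<Longrightarrow> ordinal x v m \<in> elts \<delta>" "adm \<delta> N v" "adm \<delta> N v'" for m N \<delta> v v'
  proof (rule ordinal_independent[OF x that(1,2), of low \<delta> u])
    show "m' \<in> low" if "l \<in> low" "m' \<in> opp N" "lt x m' l" for l m' using low_down that .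
    show "\<delta> \<in> elts (c (pi m))" if "m \<in> opp N - low" for m using \<open>\<And>m. m \<in> opp N - low \<Longrightarrow> \<delta> \<in> elts (c (pi m))\<close> that .
    show "ordinal x v m \<in> elts \<delta>" if "good x N v" "\<And>m. m \<in> opp N \<inter> low \<Longrightarrow> v m = u m"
      "\<And>m. m \<in> opp N - low \<Longrightarrow> \<delta> \<in> elts (v m)" for v
      by (rule \<open>\<And>v. adm \<delta> N v \<Longrightarrow> ordinal x v m \<in> elts \<delta>\<close>) (use that in \<open>simp add: adm_def\<close>)
  qed (use that(5,6) in \<open>auto simp: adm_def\<close>)
  let ?m = "xi i b 0"
  have own: "turn pl (xi i b k)" for k using b by simp
  \<comment> \<open>When the maximal element is assigned its ordinal, the later blocks with the same
    \<open>i\<close> have not begun, by the enumeration. Every unfrozen opposing position seen so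
    far belongs to a larger \<open>i\<close> and lies above \<open>c i\<close>, so
    \<open>c i\<close> bounds the first pigeonhole argument.\<close>
  have above: "i < pi m" if "m \<in> opp (Suc ?m) - low" for m
  proof (rule ccontr)
    assume "\<not> i < pi m"
    with high[OF that] have "pi m = i" "b < pb m" by auto
    from xi_zero_less[OF this(2), of i "pk m"] xi_idx[of m] \<open>pi m = i\<close> have "?m < m" by simp
    moreover have "m \<le> ?m" using that by (auto simp: opp_def)
    ultimately show False by simp
  qed
  have ci: "c i \<in> elts (c (pi m))" if "m \<in> opp (Suc ?m) - low" for m
    by (rule seq_less[OF c above[OF that]])
  from ex_adm[OF ci] obtain v0 where v0: "adm (c i) (Suc ?m) v0" by blast
  define \<alpha> where "\<alpha> = ordinal x v0 ?m"
  have bound: "ordinal x v ?m \<in> elts (c i)" if "adm (c i) (Suc ?m) v" for v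
    by (rule ordinal_embeds(1)[OF x, of "Suc ?m"]) (use that in \<open>simp_all add: adm_def\<close>)
  have \<alpha>: "ordinal x v ?m = \<alpha>" if "adm (c i) (Suc ?m) v" for v
    unfolding \<alpha>_def by (rule indep[OF _ own ci bound that v0]) simp
  have "{\<alpha>} \<subseteq> elts (c i)" using bound[OF v0] by (simp add: \<alpha>_def)
  \<comment> \<open>As 0 is the maximum of the ordering, all its other values lie below
    \<open>\<alpha>\<close>, hence below \<open>\<delta>\<close>. Later blocks with the same
    \<open>i\<close> still fit between \<open>\<delta>\<close> and \<open>c i\<close>, so one bound
    serves all stages.\<close>
  then obtain \<delta> where \<delta>: "\<delta> \<in> C" "\<delta> \<in> elts (c i)" "\<alpha> \<in> elts \<delta>" using cof[of "{\<alpha>}" i] by auto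
  have \<delta>c: "\<delta> \<in> elts (c (pi m))" if "m \<in> opp N - low" for m N
    using c_mono[OF _ \<delta>(2), of "pi m"] high[OF that] by auto
  have ex_adm\<delta>: "\<exists>v. adm \<delta> N v" for N by (rule ex_adm) (rule \<delta>c)
  have adm_mono: "adm \<delta> M v" if "adm \<delta> N v" "M \<le> N" for M N v
  proof -
    have "opp M \<subseteq> opp N" using that(2) by (auto simp: opp_def)
    then show ?thesis using that good_mono[of x N v M] unfolding adm_def by blast
  qed
  have adm_ci: "adm (c i) (Suc ?m) v" if "adm \<delta> (Suc ?m) v" for v
  proof -
    have "c i \<in> elts (v m)" if "m \<in> opp (Suc ?m) - low" for m
      using \<open>adm \<delta> (Suc ?m) v\<close> that above[OF that] by (auto simp: adm_def good_def good_on_def)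
    then show ?thesis using that by (auto simp: adm_def)
  qed
  have le: "?m \<le> xi i b k" for k using strict_mono_less_eq[OF xi_mono] by simp
  have small: "ordinal x v (xi i b k) \<in> elts \<delta>" if v: "adm \<delta> (Suc (xi i b k)) v" for v k
  proof -
    have a: "ordinal x v ?m = \<alpha>" by (rule \<alpha>[OF adm_ci[OF adm_mono[OF v]]]) (simp add: le)
    show ?thesis
    proof (cases "k = 0")
      case True
      then show ?thesis using a \<delta>(3) by simp
    next
      case False
      have g: "good x (Suc (xi i b k)) v" using v by (simp add: adm_def)
      have "ordinal x v (xi i b k) \<in> elts \<alpha>"
        using ordinal_embeds(2)[OF x g _ _ prec_max[OF False, of i b x]] le[of k] a by simp
      then show ?thesis using vord_trans[OF ord_C[OF \<delta>(1)] \<delta>(3)] by blast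
    qed
  qed
  \<comment> \<open>The value at stage \<open>k\<close> is computed from an arbitrary admissible
    tuple just long enough; longer ones give the same value.\<close>
  define g where "g k = ordinal x (SOME v. adm \<delta> (Suc (xi i b k)) v) (xi i b k)" for k
  have g: "ordinal x v (xi i b k) = g k" if "adm \<delta> N v" "xi i b k < N" for v k N
  proof -
    have some: "adm \<delta> (Suc (xi i b k)) (SOME v. adm \<delta> (Suc (xi i b k)) v)"
      by (rule someI_ex[OF ex_adm\<delta>])
    have adm: "adm \<delta> (Suc (xi i b k)) v" by (rule adm_mono[OF that(1)]) (use that(2) in simp)
    show ?thesis unfolding g_def
    proof (rule indep[OF _ own _ _ adm some])
      show "\<delta> \<in> elts (c (pi m))" if "m \<in> opp (Suc (xi i b k)) - low" for m by (rule \<delta>c[OF that])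
      show "ordinal x w (xi i b k) \<in> elts \<delta>" if "adm \<delta> (Suc (xi i b k)) w" for w by (rule small[OF that])
    qed simp
  qed
  \<comment> \<open>Both values occur in a single admissible play of sufficient length, where they
    are correctly ordered.\<close>
  have "(k, l) \<in> inv_image {(y, z). y \<in> elts z} g" if "(k, l) \<in> prec i b x" for k l
  proof -
    let ?N = "Suc (max (xi i b k) (xi i b l))"
    from ex_adm\<delta>[of ?N] obtain v where v: "adm \<delta> ?N v" by blast
    then have "good x ?N v" by (simp add: adm_def)
    from ordinal_embeds(2)[OF x this _ _ that] have "ordinal x v (xi i b k) \<in> elts (ordinal x v (xi i b l))"
      by simp
    then show ?thesis using g[OF v] by simp
  qed
  then have "prec i b x \<subseteq> inv_image {(y, z). y \<in> elts z} g" by auto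
  then have "wf (prec i b x)" by (rule wf_subset[OF wf_inv_image[OF foundation]])
  then show ?thesis by (simp add: wf_prec)
qed

text \<open>A single infinite good tuple exists, and every condition on the embeddings concerns
  finitely many moves; hence the play is not badly lost, because no finite stage fails.\<close>

lemma all_well_ordered:
  assumes x: "consistent x" and all: "\<And>i b. x \<in> B (0, i, b)"
  shows "x \<in> B (1, 0, 0) \<longleftrightarrow> pl = I"
proof -
  let ?P = "{m. \<not> turn pl m}"
  have "wf {(m', m). m' \<in> ?P \<and> m \<in> ?P \<and> lt x m' m}" by (rule lt_wf) (rule all)
  moreover from c_nonempty have "\<forall>i. \<exists>h. h \<in> elts (c i)" ..
  then obtain base where "\<And>i. base i \<in> elts (c i)" by metis
  ultimately have "\<exists>v. (\<forall>m. v m \<in> U) \<and> good_on x ?P v \<and> (\<forall>m\<in>?P. base (pi m) \<in> elts (v m))"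
    by (intro embed)
  then obtain v where v: "\<And>m. v m \<in> U" "good_on x ?P v" by blast
  have good: "good x N v" for N
    using v(1) good_on_subset[OF v(2), of "opp N"] by (auto simp: good_def opp_def)
  let ?f = "play x v"
  have real: "real_part ?f = x"
  proof
    fix m show "real_part ?f m = x m" by (rule real_part_play[OF x good[of "Suc m"]]) simp
  qed
  have "embeds UNIV (prec i b (real_part ?f)) (F ?f i b) (c i)" for i b
    unfolding embeds_def
  proof (intro conjI ballI impI)
    fix k
    have "\<not> fails_at ?f (Suc (xi i b k)) i b" by (rule embeds_good[OF x good])
    then show "F ?f i b k \<in> elts (c i)" unfolding fails_at_def embeds_def by simp
    fix l assume "(k, l) \<in> prec i b (real_part ?f)"
    moreover have "\<not> fails_at ?f (Suc (max (xi i b k) (xi i b l))) i b" by (rule embeds_good[OF x good])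
    ultimately show "F ?f i b k \<in> elts (F ?f i b l)" unfolding fails_at_def embeds_def by simp
  qed
  then have "\<not> badly_lost ?f" by (simp add: badly_lost_def)
  then have "?f \<in> payoff \<longleftrightarrow> x \<in> B (1, 0, 0)" using play_moves[of v x, OF v(1)] by (simp add: payoff_def real)
  then show ?thesis using play_wins[of v x, OF v(1)] by simp
qed

theorem tau_wins:
  assumes "diff_witness \<Gamma> X B" shows "winning_strategy UNIV X pl tau"
  unfolding winning_strategy_def
proof (intro conjI ballI impI allI)
  fix x :: baire assume "(\<forall>m. x m \<in> UNIV) \<and> (\<forall>m. turn pl m \<longrightarrow> x m = tau (map x [0..<m]))"
  then have x: "consistent x" by (simp add: consistent_def)
  define P where "P \<beta> \<longleftrightarrow> \<beta> \<le> (1, 0, 1) \<and> x \<notin> B \<beta>" for \<beta> :: index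
  define L where "L = (LEAST \<beta>. P \<beta>)"
  have last: "B (1, 0, 1) = {}" and X: "x \<in> X \<longleftrightarrow> odd_index L"
    using assms by (simp_all add: diff_witness_def L_def P_def)
  have "P (1, 0, 1)" using last by (simp add: P_def)
  then have PL: "P L" unfolding L_def by (rule LeastI)
  have below: "x \<in> B \<beta>" if "\<beta> < L" for \<beta>
  proof -
    have "\<not> P \<beta>" using not_less_Least[of \<beta> P] that by (simp add: L_def)
    moreover have "\<beta> \<le> (1, 0, 1)" using that PL by (auto simp: P_def)
    ultimately show ?thesis by (simp add: P_def)
  qed
  obtain e i b where L: "L = (e, i, b)" by (rule prod_cases3)
  show "x \<in> X \<longleftrightarrow> pl = I"
  proof (cases "e = 0")
    case True
    \<comment> \<open>The first failing index cannot have the parity of the owner of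
      \<open>tau\<close>, and the opposite parity is the one with which the owner wins.\<close>
    have "\<not> turn pl b"
    proof
      assume b: "turn pl b"
      have "x \<in> B (0, i, b)"
        by (rule wf_own[OF x b]) (rule below, simp add: L True less_prod_simp)
      then show False using PL by (simp add: P_def L True)
    qed
    then show ?thesis unfolding X by (auto simp: odd_index_def L turn_other)
  next
    case False
    \<comment> \<open>Here the parity of \<open>L\<close> only says whether \<open>x\<close> belongs
      to the set with index \<omega> * \<omega>, which is also what decides the auxiliary
      play.\<close>
    have all: "x \<in> B (0, i', b')" for i' b'
      by (rule below) (use False in \<open>simp add: L less_prod_simp\<close>)
    have "L \<le> (1, 0, 1)" using PL by (simp add: P_def)
    then consider "L = (1, 0, 0)" | "L = (1, 0, 1)"
      using False by (auto simp: L less_eq_prod_simp le_Suc_eq)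
    then show ?thesis
    proof cases
      case 1
      then have "x \<notin> B (1, 0, 0)" using PL by (simp add: P_def)
      then show ?thesis unfolding X using all_well_ordered[OF x all] 1 by (simp add: odd_index_def)
    next
      case 2
      then have "x \<in> B (1, 0, 0)" by (intro below) (simp add: less_prod_simp)
      then show ?thesis unfolding X using all_well_ordered[OF x all] 2 by (simp add: odd_index_def)
    qed
  qed
qed simp

end

theorem theorem1p2:
  fixes \<Gamma> :: "baire set set" and T :: "fm set" and C :: "'v::zf_universe set" and n :: nat
  assumes "arithmetic_pointclass \<Gamma>"
    and "theory_extending_KP TYPE('v) T"
    and "generating_indiscernibles n T C"
    and "\<And>c W. c \<in> increasing_seqs C \<Longrightarrow> W \<in> Gamma_tilde \<Gamma> c \<Longrightarrow>
           \<exists>pl \<sigma>. winning_strategy (aux_moves c) W pl \<sigma> \<and> Sigma_definable_strategy n T c pl \<sigma>"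
  shows "Det (omega2_Pi11_plus \<Gamma>)"
  unfolding Det_def
proof
  fix X assume "X \<in> omega2_Pi11_plus \<Gamma>"
  then obtain B where B: "diff_witness \<Gamma> X B" by (auto simp: omega2_Pi11_plus_def)
  then have "uniformly_Pi11 B" by (simp add: diff_witness_def)
  \<comment> \<open>The assumption speaks only of auxiliary games, so suitable orderings and an
    enumeration must exist before it can be applied to \<open>X\<close>.\<close>
  from ex_order_assignment[OF this] obtain prec where prec: "order_assignment B prec" ..
  from ex_enumeration obtain xi where xi: "enumeration xi" ..
  interpret indiscernibles n T C by (rule indiscernibles.intro[OF assms(2,3)])
  obtain c where c: "c \<in> increasing_seqs C"
    "\<And>i \<delta>. \<delta> \<in> elts (c i) \<Longrightarrow> gap_large C \<delta> (c i)"
    "\<And>i S. countable S \<Longrightarrow> S \<subseteq> elts (c i) \<Longrightarrow> \<exists>h\<in>C. h \<in> elts (c i) \<and> (\<forall>s\<in>S. s \<in> elts h)"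
    using ex_spacious_seq[OF club] by metis
  have "aux_game.payoff c B prec xi \<in> Gamma_tilde \<Gamma> c"
    using B prec xi unfolding Gamma_tilde_def by blast
  from assms(4)[OF c(1) this] obtain pl \<sigma> where \<sigma>:
    "winning_strategy (aux_moves c) (aux_game.payoff c B prec xi) pl \<sigma>" "Sigma_definable_strategy n T c pl \<sigma>" by blast
  interpret aux_strategy n T C c B prec xi pl \<sigma>
    by unfold_locales (fact c(1), fact c(2), fact c(3), fact prec, fact xi, fact \<sigma>(1), fact \<sigma>(2))
  show "\<exists>pl \<tau>. winning_strategy UNIV X pl \<tau>" using tau_wins[OF B] by blast
qed

end
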